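(* Let $n\geq 2$, let $\{\lambda_{i,jk} : 1\leq i\leq k,\ 1\leq j<k\leq n\}\subseteq\mathbb{T}$, and let $\sigma$ be the two-cocycle of $G(n)$ $$\sigma(r,s)=\prod_{1\leq i<j<k\leq n}\lambda_{i,jk}^{s_{jk}r_i+s_kr_{ij}}\,\lambda_{j,ik}^{s_{ik}r_j+s_k(r_ir_j-r_{ij})}\cdot\prod_{1\leq j<k\leq n}\lambda_{j,jk}^{s_{jk}r_j+\frac{1}{2}s_kr_j(r_j-1)}\,\lambda_{k,jk}^{r_k(s_{jk}+r_js_k)+\frac{1}{2}r_js_k(s_k-1)}.$$ The following are equivalent: (i) $C^*(G(n),\sigma)$ is simple. (ii) $C^*(G(n),\sigma)$ has trivial center. (iii) There are no nontrivial central $\sigma$-regular elements in $G(n)$.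
   Context: $G(n)$ is the free nilpotent group of class $2$ and rank $n$, realized as the set of integer tuples $r=(r_1,\dotsc,r_n,(r_{jk})_{1\leq j<k\leq n})$ with multiplication $(rs)_i=r_i+s_i$ and $(rs)_{jk}=r_{jk}+s_{jk}+r_js_k$. Its center consists of the elements with $r_1=\dots=r_n=0$. A two-cocycle of a discrete group $G$ is a function $\sigma\colon G\times G\to\mathbb{T}$ with $\sigma(r,s)\sigma(rs,t)=\sigma(r,st)\sigma(s,t)$ and $\sigma(r,e)=\sigma(e,r)=1$. $C^*(G,\sigma)$ denotes the full twisted group $C^*$-algebra: the universal $C^*$-algebra generated by unitaries $i_\sigma(r)$, $r\in G$, with $i_\sigma(r)i_\sigma(s)=\sigma(r,s)i_\sigma(rs)$. An element $r\in G$ is $\sigma$-regular if $\sigma(r,s)=\sigma(s,r)$ whenever $s\in G$ commutes with $r$. "Trivial center" means the center is $\mathbb{C}I$. *)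

theory Defs
  imports Complex_Main "HOL-Algebra.Module" "HOL-Algebra.Ideal"
begin

section \<open>Complex *-algebras and C*-algebras\<close>

text \<open>Unital complex *-algebras with explicit carriers, on top of the ring records of
  HOL-Algebra; the scalars are the elements of the type \<^typ>\<open>complex\<close>.\<close>

record 'a star_struct = "(complex, 'a) module" +
  star :: "'a \<Rightarrow> 'a"

record 'a cstar_struct = "'a star_struct" +
  nrm :: "'a \<Rightarrow> real"

locale star_alg = ring A for A :: "('a, 'm) star_struct_scheme" (structure) +
  assumes smult_closed [simp, intro]: "x \<in> carrier A \<Longrightarrow> c \<odot> x \<in> carrier A"
    and smult_l_distr: "x \<in> carrier A \<Longrightarrow> (c + d) \<odot> x = (c \<odot> x) \<oplus> (d \<odot> x)"
    and smult_r_distr: "x \<in> carrier A \<Longrightarrow> y \<in> carrier A \<Longrightarrow> c \<odot> (x \<oplus> y) = (c \<odot> x) \<oplus> (c \<odot> y)"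
    and smult_assoc1: "x \<in> carrier A \<Longrightarrow> (c * d) \<odot> x = c \<odot> (d \<odot> x)"
    and smult_one [simp]: "x \<in> carrier A \<Longrightarrow> 1 \<odot> x = x"
    and smult_mult_l: "x \<in> carrier A \<Longrightarrow> y \<in> carrier A \<Longrightarrow> (c \<odot> x) \<otimes> y = c \<odot> (x \<otimes> y)"
    and smult_mult_r: "x \<in> carrier A \<Longrightarrow> y \<in> carrier A \<Longrightarrow> x \<otimes> (c \<odot> y) = c \<odot> (x \<otimes> y)"
    and star_closed [simp, intro]: "x \<in> carrier A \<Longrightarrow> star A x \<in> carrier A"
    and star_star: "x \<in> carrier A \<Longrightarrow> star A (star A x) = x"
    and star_add: "x \<in> carrier A \<Longrightarrow> y \<in> carrier A \<Longrightarrow> star A (x \<oplus> y) = star A x \<oplus> star A y"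
    and star_smult: "x \<in> carrier A \<Longrightarrow> star A (c \<odot> x) = cnj c \<odot> star A x"
    and star_mult: "x \<in> carrier A \<Longrightarrow> y \<in> carrier A \<Longrightarrow> star A (x \<otimes> y) = star A y \<otimes> star A x"

definition cstar_seminorm :: "('a, 'm) star_struct_scheme \<Rightarrow> ('a \<Rightarrow> real) \<Rightarrow> bool" where
  "cstar_seminorm A p \<longleftrightarrow>
     (\<forall>x\<in>carrier A. 0 \<le> p x) \<and>
     (\<forall>x\<in>carrier A. \<forall>y\<in>carrier A. p (x \<oplus>\<^bsub>A\<^esub> y) \<le> p x + p y) \<and>
     (\<forall>c. \<forall>x\<in>carrier A. p (c \<odot>\<^bsub>A\<^esub> x) = cmod c * p x) \<and>
     (\<forall>x\<in>carrier A. \<forall>y\<in>carrier A. p (x \<otimes>\<^bsub>A\<^esub> y) \<le> p x * p y) \<and>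
     (\<forall>x\<in>carrier A. p (star A x \<otimes>\<^bsub>A\<^esub> x) = (p x)\<^sup>2)"

definition cauchy_seqs :: "('a, 'm) star_struct_scheme \<Rightarrow> ('a \<Rightarrow> real) \<Rightarrow> (nat \<Rightarrow> 'a) set" where
  "cauchy_seqs A p = {X. (\<forall>k. X k \<in> carrier A) \<and>
     (\<forall>e>0. \<exists>N. \<forall>m\<ge>N. \<forall>k\<ge>N. p (X m \<ominus>\<^bsub>A\<^esub> X k) < e)}"

locale cstar_alg = star_alg A for A :: "('a, 'm) cstar_struct_scheme" (structure) +
  assumes nrm_cstar: "cstar_seminorm A (nrm A)"
    and nrm_zero_imp: "x \<in> carrier A \<Longrightarrow> nrm A x = 0 \<Longrightarrow> x = \<zero>"
    and nrm_complete: "X \<in> cauchy_seqs A (nrm A) \<Longrightarrow>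
      \<exists>x\<in>carrier A. (\<lambda>k. nrm A (X k \<ominus> x)) \<longlonglongrightarrow> 0"

definition star_hom :: "('a, 'm) star_struct_scheme \<Rightarrow> ('b, 'k) star_struct_scheme \<Rightarrow> ('a \<Rightarrow> 'b) \<Rightarrow> bool" where
  "star_hom A B h \<longleftrightarrow> h \<in> ring_hom A B \<and>
     (\<forall>c. \<forall>x\<in>carrier A. h (c \<odot>\<^bsub>A\<^esub> x) = c \<odot>\<^bsub>B\<^esub> h x) \<and>
     (\<forall>x\<in>carrier A. h (star A x) = star B (h x))"

definition unitary_elem :: "('a, 'm) star_struct_scheme \<Rightarrow> 'a \<Rightarrow> bool" where
  "unitary_elem A u \<longleftrightarrow> u \<in> carrier A \<and>
     star A u \<otimes>\<^bsub>A\<^esub> u = \<one>\<^bsub>A\<^esub> \<and> u \<otimes>\<^bsub>A\<^esub> star A u = \<one>\<^bsub>A\<^esub>"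

definition closed_in :: "('a, 'm) cstar_struct_scheme \<Rightarrow> 'a set \<Rightarrow> bool" where
  "closed_in A I \<longleftrightarrow> (\<forall>X x. (\<forall>k. X k \<in> I) \<and> x \<in> carrier A \<and>
      (\<lambda>k. nrm A (X k \<ominus>\<^bsub>A\<^esub> x)) \<longlonglongrightarrow> 0 \<longrightarrow> x \<in> I)"

text \<open>Ideals are two-sided.  All algebras here are unital, so ring ideals are complex subspaces.\<close>

definition simple_cstar :: "('a, 'm) cstar_struct_scheme \<Rightarrow> bool" where
  "simple_cstar A \<longleftrightarrow> carrier A \<noteq> {\<zero>\<^bsub>A\<^esub>} \<and>
     (\<forall>I. ideal I A \<and> closed_in A I \<longrightarrow> I = {\<zero>\<^bsub>A\<^esub>} \<or> I = carrier A)"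

definition mult_center :: "('a, 'm) monoid_scheme \<Rightarrow> 'a set" where
  "mult_center M = {z \<in> carrier M. \<forall>x\<in>carrier M. z \<otimes>\<^bsub>M\<^esub> x = x \<otimes>\<^bsub>M\<^esub> z}"

definition trivial_center :: "('a, 'm) cstar_struct_scheme \<Rightarrow> bool" where
  "trivial_center A \<longleftrightarrow> mult_center A = {c \<odot>\<^bsub>A\<^esub> \<one>\<^bsub>A\<^esub> | c. True}"


section \<open>Enveloping C*-algebras\<close>

text \<open>The Hausdorff completion of a *-algebra for a C*-seminorm: Cauchy sequences modulo
  null sequences.  The operations are computed on chosen representatives; the lemmas \<open>CC_add\<close>,
  \<open>CC_mult\<close>, ... below show that the choice does not matter.\<close>

definition null_rel :: "('a, 'm) star_struct_scheme \<Rightarrow> ('a \<Rightarrow> real) \<Rightarrow> ((nat \<Rightarrow> 'a) \<times> (nat \<Rightarrow> 'a)) set" where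
  "null_rel A p = {(X, Y). X \<in> cauchy_seqs A p \<and> Y \<in> cauchy_seqs A p \<and>
     (\<lambda>k. p (X k \<ominus>\<^bsub>A\<^esub> Y k)) \<longlonglongrightarrow> 0}"

definition seq_class :: "('a, 'm) star_struct_scheme \<Rightarrow> ('a \<Rightarrow> real) \<Rightarrow> (nat \<Rightarrow> 'a) \<Rightarrow> (nat \<Rightarrow> 'a) set" where
  "seq_class A p X = null_rel A p `` {X}"

definition rep :: "'b set \<Rightarrow> 'b" where
  "rep U = (SOME X. X \<in> U)"

definition cstar_completion ::
  "('a, 'm) star_struct_scheme \<Rightarrow> ('a \<Rightarrow> real) \<Rightarrow> ((nat \<Rightarrow> 'a) set) cstar_struct" where
  "cstar_completion A p =
     \<lparr> carrier = cauchy_seqs A p // null_rel A p,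
       mult = (\<lambda>U V. seq_class A p (\<lambda>k. rep U k \<otimes>\<^bsub>A\<^esub> rep V k)),
       one = seq_class A p (\<lambda>k. \<one>\<^bsub>A\<^esub>),
       zero = seq_class A p (\<lambda>k. \<zero>\<^bsub>A\<^esub>),
       add = (\<lambda>U V. seq_class A p (\<lambda>k. rep U k \<oplus>\<^bsub>A\<^esub> rep V k)),
       smult = (\<lambda>c U. seq_class A p (\<lambda>k. c \<odot>\<^bsub>A\<^esub> rep U k)),
       star = (\<lambda>U. seq_class A p (\<lambda>k. star A (rep U k))),
       nrm = (\<lambda>U. lim (\<lambda>k. p (rep U k))) \<rparr>"

definition max_norm :: "('a, 'm) star_struct_scheme \<Rightarrow> 'a \<Rightarrow> real" where
  "max_norm A x = (SUP p\<in>{p. cstar_seminorm A p}. p x)"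


section \<open>Twisted group C*-algebras\<close>

definition two_cocycle :: "('g, 'm) monoid_scheme \<Rightarrow> ('g \<Rightarrow> 'g \<Rightarrow> complex) \<Rightarrow> bool" where
  "two_cocycle G \<sigma> \<longleftrightarrow>
     (\<forall>r\<in>carrier G. \<forall>s\<in>carrier G. cmod (\<sigma> r s) = 1) \<and>
     (\<forall>r\<in>carrier G. \<forall>s\<in>carrier G. \<forall>t\<in>carrier G.
        \<sigma> r s * \<sigma> (r \<otimes>\<^bsub>G\<^esub> s) t = \<sigma> r (s \<otimes>\<^bsub>G\<^esub> t) * \<sigma> s t) \<and>
     (\<forall>r\<in>carrier G. \<sigma> r \<one>\<^bsub>G\<^esub> = 1 \<and> \<sigma> \<one>\<^bsub>G\<^esub> r = 1)"

text \<open>The twisted group *-algebra, i.e. the universal *-algebra generated by unitaries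
  \<open>i r\<close> with \<open>i r * i s = \<sigma> r s * i (r s)\<close>: a finitely supported function \<open>f\<close> stands for the
  sum of the \<open>f r * i r\<close>.  The involution comes from
  \<open>star (i t) = inverse (i t) = cnj (\<sigma> t (inv t)) * i (inv t)\<close>.\<close>

definition twisted_star_algebra ::
  "('g, 'm) monoid_scheme \<Rightarrow> ('g \<Rightarrow> 'g \<Rightarrow> complex) \<Rightarrow> ('g \<Rightarrow> complex) star_struct" where
  "twisted_star_algebra G \<sigma> =
     \<lparr> carrier = {f. finite {r. f r \<noteq> 0} \<and> {r. f r \<noteq> 0} \<subseteq> carrier G},
       mult = (\<lambda>f g t. \<Sum>r | f r \<noteq> 0. \<Sum>s | g s \<noteq> 0.
                 if r \<otimes>\<^bsub>G\<^esub> s = t then f r * g s * \<sigma> r s else 0),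
       one = (\<lambda>t. if t = \<one>\<^bsub>G\<^esub> then 1 else 0),
       zero = (\<lambda>t. 0),
       add = (\<lambda>f g t. f t + g t),
       smult = (\<lambda>c f t. c * f t),
       star = (\<lambda>f t. if t \<in> carrier G
                 then cnj (f (inv\<^bsub>G\<^esub> t) * \<sigma> (inv\<^bsub>G\<^esub> t) t) else 0) \<rparr>"

text \<open>The full twisted group C*-algebra is the completion of the twisted group *-algebra in its
  largest C*-seminorm.  The lemmas \<open>C_cstar_alg\<close>, \<open>iota_unitary\<close>, \<open>iota_mult\<close>,
  \<open>C_generated\<close> and \<open>C_universal\<close> below show that it is the universal C*-algebra generated by
  unitaries \<open>i r\<close> with \<open>i r * i s = \<sigma> r s * i (r s)\<close>; the \<open>i r\<close> are \<open>twisted_unitary\<close>.\<close>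

definition delta :: "'g \<Rightarrow> 'g \<Rightarrow> complex" where
  "delta r = (\<lambda>t. if t = r then 1 else 0)"

definition twisted_cstar ::
  "('g, 'm) monoid_scheme \<Rightarrow> ('g \<Rightarrow> 'g \<Rightarrow> complex) \<Rightarrow> ((nat \<Rightarrow> 'g \<Rightarrow> complex) set) cstar_struct" where
  "twisted_cstar G \<sigma> =
     cstar_completion (twisted_star_algebra G \<sigma>) (max_norm (twisted_star_algebra G \<sigma>))"

definition twisted_unitary ::
  "('g, 'm) monoid_scheme \<Rightarrow> ('g \<Rightarrow> 'g \<Rightarrow> complex) \<Rightarrow> 'g \<Rightarrow> (nat \<Rightarrow> 'g \<Rightarrow> complex) set" where
  "twisted_unitary G \<sigma> r =
     seq_class (twisted_star_algebra G \<sigma>) (max_norm (twisted_star_algebra G \<sigma>)) (\<lambda>k. delta r)"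

definition cocycle_regular :: "('g, 'm) monoid_scheme \<Rightarrow> ('g \<Rightarrow> 'g \<Rightarrow> complex) \<Rightarrow> 'g \<Rightarrow> bool" where
  "cocycle_regular G \<sigma> r \<longleftrightarrow> r \<in> carrier G \<and>
     (\<forall>s\<in>carrier G. s \<otimes>\<^bsub>G\<^esub> r = r \<otimes>\<^bsub>G\<^esub> s \<longrightarrow> \<sigma> r s = \<sigma> s r)"


section \<open>The free nilpotent group of class 2 and rank n\<close>

text \<open>A tuple is a pair \<open>(a, b)\<close> with \<open>a i = r_i\<close> and \<open>b j k = r_jk\<close>; entries outside the index
  range are set to 0.\<close>

type_synonym nil2 = "(nat \<Rightarrow> int) \<times> (nat \<Rightarrow> nat \<Rightarrow> int)"

definition free_nil2 :: "nat \<Rightarrow> nil2 monoid" where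
  "free_nil2 n =
     \<lparr> carrier = {(a, b). (\<forall>i. \<not> (1 \<le> i \<and> i \<le> n) \<longrightarrow> a i = 0) \<and>
                          (\<forall>j k. \<not> (1 \<le> j \<and> j < k \<and> k \<le> n) \<longrightarrow> b j k = 0)},
       mult = (\<lambda>(a, b) (c, d).
                 (\<lambda>i. a i + c i,
                  \<lambda>j k. if 1 \<le> j \<and> j < k \<and> k \<le> n then b j k + d j k + a j * c k else 0)),
       one = (\<lambda>i. 0, \<lambda>j k. 0) \<rparr>"

text \<open>\<open>l i j k\<close> is \<open>\<lambda>_{i,jk}\<close>.  The integer divisions are exact.\<close>

definition nil2_cocycle :: "nat \<Rightarrow> (nat \<Rightarrow> nat \<Rightarrow> nat \<Rightarrow> complex) \<Rightarrow> nil2 \<Rightarrow> nil2 \<Rightarrow> complex" where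
  "nil2_cocycle n l = (\<lambda>(r1, r2) (s1, s2).
     (\<Prod>(i, j, k)\<in>{(i, j, k). 1 \<le> i \<and> i < j \<and> j < k \<and> k \<le> n}.
        l i j k powi (s2 j k * r1 i + s1 k * r2 i j) *
        l j i k powi (s2 i k * r1 j + s1 k * (r1 i * r1 j - r2 i j))) *
     (\<Prod>(j, k)\<in>{(j, k). 1 \<le> j \<and> j < k \<and> k \<le> n}.
        l j j k powi (s2 j k * r1 j + s1 k * (r1 j * (r1 j - 1) div 2)) *
        l k j k powi (r1 k * (s2 j k + r1 j * s1 k) + r1 j * (s1 k * (s1 k - 1) div 2))))"


section \<open>The completion is a C*-algebra\<close>

context star_alg
begin

lemma smult_zero_l [simp]: "x \<in> carrier A \<Longrightarrow> 0 \<odot> x = \<zero>"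
  using smult_l_distr[of x 0 0] by (metis add.r_cancel_one' add_cancel_left_left smult_closed)

lemma smult_zero_r [simp]: "c \<odot> \<zero> = \<zero>"
  using smult_assoc1[of \<zero> c 0] by simp

lemma minus_smult: "x \<in> carrier A \<Longrightarrow> \<ominus> x = (-1) \<odot> x"
  using smult_l_distr[of x 1 "-1"] by (simp add: minus_equality a_comm)

lemma star_minus: "x \<in> carrier A \<Longrightarrow> star A (\<ominus> x) = \<ominus> star A x"
  by (simp add: minus_smult star_smult)

lemma star_zero [simp]: "star A \<zero> = \<zero>"
  using star_smult[of \<zero> 0] by simp

lemma star_one [simp]: "star A \<one> = \<one>"
proof -
  have "star A \<one> = star A \<one> \<otimes> \<one>" by simp
  also have "\<dots> = star A \<one> \<otimes> star A (star A \<one>)" by (simp add: star_star)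
  also have "\<dots> = star A (star A \<one> \<otimes> \<one>)" by (simp add: star_mult del: r_one)
  finally show ?thesis by (simp add: star_star)
qed

end

locale seminormed_star_alg = star_alg A for A :: "('a, 'm) star_struct_scheme" (structure) +
  fixes p :: "'a \<Rightarrow> real"
  assumes p_cstar: "cstar_seminorm A p"
begin

lemma p_nonneg: "x \<in> carrier A \<Longrightarrow> 0 \<le> p x"
  and p_add: "x \<in> carrier A \<Longrightarrow> y \<in> carrier A \<Longrightarrow> p (x \<oplus> y) \<le> p x + p y"
  and p_smult: "x \<in> carrier A \<Longrightarrow> p (c \<odot> x) = cmod c * p x"
  and p_mult: "x \<in> carrier A \<Longrightarrow> y \<in> carrier A \<Longrightarrow> p (x \<otimes> y) \<le> p x * p y"
  and p_star_mult: "x \<in> carrier A \<Longrightarrow> p (star A x \<otimes> x) = (p x)\<^sup>2"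
  using p_cstar by (auto simp: cstar_seminorm_def)

lemma p_zero [simp]: "p \<zero> = 0"
  using p_smult[of \<zero> 0] by simp

lemma p_minus [simp]: "x \<in> carrier A \<Longrightarrow> p (\<ominus> x) = p x"
  by (simp add: minus_smult p_smult)

lemma p_star [simp]:
  assumes x: "x \<in> carrier A" shows "p (star A x) = p x"
proof -
  have le: "p y \<le> p (star A y)" if y: "y \<in> carrier A" for y
  proof (cases "p y = 0")
    case True
    then show ?thesis using y p_nonneg[of "star A y"] by simp
  next
    case False
    then have "p y > 0" using p_nonneg[OF y] by simp
    moreover have "p y * p y \<le> p (star A y) * p y"
      using p_mult[of "star A y" y] p_star_mult[of y] y by (simp add: power2_eq_square)
    ultimately show ?thesis by simp
  qed
  from le[of x] le[of "star A x"] x show ?thesis by (simp add: star_star)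
qed

lemma p_diff_sym: "x \<in> carrier A \<Longrightarrow> y \<in> carrier A \<Longrightarrow> p (x \<ominus> y) = p (y \<ominus> x)"
  using p_minus[of "x \<ominus> y"] by (simp add: minus_eq minus_add a_comm)

lemma p_diff_tri: 
  assumes "x \<in> carrier A" "y \<in> carrier A" "z \<in> carrier A"
  shows "p (x \<ominus> z) \<le> p (x \<ominus> y) + p (y \<ominus> z)"
proof -
  have "x \<ominus> z = (x \<ominus> y) \<oplus> (y \<ominus> z)" using assms by algebra
  then show ?thesis using p_add[of "x \<ominus> y" "y \<ominus> z"] assms by simp
qed

lemma p_diff_abs: 
  assumes "x \<in> carrier A" "y \<in> carrier A"
  shows "\<bar>p x - p y\<bar> \<le> p (x \<ominus> y)"
proof -
  have 1: "p u \<le> p (u \<ominus> v) + p v" if "u \<in> carrier A" "v \<in> carrier A" for u v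
  proof -
    have "u = (u \<ominus> v) \<oplus> v" using that by algebra
    then show ?thesis using p_add[of "u \<ominus> v" v] that by simp
  qed
  show ?thesis using 1[of x y] 1[of y x] p_diff_sym assms by (simp add: abs_le_iff)
qed

lemma p_diff_add:
  assumes "x \<in> carrier A" "y \<in> carrier A" "x' \<in> carrier A" "y' \<in> carrier A"
  shows "p ((x \<oplus> y) \<ominus> (x' \<oplus> y')) \<le> p (x \<ominus> x') + p (y \<ominus> y')"
proof -
  have "(x \<oplus> y) \<ominus> (x' \<oplus> y') = (x \<ominus> x') \<oplus> (y \<ominus> y')" using assms by algebra
  then show ?thesis using p_add[of "x \<ominus> x'" "y \<ominus> y'"] assms by simp
qed

lemma p_diff_mult:
  assumes "x \<in> carrier A" "y \<in> carrier A" "x' \<in> carrier A" "y' \<in> carrier A"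
  shows "p ((x \<otimes> y) \<ominus> (x' \<otimes> y')) \<le> p (x \<ominus> x') * p y + p x' * p (y \<ominus> y')"
proof -
  have "(x \<otimes> y) \<ominus> (x' \<otimes> y') = (x \<ominus> x') \<otimes> y \<oplus> x' \<otimes> (y \<ominus> y')" using assms by algebra
  then have "p ((x \<otimes> y) \<ominus> (x' \<otimes> y')) \<le> p ((x \<ominus> x') \<otimes> y) + p (x' \<otimes> (y \<ominus> y'))"
    using p_add[of "(x \<ominus> x') \<otimes> y" "x' \<otimes> (y \<ominus> y')"] assms by simp
  also have "\<dots> \<le> p (x \<ominus> x') * p y + p x' * p (y \<ominus> y')"
    using assms by (intro add_mono p_mult) auto
  finally show ?thesis .
qed

lemma p_diff_smult:
  assumes "x \<in> carrier A" "y \<in> carrier A"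
  shows "p (c \<odot> x \<ominus> c \<odot> y) = cmod c * p (x \<ominus> y)"
proof -
  have "c \<odot> x \<ominus> c \<odot> y = c \<odot> (x \<ominus> y)"
    using assms smult_assoc1[of y c "-1"] smult_assoc1[of y "-1" c] by (simp add: minus_eq smult_r_distr minus_smult)
  then show ?thesis using assms by (simp add: p_smult)
qed

lemma p_diff_star:
  assumes "x \<in> carrier A" "y \<in> carrier A"
  shows "p (star A x \<ominus> star A y) = p (x \<ominus> y)"
proof -
  have "star A x \<ominus> star A y = star A (x \<ominus> y)"
    using assms by (simp add: minus_eq star_add star_minus)
  then show ?thesis using assms by simp
qed

abbreviation "CS \<equiv> cauchy_seqs A p"
abbreviation "cls \<equiv> seq_class A p"
abbreviation "CC \<equiv> cstar_completion A p"

lemma CS_carrier: "X \<in> CS \<Longrightarrow> X k \<in> carrier A"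
  by (auto simp: cauchy_seqs_def)

lemma CS_D: "X \<in> CS \<Longrightarrow> e > 0 \<Longrightarrow> \<exists>N. \<forall>m\<ge>N. \<forall>k\<ge>N. p (X m \<ominus> X k) < e"
  by (auto simp: cauchy_seqs_def)

lemma CS_I:
  assumes "\<And>k. X k \<in> carrier A" "\<And>e. e > 0 \<Longrightarrow> \<exists>N. \<forall>m\<ge>N. \<forall>k\<ge>N. p (X m \<ominus> X k) < e"
  shows "X \<in> CS" using assms by (auto simp: cauchy_seqs_def)

lemma CS_const: "x \<in> carrier A \<Longrightarrow> (\<lambda>k. x) \<in> CS"
  by (rule CS_I) (auto simp: minus_eq r_neg)

lemma CS_p_convergent: 
  assumes X: "X \<in> CS" shows "convergent (\<lambda>k. p (X k))"
proof -
  have "Cauchy (\<lambda>k. p (X k))"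
  proof (rule metric_CauchyI)
    fix e :: real assume "e > 0"
    from CS_D[OF X this] obtain N where N: "\<forall>m\<ge>N. \<forall>k\<ge>N. p (X m \<ominus> X k) < e" by blast
    have "dist (p (X m)) (p (X k)) < e" if "m \<ge> N" "k \<ge> N" for m k
      using N that p_diff_abs[of "X m" "X k"] CS_carrier[OF X] by (fastforce simp: dist_real_def)
    then show "\<exists>N. \<forall>m\<ge>N. \<forall>n\<ge>N. dist (p (X m)) (p (X n)) < e" by blast
  qed
  then show ?thesis by (rule Cauchy_convergent)
qed

lemma CS_bounded:
  assumes X: "X \<in> CS" obtains B where "B > 0" "\<And>k. p (X k) \<le> B"
proof -
  have "Bseq (\<lambda>k. p (X k))" using CS_p_convergent[OF X] by (rule convergent_imp_Bseq)
  then obtain B where "B > 0" "\<And>k. norm (p (X k)) \<le> B" by (auto simp: Bseq_def)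
  then show ?thesis using that[of B] by (metis abs_le_D1 real_norm_def)
qed

lemma CS_dominated:
  assumes X: "X \<in> CS" and Y: "\<And>k. Y k \<in> carrier A"
    and B: "B \<ge> 0" "\<And>m k. p (Y m \<ominus> Y k) \<le> B * p (X m \<ominus> X k)"
  shows "Y \<in> CS"
proof (rule CS_I[OF Y])
  fix e :: real assume e: "e > 0"
  have "e / (B + 1) > 0" using e B by simp
  from CS_D[OF X this] obtain N where N: "\<forall>m\<ge>N. \<forall>k\<ge>N. p (X m \<ominus> X k) < e / (B + 1)" by blast
  have "p (Y m \<ominus> Y k) < e" if "m \<ge> N" "k \<ge> N" for m k
  proof -
    have "p (Y m \<ominus> Y k) \<le> (B + 1) * p (X m \<ominus> X k)"
      using B(2)[of m k] p_nonneg[of "X m \<ominus> X k"] CS_carrier[OF X] by (simp add: distrib_right)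
    also have "\<dots> < (B + 1) * (e / (B + 1))" using N that B by (intro mult_strict_left_mono) auto
    also have "\<dots> = e" using B by simp
    finally show ?thesis .
  qed
  then show "\<exists>N. \<forall>m\<ge>N. \<forall>k\<ge>N. p (Y m \<ominus> Y k) < e" by blast
qed

lemma CS_add: 
  assumes X: "X \<in> CS" and Y: "Y \<in> CS" shows "(\<lambda>k. X k \<oplus> Y k) \<in> CS"
proof (rule CS_I)
  fix e :: real assume "e > 0"
  then have e: "e / 2 > 0" by simp
  from CS_D[OF X e] obtain N where N: "\<forall>m\<ge>N. \<forall>k\<ge>N. p (X m \<ominus> X k) < e / 2" by blast
  from CS_D[OF Y e] obtain M where M: "\<forall>m\<ge>M. \<forall>k\<ge>M. p (Y m \<ominus> Y k) < e / 2" by blast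
  have "p ((X m \<oplus> Y m) \<ominus> (X k \<oplus> Y k)) < e" if "m \<ge> max N M" "k \<ge> max N M" for m k
  proof -
    have "p (X m \<ominus> X k) < e / 2" "p (Y m \<ominus> Y k) < e / 2" using that N M by auto
    then show ?thesis
      using p_diff_add[of "X m" "Y m" "X k" "Y k"] CS_carrier[OF X] CS_carrier[OF Y] by simp
  qed
  then show "\<exists>N. \<forall>m\<ge>N. \<forall>k\<ge>N. p ((X m \<oplus> Y m) \<ominus> (X k \<oplus> Y k)) < e" by blast
qed (use CS_carrier[OF X] CS_carrier[OF Y] in auto)

lemma CS_mult: 
  assumes X: "X \<in> CS" and Y: "Y \<in> CS" shows "(\<lambda>k. X k \<otimes> Y k) \<in> CS"
proof (rule CS_I)
  fix e :: real assume e: "e > 0"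
  obtain B where B: "B > 0" "\<And>k. p (X k) \<le> B" using CS_bounded[OF X] by blast
  obtain C where C: "C > 0" "\<And>k. p (Y k) \<le> C" using CS_bounded[OF Y] by blast
  have eC: "e / (2 * C) > 0" and eB: "e / (2 * B) > 0" using e B C by auto
  from CS_D[OF X eC] obtain N where N: "\<forall>m\<ge>N. \<forall>k\<ge>N. p (X m \<ominus> X k) < e / (2 * C)" by blast
  from CS_D[OF Y eB] obtain M where M: "\<forall>m\<ge>M. \<forall>k\<ge>M. p (Y m \<ominus> Y k) < e / (2 * B)" by blast
  have "p ((X m \<otimes> Y m) \<ominus> (X k \<otimes> Y k)) < e" if mk: "m \<ge> max N M" "k \<ge> max N M" for m k
  proof -
    have "p ((X m \<otimes> Y m) \<ominus> (X k \<otimes> Y k)) \<le> p (X m \<ominus> X k) * p (Y m) + p (X k) * p (Y m \<ominus> Y k)"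
      using p_diff_mult[of "X m" "Y m" "X k" "Y k"] CS_carrier[OF X] CS_carrier[OF Y] by simp
    also have "\<dots> \<le> p (X m \<ominus> X k) * C + B * p (Y m \<ominus> Y k)"
      using B C CS_carrier[OF X] CS_carrier[OF Y] by (intro add_mono mult_mono p_nonneg) (auto intro: less_imp_le)
    also have "\<dots> < e / (2 * C) * C + B * (e / (2 * B))"
      using B C N M mk by (intro add_strict_mono mult_strict_right_mono mult_strict_left_mono) auto
    also have "\<dots> = e" using B C by simp
    finally show ?thesis .
  qed
  then show "\<exists>N. \<forall>m\<ge>N. \<forall>k\<ge>N. p ((X m \<otimes> Y m) \<ominus> (X k \<otimes> Y k)) < e" by blast
qed (use CS_carrier[OF X] CS_carrier[OF Y] in auto)

lemma CS_smult: "X \<in> CS \<Longrightarrow> (\<lambda>k. c \<odot> X k) \<in> CS"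
  by (rule CS_dominated[of X _ "cmod c"]) (auto simp: CS_carrier p_diff_smult)

lemma CS_star: "X \<in> CS \<Longrightarrow> (\<lambda>k. star A (X k)) \<in> CS"
  by (rule CS_dominated[of X _ 1]) (auto simp: CS_carrier p_diff_star)

lemma rel_iff: "(X, Y) \<in> null_rel A p \<longleftrightarrow> X \<in> CS \<and> Y \<in> CS \<and> (\<lambda>k. p (X k \<ominus> Y k)) \<longlonglongrightarrow> 0"
  by (simp add: null_rel_def)

lemma null_dominated:
  assumes "(\<lambda>k. b k) \<longlonglongrightarrow> (0::real)" "\<And>k. x k \<in> carrier A" "\<And>k. p (x k) \<le> b k"
  shows "(\<lambda>k. p (x k)) \<longlonglongrightarrow> 0"
  by (rule tendsto_sandwich[OF _ _ tendsto_const assms(1)]) (auto intro!: always_eventually p_nonneg assms)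

lemma equiv_null: "equiv CS (null_rel A p)"
proof (rule equivI)
  show "null_rel A p \<subseteq> CS \<times> CS" by (auto simp: rel_iff)
  show "refl_on CS (null_rel A p)"
    by (auto simp: refl_on_def rel_iff minus_eq r_neg CS_carrier)
  show "sym (null_rel A p)"
    by (auto simp: sym_def rel_iff p_diff_sym CS_carrier)
  show "trans (null_rel A p)"
  proof (rule transI)
    fix X Y Z assume "(X, Y) \<in> null_rel A p" "(Y, Z) \<in> null_rel A p"
    then have c: "X \<in> CS" "Y \<in> CS" "Z \<in> CS" and l: "(\<lambda>k. p (X k \<ominus> Y k)) \<longlonglongrightarrow> 0" "(\<lambda>k. p (Y k \<ominus> Z k)) \<longlonglongrightarrow> 0"
      by (auto simp: rel_iff)
    have "(\<lambda>k. p (X k \<ominus> Z k)) \<longlonglongrightarrow> 0"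
      using tendsto_add[OF l] p_diff_tri CS_carrier c by (intro null_dominated[of "\<lambda>k. p (X k \<ominus> Y k) + p (Y k \<ominus> Z k)"]) auto
    with c show "(X, Z) \<in> null_rel A p" by (simp add: rel_iff)
  qed
qed

lemma cls_eq_iff: "X \<in> CS \<Longrightarrow> Y \<in> CS \<Longrightarrow> cls X = cls Y \<longleftrightarrow> (\<lambda>k. p (X k \<ominus> Y k)) \<longlonglongrightarrow> 0"
  using eq_equiv_class_iff[OF equiv_null, of X Y] by (simp add: seq_class_def rel_iff)

lemma cls_in [simp]: "X \<in> CS \<Longrightarrow> cls X \<in> carrier CC"
  by (simp add: cstar_completion_def seq_class_def quotientI)

lemma rep_cls: assumes "X \<in> CS" shows "rep (cls X) \<in> CS" "cls (rep (cls X)) = cls X"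
proof -
  have "X \<in> cls X" using equiv_class_self[OF equiv_null assms] by (simp add: seq_class_def)
  then have "rep (cls X) \<in> cls X" unfolding rep_def by (rule someI[of "\<lambda>Y. Y \<in> cls X"])
  then have r: "(X, rep (cls X)) \<in> null_rel A p" by (simp add: seq_class_def)
  then show "rep (cls X) \<in> CS" by (simp add: rel_iff)
  show "cls (rep (cls X)) = cls X" using equiv_class_eq[OF equiv_null r] by (simp add: seq_class_def)
qed

lemma CC_cases: assumes "U \<in> carrier CC" obtains X where "X \<in> CS" "U = cls X"
  using assms by (auto simp: cstar_completion_def seq_class_def elim: quotientE)

lemma rep_in: "U \<in> carrier CC \<Longrightarrow> rep U \<in> CS \<and> cls (rep U) = U"
  by (metis CC_cases rep_cls)

lemma cls_congI: "X \<in> CS \<Longrightarrow> Y \<in> CS \<Longrightarrow> (\<And>k. p (X k \<ominus> Y k) \<le> b k) \<Longrightarrow> b \<longlonglongrightarrow> 0 \<Longrightarrow> cls X = cls Y"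
  by (subst cls_eq_iff, simp, simp, rule null_dominated[of b]) (auto simp: CS_carrier)

lemma rep_null: "X \<in> CS \<Longrightarrow> (\<lambda>k. p (rep (cls X) k \<ominus> X k)) \<longlonglongrightarrow> 0"
  using cls_eq_iff[of "rep (cls X)" X] rep_cls by simp

lemma CC_add: assumes X: "X \<in> CS" and Y: "Y \<in> CS"
  shows "cls X \<oplus>\<^bsub>CC\<^esub> cls Y = cls (\<lambda>k. X k \<oplus> Y k)"
proof -
  have "cls (\<lambda>k. rep (cls X) k \<oplus> rep (cls Y) k) = cls (\<lambda>k. X k \<oplus> Y k)"
    using tendsto_add[OF rep_null[OF X] rep_null[OF Y]] X Y rep_cls CS_carrier p_diff_add
    by (intro cls_congI[where b = "\<lambda>k. p (rep (cls X) k \<ominus> X k) + p (rep (cls Y) k \<ominus> Y k)"] CS_add) auto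
  then show ?thesis by (simp add: cstar_completion_def)
qed

lemma CC_mult: assumes X: "X \<in> CS" and Y: "Y \<in> CS"
  shows "cls X \<otimes>\<^bsub>CC\<^esub> cls Y = cls (\<lambda>k. X k \<otimes> Y k)"
proof -
  have lim: "(\<lambda>k. p (rep (cls X) k \<ominus> X k) * p (rep (cls Y) k) + p (X k) * p (rep (cls Y) k \<ominus> Y k)) \<longlonglongrightarrow> 0"
  proof -
    obtain a where "(\<lambda>k. p (X k)) \<longlonglongrightarrow> a" using CS_p_convergent[OF X] by (auto simp: convergent_def)
    moreover obtain b where "(\<lambda>k. p (rep (cls Y) k)) \<longlonglongrightarrow> b"
      using CS_p_convergent[OF rep_cls(1)[OF Y]] by (auto simp: convergent_def)
    ultimately have "(\<lambda>k. p (rep (cls X) k \<ominus> X k) * p (rep (cls Y) k) + p (X k) * p (rep (cls Y) k \<ominus> Y k)) \<longlonglongrightarrow> 0 * b + a * 0"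
      by (intro tendsto_intros rep_null X Y)
    then show ?thesis by simp
  qed
  have "cls (\<lambda>k. rep (cls X) k \<otimes> rep (cls Y) k) = cls (\<lambda>k. X k \<otimes> Y k)"
    using X Y rep_cls CS_carrier p_diff_mult
    by (intro cls_congI[OF _ _ _ lim] CS_mult) auto
  then show ?thesis by (simp add: cstar_completion_def)
qed

lemma CC_smult: assumes X: "X \<in> CS" shows "c \<odot>\<^bsub>CC\<^esub> cls X = cls (\<lambda>k. c \<odot> X k)"
proof -
  have "cls (\<lambda>k. c \<odot> rep (cls X) k) = cls (\<lambda>k. c \<odot> X k)"
    using tendsto_mult_left[OF rep_null[OF X], of "cmod c"] X rep_cls CS_carrier p_diff_smult
    by (intro cls_congI[where b = "\<lambda>k. cmod c * p (rep (cls X) k \<ominus> X k)"] CS_smult) auto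
  then show ?thesis by (simp add: cstar_completion_def)
qed

lemma CC_star: assumes X: "X \<in> CS" shows "star CC (cls X) = cls (\<lambda>k. star A (X k))"
proof -
  have "cls (\<lambda>k. star A (rep (cls X) k)) = cls (\<lambda>k. star A (X k))"
    using rep_null[OF X] X rep_cls CS_carrier p_diff_star
    by (intro cls_congI[where b = "\<lambda>k. p (rep (cls X) k \<ominus> X k)"] CS_star) auto
  then show ?thesis by (simp add: cstar_completion_def)
qed

lemma CC_zero: "\<zero>\<^bsub>CC\<^esub> = cls (\<lambda>k. \<zero>)" and CC_one: "\<one>\<^bsub>CC\<^esub> = cls (\<lambda>k. \<one>)"
  by (simp_all add: cstar_completion_def)

lemma CC_nrm: assumes X: "X \<in> CS" shows "(\<lambda>k. p (X k)) \<longlonglongrightarrow> nrm CC (cls X)"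
proof -
  obtain a where a: "(\<lambda>k. p (X k)) \<longlonglongrightarrow> a" using CS_p_convergent[OF X] by (auto simp: convergent_def)
  have "(\<lambda>k. p (rep (cls X) k) - p (X k)) \<longlonglongrightarrow> 0"
  proof (rule tendsto_rabs_zero_cancel, rule tendsto_sandwich[OF _ _ tendsto_const rep_null[OF X]])
    show "\<forall>\<^sub>F k in sequentially. \<bar>p (rep (cls X) k) - p (X k)\<bar> \<le> p (rep (cls X) k \<ominus> X k)"
      using X rep_cls CS_carrier p_diff_abs by (intro always_eventually) auto
  qed auto
  from tendsto_add[OF this a] have "(\<lambda>k. p (rep (cls X) k)) \<longlonglongrightarrow> a" by simp
  then show ?thesis using a by (simp add: cstar_completion_def limI)
qed

lemmas CC_simps = CC_add CC_mult CC_smult CC_star CC_zero CC_one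
lemmas CS_intros = CS_add CS_mult CS_smult CS_star CS_const

lemma CC_star_alg: "star_alg CC"
proof -
  have ag: "abelian_group CC"
  proof (rule abelian_groupI)
    fix x assume "x \<in> carrier CC"
    then obtain X where X: "X \<in> CS" "x = cls X" by (elim CC_cases)
    show "\<exists>y\<in>carrier CC. y \<oplus>\<^bsub>CC\<^esub> x = \<zero>\<^bsub>CC\<^esub>"
    proof (rule bexI)
      show "cls (\<lambda>k. (-1) \<odot> X k) \<in> carrier CC" using X by (simp add: CS_smult)
      have "cls (\<lambda>k. (-1) \<odot> X k) \<oplus>\<^bsub>CC\<^esub> x = cls (\<lambda>k. (-1) \<odot> X k \<oplus> X k)"
        using X by (simp add: CC_add CS_smult)
      also have "(\<lambda>k. (-1) \<odot> X k \<oplus> X k) = (\<lambda>k. \<zero>)"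
        using X by (simp add: minus_smult[symmetric] CS_carrier l_neg)
      finally show "cls (\<lambda>k. (-1) \<odot> X k) \<oplus>\<^bsub>CC\<^esub> x = \<zero>\<^bsub>CC\<^esub>" by (simp add: CC_zero)
    qed
  qed (auto simp: CC_simps CS_intros CS_carrier a_ac elim!: CC_cases)
  have mo: "monoid CC"
    by (rule monoidI) (auto simp: CC_simps CS_intros CS_carrier m_assoc elim!: CC_cases)
  have "ring CC"
    by (rule ringI[OF ag mo]) (auto simp: CC_simps CS_intros CS_carrier l_distr r_distr elim!: CC_cases)
  then show ?thesis
    by (rule star_alg.intro, unfold_locales)
       (auto simp: CC_simps CS_intros CS_carrier smult_l_distr smult_r_distr smult_assoc1 smult_mult_l smult_mult_r
         star_star star_add star_smult star_mult elim!: CC_cases)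
qed

lemma CC_cstar_seminorm: "cstar_seminorm CC (nrm CC)"
  unfolding cstar_seminorm_def
proof (intro conjI ballI allI)
  fix x assume "x \<in> carrier CC"
  then obtain X where X: "X \<in> CS" "x = cls X" by (elim CC_cases)
  show "0 \<le> nrm CC x" unfolding X(2)
    by (rule tendsto_lowerbound[OF CC_nrm[OF X(1)]]) (auto intro!: always_eventually p_nonneg CS_carrier X)
  show "nrm CC (c \<odot>\<^bsub>CC\<^esub> x) = cmod c * nrm CC x" for c
    using CC_nrm[OF CS_smult[OF X(1)], of c] tendsto_mult_left[OF CC_nrm[OF X(1)], of "cmod c"] X
    by (simp add: CC_simps p_smult CS_carrier LIMSEQ_unique)
  show "nrm CC (star CC x \<otimes>\<^bsub>CC\<^esub> x) = (nrm CC x)\<^sup>2"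
    using CC_nrm[OF CS_mult[OF CS_star[OF X(1)] X(1)]] tendsto_power[OF CC_nrm[OF X(1)], of 2] X
    by (simp add: CC_simps CS_intros p_star_mult CS_carrier LIMSEQ_unique)
  fix y assume "y \<in> carrier CC"
  then obtain Y where Y: "Y \<in> CS" "y = cls Y" by (elim CC_cases)
  show "nrm CC (x \<oplus>\<^bsub>CC\<^esub> y) \<le> nrm CC x + nrm CC y"
    using tendsto_le[OF _ tendsto_add[OF CC_nrm[OF X(1)] CC_nrm[OF Y(1)]] CC_nrm[OF CS_add[OF X(1) Y(1)]]] X Y
    by (auto simp: CC_simps p_add CS_carrier)
  show "nrm CC (x \<otimes>\<^bsub>CC\<^esub> y) \<le> nrm CC x * nrm CC y"
    using tendsto_le[OF _ tendsto_mult[OF CC_nrm[OF X(1)] CC_nrm[OF Y(1)]] CC_nrm[OF CS_mult[OF X(1) Y(1)]]] X Y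
    by (auto simp: CC_simps p_mult CS_carrier)
qed

end

context seminormed_star_alg
begin

interpretation CC: seminormed_star_alg "cstar_completion A p" "nrm (cstar_completion A p)"
  by (intro seminormed_star_alg.intro seminormed_star_alg_axioms.intro CC_star_alg CC_cstar_seminorm)

lemma CC_diff: assumes X: "X \<in> CS" and Y: "Y \<in> CS"
  shows "cls X \<ominus>\<^bsub>CC\<^esub> cls Y = cls (\<lambda>k. X k \<ominus> Y k)"
  using X Y by (simp add: CC.minus_eq CC.minus_smult CC_simps CS_intros minus_eq minus_smult CS_carrier)

lemma CS_diff: "X \<in> CS \<Longrightarrow> Y \<in> CS \<Longrightarrow> (\<lambda>k. X k \<ominus> Y k) \<in> CS"
  using CS_add[of X "\<lambda>k. (-1) \<odot> Y k"] CS_smult[of Y "-1"] by (simp add: minus_eq minus_smult CS_carrier)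

lemma nrm_const: "x \<in> carrier A \<Longrightarrow> nrm CC (cls (\<lambda>k. x)) = p x"
  using CC_nrm[OF CS_const[of x]] by (simp add: LIMSEQ_const_iff)

lemma nrm_diff_const: "x \<in> carrier A \<Longrightarrow> y \<in> carrier A \<Longrightarrow>
    nrm CC (cls (\<lambda>k. x) \<ominus>\<^bsub>CC\<^esub> cls (\<lambda>k. y)) = p (x \<ominus> y)"
  by (simp add: CC_diff CS_const nrm_const)

lemma CC_approx: assumes X: "X \<in> CS" 
  shows "(\<lambda>m. nrm CC (cls (\<lambda>k. X m) \<ominus>\<^bsub>CC\<^esub> cls X)) \<longlonglongrightarrow> 0"
proof (rule LIMSEQ_I)
  fix e :: real assume "e > 0"
  then have "e / 2 > 0" by simp
  from CS_D[OF X this] obtain N where N: "\<forall>m\<ge>N. \<forall>k\<ge>N. p (X m \<ominus> X k) < e / 2" by blast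
  have "norm (nrm CC (cls (\<lambda>k. X m) \<ominus>\<^bsub>CC\<^esub> cls X) - 0) < e" if "m \<ge> N" for m
  proof -
    have "(\<lambda>k. p (X m \<ominus> X k)) \<longlonglongrightarrow> nrm CC (cls (\<lambda>k. X m) \<ominus>\<^bsub>CC\<^esub> cls X)"
      using CC_nrm[OF CS_diff[OF CS_const[OF CS_carrier[OF X]] X]] X by (simp add: CC_diff CS_const CS_carrier)
    then have "nrm CC (cls (\<lambda>k. X m) \<ominus>\<^bsub>CC\<^esub> cls X) \<le> e / 2"
      by (rule tendsto_upperbound) (use N that in \<open>auto simp: eventually_sequentially intro!: exI[of _ N] less_imp_le\<close>)
    moreover have "0 \<le> nrm CC (cls (\<lambda>k. X m) \<ominus>\<^bsub>CC\<^esub> cls X)"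
      using X by (intro CC.p_nonneg CC.minus_closed cls_in CS_const CS_carrier)
    ultimately show ?thesis using \<open>e > 0\<close> by simp
  qed
  then show "\<exists>N. \<forall>m\<ge>N. norm (nrm CC (cls (\<lambda>k. X m) \<ominus>\<^bsub>CC\<^esub> cls X) - 0) < e" by blast
qed

lemma CC_cstar_alg: "cstar_alg CC"
proof (intro cstar_alg.intro CC_star_alg cstar_alg_axioms.intro CC_cstar_seminorm)
  fix x assume "x \<in> carrier CC" and 0: "nrm CC x = 0"
  then obtain X where X: "X \<in> CS" "x = cls X" by (elim CC_cases)
  have "X k \<ominus> \<zero> = X k" for k using X by (simp add: minus_eq CS_carrier)
  then have "cls X = cls (\<lambda>k. \<zero>)"
    using CC_nrm[OF X(1)] 0 X by (subst cls_eq_iff) (auto simp: CS_const)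
  then show "x = \<zero>\<^bsub>CC\<^esub>" by (simp add: X CC_zero)
next
  fix U assume U: "U \<in> cauchy_seqs CC (nrm CC)"
  have Uc: "U m \<in> carrier CC" for m using U by (simp add: CC.CS_carrier)
  have "\<exists>a\<in>carrier A. nrm CC (cls (\<lambda>k. a) \<ominus>\<^bsub>CC\<^esub> U m) < 1 / real (Suc m)" for m
  proof -
    obtain X where X: "X \<in> CS" "U m = cls X" using Uc[of m] by (elim CC_cases)
    from LIMSEQ_D[OF CC_approx[OF X(1)], of "1 / real (Suc m)"] 
    obtain N where "norm (nrm CC (cls (\<lambda>k. X N) \<ominus>\<^bsub>CC\<^esub> cls X) - 0) < 1 / real (Suc m)" by auto
    then show ?thesis using X by (intro bexI[of _ "X N"]) (auto simp: CS_carrier)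
  qed
  then obtain a where a: "\<And>m. a m \<in> carrier A" "\<And>m. nrm CC (cls (\<lambda>k. a m) \<ominus>\<^bsub>CC\<^esub> U m) < 1 / real (Suc m)"
    by metis
  have ac: "cls (\<lambda>k. a m) \<in> carrier CC" for m by (simp add: CS_const a)
  have lim: "(\<lambda>m. 1 / real (Suc m)) \<longlonglongrightarrow> 0" using LIMSEQ_inverse_real_of_nat by (simp add: inverse_eq_divide)
  have aC: "a \<in> CS"
  proof (rule CS_I[OF a(1)])
    fix e :: real assume "e > 0"
    then have e: "e / 3 > 0" by simp
    from CC.CS_D[OF U e] obtain N where N: "\<forall>m\<ge>N. \<forall>k\<ge>N. nrm CC (U m \<ominus>\<^bsub>CC\<^esub> U k) < e / 3" by blast
    from LIMSEQ_D[OF lim e] obtain M where M: "\<And>m. m \<ge> M \<Longrightarrow> 1 / real (Suc m) < e / 3" by auto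
    have "p (a m \<ominus> a k) < e" if "m \<ge> max N M" "k \<ge> max N M" for m k
    proof -
      have "p (a m \<ominus> a k) = nrm CC (cls (\<lambda>_. a m) \<ominus>\<^bsub>CC\<^esub> cls (\<lambda>_. a k))" by (simp add: nrm_diff_const a)
      also have "\<dots> \<le> nrm CC (cls (\<lambda>_. a m) \<ominus>\<^bsub>CC\<^esub> U m) + nrm CC (U m \<ominus>\<^bsub>CC\<^esub> cls (\<lambda>_. a k))"
        by (intro CC.p_diff_tri ac Uc)
      also have "nrm CC (U m \<ominus>\<^bsub>CC\<^esub> cls (\<lambda>_. a k)) \<le> nrm CC (U m \<ominus>\<^bsub>CC\<^esub> U k) + nrm CC (U k \<ominus>\<^bsub>CC\<^esub> cls (\<lambda>_. a k))"
        by (intro CC.p_diff_tri ac Uc)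
      also have "nrm CC (U k \<ominus>\<^bsub>CC\<^esub> cls (\<lambda>_. a k)) = nrm CC (cls (\<lambda>_. a k) \<ominus>\<^bsub>CC\<^esub> U k)"
        by (intro CC.p_diff_sym ac Uc)
      finally have 1: "p (a m \<ominus> a k) \<le> nrm CC (cls (\<lambda>_. a m) \<ominus>\<^bsub>CC\<^esub> U m) + (nrm CC (U m \<ominus>\<^bsub>CC\<^esub> U k) + nrm CC (cls (\<lambda>_. a k) \<ominus>\<^bsub>CC\<^esub> U k))" by simp
      have "nrm CC (U m \<ominus>\<^bsub>CC\<^esub> U k) < e / 3" using N that by auto
      moreover have "1 / real (Suc m) < e / 3" "1 / real (Suc k) < e / 3" using M that by auto
      ultimately show ?thesis using 1 a(2)[of m] a(2)[of k] by linarith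
    qed
    then show "\<exists>N. \<forall>m\<ge>N. \<forall>k\<ge>N. p (a m \<ominus> a k) < e" by blast
  qed
  have "(\<lambda>m. nrm CC (U m \<ominus>\<^bsub>CC\<^esub> cls a)) \<longlonglongrightarrow> 0"
  proof (rule CC.null_dominated)
    show "(\<lambda>m. 1 / real (Suc m) + nrm CC (cls (\<lambda>k. a m) \<ominus>\<^bsub>CC\<^esub> cls a)) \<longlonglongrightarrow> 0"
      using tendsto_add[OF lim CC_approx[OF aC]] by simp
    show "nrm CC (U m \<ominus>\<^bsub>CC\<^esub> cls a) \<le> 1 / real (Suc m) + nrm CC (cls (\<lambda>k. a m) \<ominus>\<^bsub>CC\<^esub> cls a)" for m
      using CC.p_diff_tri[OF Uc ac cls_in[OF aC], of m m] CC.p_diff_sym[OF ac Uc, of m m] a(2)[of m] by linarith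
  qed (use Uc aC in auto)
  then show "\<exists>x\<in>carrier CC. (\<lambda>k. nrm CC (U k \<ominus>\<^bsub>CC\<^esub> x)) \<longlonglongrightarrow> 0" using aC by (intro bexI[of _ "cls a"]) auto
qed

end


section \<open>The universal property of the twisted group C*-algebra\<close>

locale twisted_group = group G for G :: "('g, 'm) monoid_scheme" (structure) +
  fixes \<sigma> :: "'g \<Rightarrow> 'g \<Rightarrow> complex"
  assumes cocycle: "two_cocycle G \<sigma>"
begin

abbreviation "T \<equiv> twisted_star_algebra G \<sigma>"

lemma sigma_norm: "r \<in> carrier G \<Longrightarrow> s \<in> carrier G \<Longrightarrow> cmod (\<sigma> r s) = 1"
  and sigma_cocycle: "r \<in> carrier G \<Longrightarrow> s \<in> carrier G \<Longrightarrow> t \<in> carrier G \<Longrightarrow>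
    \<sigma> r s * \<sigma> (r \<otimes> s) t = \<sigma> r (s \<otimes> t) * \<sigma> s t"
  and sigma_one [simp]: "r \<in> carrier G \<Longrightarrow> \<sigma> r \<one> = 1" "r \<in> carrier G \<Longrightarrow> \<sigma> \<one> r = 1"
  using cocycle by (auto simp: two_cocycle_def)

lemma sigma_cnj: "r \<in> carrier G \<Longrightarrow> s \<in> carrier G \<Longrightarrow> cnj (\<sigma> r s) * \<sigma> r s = 1"
  by (simp add: sigma_norm complex_norm_square[symmetric] mult.commute)

lemma sigma_inv: "r \<in> carrier G \<Longrightarrow> \<sigma> (inv r) r = \<sigma> r (inv r)"
  using sigma_cocycle[of r "inv r" r] by simp

lemma sigma_nz: "r \<in> carrier G \<Longrightarrow> s \<in> carrier G \<Longrightarrow> \<sigma> r s \<noteq> 0"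
  using sigma_norm[of r s] by auto

lemma T_carrier: "f \<in> carrier T \<longleftrightarrow> finite {r. f r \<noteq> 0} \<and> (\<forall>r. f r \<noteq> 0 \<longrightarrow> r \<in> carrier G)"
  by (auto simp: twisted_star_algebra_def)

lemma T_ops:
  "f \<oplus>\<^bsub>T\<^esub> g = (\<lambda>t. f t + g t)" "\<zero>\<^bsub>T\<^esub> = (\<lambda>t. 0)" "c \<odot>\<^bsub>T\<^esub> f = (\<lambda>t. c * f t)"
  "\<one>\<^bsub>T\<^esub> = delta \<one>"
  "star T f = (\<lambda>t. if t \<in> carrier G then cnj (f (inv t) * \<sigma> (inv t) t) else 0)"
  by (simp_all add: twisted_star_algebra_def delta_def)

lemma T_mult:
  assumes "finite F" "{r. f r \<noteq> 0} \<subseteq> F" "finite H" "{s. g s \<noteq> 0} \<subseteq> H"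
  shows "f \<otimes>\<^bsub>T\<^esub> g = (\<lambda>t. \<Sum>r\<in>F. \<Sum>s\<in>H. if r \<otimes> s = t then f r * g s * \<sigma> r s else 0)"
proof
  fix t
  have "(\<Sum>s | g s \<noteq> 0. if r \<otimes> s = t then f r * g s * \<sigma> r s else 0) =
    (\<Sum>s\<in>H. if r \<otimes> s = t then f r * g s * \<sigma> r s else 0)" for r
    by (rule sum.mono_neutral_left) (use assms in auto)
  moreover have "(\<Sum>r | f r \<noteq> 0. \<Sum>s\<in>H. if r \<otimes> s = t then f r * g s * \<sigma> r s else 0) =
    (\<Sum>r\<in>F. \<Sum>s\<in>H. if r \<otimes> s = t then f r * g s * \<sigma> r s else 0)"
    by (rule sum.mono_neutral_left) (use assms in \<open>auto intro!: sum.neutral split: if_splits\<close>)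
  ultimately show "(f \<otimes>\<^bsub>T\<^esub> g) t = (\<Sum>r\<in>F. \<Sum>s\<in>H. if r \<otimes> s = t then f r * g s * \<sigma> r s else 0)"
    by (simp add: twisted_star_algebra_def)
qed

lemma T_delta [simp]: "r \<in> carrier G \<Longrightarrow> delta r \<in> carrier T"
proof -
  have "{t. delta r t \<noteq> 0} = {r}" by (auto simp: delta_def)
  then show "r \<in> carrier G \<Longrightarrow> delta r \<in> carrier T" by (auto simp: T_carrier delta_def)
qed

lemma T_add_closed: "f \<in> carrier T \<Longrightarrow> g \<in> carrier T \<Longrightarrow> f \<oplus>\<^bsub>T\<^esub> g \<in> carrier T"
  unfolding T_carrier T_ops
  by (auto intro: finite_subset[of _ "{r. f r \<noteq> 0} \<union> {r. g r \<noteq> 0}"]) (metis add.right_neutral)+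

lemma T_zero_closed: "\<zero>\<^bsub>T\<^esub> \<in> carrier T"
  by (simp add: T_carrier T_ops)

lemma T_smult_closed: "f \<in> carrier T \<Longrightarrow> c \<odot>\<^bsub>T\<^esub> f \<in> carrier T"
  unfolding T_carrier T_ops by (auto intro: finite_subset[of _ "{r. f r \<noteq> 0}"])

lemma T_star_closed: "f \<in> carrier T \<Longrightarrow> star T f \<in> carrier T"
proof -
  assume f: "f \<in> carrier T"
  have "{r. star T f r \<noteq> 0} \<subseteq> m_inv G ` {r. f r \<noteq> 0}"
    by (auto simp: T_ops split: if_splits intro!: image_eqI[of _ _ "inv _"])
  then show ?thesis using f unfolding T_carrier
    by (auto intro: finite_subset simp: T_ops split: if_splits)
qed

lemma T_mult_closed: "f \<in> carrier T \<Longrightarrow> g \<in> carrier T \<Longrightarrow> f \<otimes>\<^bsub>T\<^esub> g \<in> carrier T"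
proof -
  assume f: "f \<in> carrier T" and g: "g \<in> carrier T"
  let ?F = "{r. f r \<noteq> 0}" and ?H = "{r. g r \<noteq> 0}"
  have fin: "finite ?F" "finite ?H" using f g by (auto simp: T_carrier)
  have "(f \<otimes>\<^bsub>T\<^esub> g) t = 0" if "t \<notin> (\<lambda>(r, s). r \<otimes> s) ` (?F \<times> ?H)" for t
    unfolding T_mult[OF fin(1) subset_refl fin(2) subset_refl] by (intro sum.neutral ballI) (use that in auto)
  then have sub: "{t. (f \<otimes>\<^bsub>T\<^esub> g) t \<noteq> 0} \<subseteq> (\<lambda>(r, s). r \<otimes> s) ` (?F \<times> ?H)" by blast
  moreover have "(\<lambda>(r, s). r \<otimes> s) ` (?F \<times> ?H) \<subseteq> carrier G" using f g by (auto simp: T_carrier)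
  ultimately show ?thesis using finite_subset[OF sub] fin unfolding T_carrier by blast
qed

lemma T_induct [consumes 1, case_names zero add delta]:
  assumes "f \<in> carrier T" "P \<zero>\<^bsub>T\<^esub>"
    "\<And>f g. f \<in> carrier T \<Longrightarrow> g \<in> carrier T \<Longrightarrow> P f \<Longrightarrow> P g \<Longrightarrow> P (f \<oplus>\<^bsub>T\<^esub> g)"
    "\<And>c r. r \<in> carrier G \<Longrightarrow> P (c \<odot>\<^bsub>T\<^esub> delta r)"
  shows "P f"
proof -
  have "finite S \<Longrightarrow> S \<subseteq> carrier G \<Longrightarrow> (\<forall>f. {r. f r \<noteq> 0} \<subseteq> S \<longrightarrow> P f)" for S
  proof (induction S rule: finite_induct)
    case empty
    have "f = \<zero>\<^bsub>T\<^esub>" if "{r. f r \<noteq> 0} \<subseteq> {}" for f :: "_ \<Rightarrow> complex" using that by (auto simp: T_ops)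
    then show ?case using assms(2) by blast
  next
    case (insert r S)
    show ?case
    proof (intro allI impI)
      fix f :: "_ \<Rightarrow> complex" assume f: "{t. f t \<noteq> 0} \<subseteq> insert r S"
      have e: "f = (f(r := 0)) \<oplus>\<^bsub>T\<^esub> (f r \<odot>\<^bsub>T\<^esub> delta r)" by (auto simp: T_ops delta_def)
      have s: "{t. (f(r := 0)) t \<noteq> 0} \<subseteq> S" using f by auto
      moreover have "finite {t. (f(r := 0)) t \<noteq> 0}" using s insert(1) by (rule finite_subset)
      ultimately have "f(r := 0) \<in> carrier T" using insert(4) unfolding T_carrier by blast
      then show "P f" using s insert assms(3,4) by (subst e) (auto simp: T_smult_closed)
    qed
  qed
  then show ?thesis using assms(1) unfolding T_carrier by blast
qed

lemma T_l_distr: 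
  assumes "f \<in> carrier T" "f' \<in> carrier T" "g \<in> carrier T"
  shows "(f \<oplus>\<^bsub>T\<^esub> f') \<otimes>\<^bsub>T\<^esub> g = (f \<otimes>\<^bsub>T\<^esub> g) \<oplus>\<^bsub>T\<^esub> (f' \<otimes>\<^bsub>T\<^esub> g)"
proof -
  let ?F = "{r. f r \<noteq> 0} \<union> {r. f' r \<noteq> 0}" and ?H = "{r. g r \<noteq> 0}"
  have F: "finite ?F" "finite ?H" "{r. f r \<noteq> 0} \<subseteq> ?F" "{r. f' r \<noteq> 0} \<subseteq> ?F" "{r. (f \<oplus>\<^bsub>T\<^esub> f') r \<noteq> 0} \<subseteq> ?F"
    using assms by (auto simp: T_carrier T_ops)
  show ?thesis
    unfolding T_mult[OF F(1,3,2) subset_refl] T_mult[OF F(1,4,2) subset_refl] T_mult[OF F(1,5,2) subset_refl]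
    unfolding T_ops sum.distrib[symmetric] by (intro ext sum.cong refl) (simp add: algebra_simps)
qed

lemma T_r_distr: 
  assumes "f \<in> carrier T" "f' \<in> carrier T" "g \<in> carrier T"
  shows "g \<otimes>\<^bsub>T\<^esub> (f \<oplus>\<^bsub>T\<^esub> f') = (g \<otimes>\<^bsub>T\<^esub> f) \<oplus>\<^bsub>T\<^esub> (g \<otimes>\<^bsub>T\<^esub> f')"
proof -
  let ?F = "{r. f r \<noteq> 0} \<union> {r. f' r \<noteq> 0}" and ?H = "{r. g r \<noteq> 0}"
  have F: "finite ?F" "finite ?H" "{r. f r \<noteq> 0} \<subseteq> ?F" "{r. f' r \<noteq> 0} \<subseteq> ?F" "{r. (f \<oplus>\<^bsub>T\<^esub> f') r \<noteq> 0} \<subseteq> ?F"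
    using assms by (auto simp: T_carrier T_ops)
  show ?thesis
    unfolding T_mult[OF F(2) subset_refl F(1,3)] T_mult[OF F(2) subset_refl F(1,4)] T_mult[OF F(2) subset_refl F(1,5)]
    unfolding T_ops sum.distrib[symmetric] by (intro ext sum.cong refl) (simp add: algebra_simps)
qed

lemma T_smult_mult:
  assumes "f \<in> carrier T" "g \<in> carrier T"
  shows "(c \<odot>\<^bsub>T\<^esub> f) \<otimes>\<^bsub>T\<^esub> g = c \<odot>\<^bsub>T\<^esub> (f \<otimes>\<^bsub>T\<^esub> g)" "f \<otimes>\<^bsub>T\<^esub> (c \<odot>\<^bsub>T\<^esub> g) = c \<odot>\<^bsub>T\<^esub> (f \<otimes>\<^bsub>T\<^esub> g)"
proof -
  let ?F = "{r. f r \<noteq> 0}" and ?H = "{r. g r \<noteq> 0}"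
  have F: "finite ?F" "finite ?H" "{r. (c \<odot>\<^bsub>T\<^esub> f) r \<noteq> 0} \<subseteq> ?F" "{r. (c \<odot>\<^bsub>T\<^esub> g) r \<noteq> 0} \<subseteq> ?H"
    using assms by (auto simp: T_carrier T_ops)
  show "(c \<odot>\<^bsub>T\<^esub> f) \<otimes>\<^bsub>T\<^esub> g = c \<odot>\<^bsub>T\<^esub> (f \<otimes>\<^bsub>T\<^esub> g)"
    unfolding T_mult[OF F(1,3,2) subset_refl] T_mult[OF F(1) subset_refl F(2) subset_refl]
    unfolding T_ops sum_distrib_left by (intro ext sum.cong refl) simp
  show "f \<otimes>\<^bsub>T\<^esub> (c \<odot>\<^bsub>T\<^esub> g) = c \<odot>\<^bsub>T\<^esub> (f \<otimes>\<^bsub>T\<^esub> g)"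
    unfolding T_mult[OF F(1) subset_refl F(2,4)] T_mult[OF F(1) subset_refl F(2) subset_refl]
    unfolding T_ops sum_distrib_left by (intro ext sum.cong refl) simp
qed

lemma T_delta_mult: "delta r \<otimes>\<^bsub>T\<^esub> delta s = \<sigma> r s \<odot>\<^bsub>T\<^esub> delta (r \<otimes> s)"
proof -
  have "{t. delta x t \<noteq> 0} \<subseteq> {x}" for x :: 'g by (auto simp: delta_def)
  from T_mult[OF _ this _ this, of r s] show ?thesis by (auto simp: T_ops delta_def)
qed

lemma T_star_delta: "r \<in> carrier G \<Longrightarrow> star T (delta r) = cnj (\<sigma> r (inv r)) \<odot>\<^bsub>T\<^esub> delta (inv r)"
  by (auto simp: T_ops delta_def fun_eq_iff)

lemma T_star_add: "star T (f \<oplus>\<^bsub>T\<^esub> g) = star T f \<oplus>\<^bsub>T\<^esub> star T g"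
  by (auto simp: T_ops algebra_simps)

lemma T_star_smult: "star T (c \<odot>\<^bsub>T\<^esub> f) = cnj c \<odot>\<^bsub>T\<^esub> star T f"
  by (auto simp: T_ops)

lemma T_smult_zero: "c \<odot>\<^bsub>T\<^esub> \<zero>\<^bsub>T\<^esub> = \<zero>\<^bsub>T\<^esub>" and T_smult_add: "c \<odot>\<^bsub>T\<^esub> (f \<oplus>\<^bsub>T\<^esub> g) = c \<odot>\<^bsub>T\<^esub> f \<oplus>\<^bsub>T\<^esub> c \<odot>\<^bsub>T\<^esub> g"
  and T_smult_smult: "c \<odot>\<^bsub>T\<^esub> (d \<odot>\<^bsub>T\<^esub> f) = (c * d) \<odot>\<^bsub>T\<^esub> f" and T_smult_one: "1 \<odot>\<^bsub>T\<^esub> f = f"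
  and T_star_zero: "star T \<zero>\<^bsub>T\<^esub> = \<zero>\<^bsub>T\<^esub>"
  by (auto simp: T_ops algebra_simps)

lemma T_mult_zero: "\<zero>\<^bsub>T\<^esub> \<otimes>\<^bsub>T\<^esub> g = \<zero>\<^bsub>T\<^esub>" "g \<otimes>\<^bsub>T\<^esub> \<zero>\<^bsub>T\<^esub> = \<zero>\<^bsub>T\<^esub>"
  by (auto simp: twisted_star_algebra_def)

lemmas T_closed = T_add_closed T_zero_closed T_smult_closed T_star_closed T_mult_closed T_delta
lemmas T_bilin = T_l_distr T_r_distr T_smult_mult T_mult_zero T_smult_zero T_smult_add T_smult_smult T_closed

lemma T_assoc: "f \<in> carrier T \<Longrightarrow> g \<in> carrier T \<Longrightarrow> h \<in> carrier T \<Longrightarrow> (f \<otimes>\<^bsub>T\<^esub> g) \<otimes>\<^bsub>T\<^esub> h = f \<otimes>\<^bsub>T\<^esub> (g \<otimes>\<^bsub>T\<^esub> h)"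
proof (induction f arbitrary: g h rule: T_induct)
  case (delta c r)
  from delta(2,3,1) show ?case
  proof (induction g arbitrary: h rule: T_induct)
    case (delta d s)
    from delta(2,1,3) show ?case
    proof (induction h rule: T_induct)
      case (delta e t)
      then show ?case by (simp add: T_bilin T_delta_mult m_assoc) (simp add: mult_ac sigma_cocycle)
    qed (simp_all add: T_bilin)
  qed (simp_all add: T_bilin)
qed (simp_all add: T_bilin)

lemma T_one: "f \<in> carrier T \<Longrightarrow> \<one>\<^bsub>T\<^esub> \<otimes>\<^bsub>T\<^esub> f = f" "f \<in> carrier T \<Longrightarrow> f \<otimes>\<^bsub>T\<^esub> \<one>\<^bsub>T\<^esub> = f"
  by (induction f rule: T_induct; simp add: T_bilin T_ops(4) T_delta_mult)+

lemma sigma_star: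
  assumes r: "r \<in> carrier G" and s: "s \<in> carrier G"
  shows "cnj (\<sigma> r s) * cnj (\<sigma> (r \<otimes> s) (inv (r \<otimes> s))) = cnj (\<sigma> s (inv s)) * cnj (\<sigma> r (inv r)) * \<sigma> (inv s) (inv r)"
proof -
  have a: "\<sigma> r s * \<sigma> (r \<otimes> s) (inv s \<otimes> inv r) = \<sigma> r (inv r) * \<sigma> s (inv s \<otimes> inv r)"
    using sigma_cocycle[of r s "inv s \<otimes> inv r"] r s by (simp add: m_assoc[symmetric])
  have b: "\<sigma> s (inv s) = \<sigma> s (inv s \<otimes> inv r) * \<sigma> (inv s) (inv r)"
    using sigma_cocycle[of s "inv s" "inv r"] r s by simp
  have "\<sigma> r s * \<sigma> (r \<otimes> s) (inv (r \<otimes> s)) * \<sigma> (inv s) (inv r) = \<sigma> s (inv s) * \<sigma> r (inv r)"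
    using a b r s by (simp add: inv_mult_group mult_ac)
  then have "cnj (\<sigma> s (inv s)) * cnj (\<sigma> r (inv r)) = cnj (\<sigma> r s) * cnj (\<sigma> (r \<otimes> s) (inv (r \<otimes> s))) * cnj (\<sigma> (inv s) (inv r))"
    by (metis complex_cnj_mult)
  then show ?thesis using sigma_cnj[of "inv s" "inv r"] r s by (simp add: mult.assoc)
qed

lemma T_star_mult: "f \<in> carrier T \<Longrightarrow> g \<in> carrier T \<Longrightarrow> star T (f \<otimes>\<^bsub>T\<^esub> g) = star T g \<otimes>\<^bsub>T\<^esub> star T f"
proof (induction f arbitrary: g rule: T_induct)
  case (delta c r)
  from delta(2,1) show ?case
  proof (induction g rule: T_induct)
    case (delta d s)
    then show ?case using sigma_star[of r s]
      by (simp add: T_bilin T_delta_mult T_star_smult T_star_delta inv_mult_group mult_ac)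
  qed (simp_all add: T_bilin T_star_add T_star_zero)
qed (simp_all add: T_bilin T_star_add T_star_zero)

lemma T_star_star: "f \<in> carrier T \<Longrightarrow> star T (star T f) = f"
proof (induction f rule: T_induct)
  case (delta c r)
  then show ?case using sigma_cnj[of r "inv r"]
    by (simp add: T_star_smult T_star_delta T_smult_smult sigma_inv T_smult_one mult_ac)
qed (simp_all add: T_star_add T_star_zero)

lemma T_star_alg: "star_alg T"
proof -
  have ag: "abelian_group T"
  proof (rule abelian_groupI)
    fix f assume "f \<in> carrier T"
    then show "\<exists>g\<in>carrier T. g \<oplus>\<^bsub>T\<^esub> f = \<zero>\<^bsub>T\<^esub>"
      by (intro bexI[of _ "(-1) \<odot>\<^bsub>T\<^esub> f"] T_smult_closed) (auto simp: T_ops)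
  qed (simp_all add: T_closed, simp_all add: T_ops algebra_simps)
  have mo: "monoid T"
    by (rule monoidI) (simp_all add: T_closed T_assoc T_one[unfolded T_ops(4)] T_ops(4))
  have "ring T" by (rule ringI[OF ag mo]) (simp_all add: T_bilin)
  then show ?thesis
    by (rule star_alg.intro, unfold_locales)
      (simp_all add: T_bilin T_smult_one T_star_star T_star_add T_star_smult T_star_mult, simp add: T_ops algebra_simps)
qed

interpretation T: star_alg T by (rule T_star_alg)

lemma delta_norm_le_1:
  assumes p: "cstar_seminorm T p" and r: "r \<in> carrier G" shows "p (delta r) \<le> 1"
proof -
  interpret seminormed_star_alg T p by (intro seminormed_star_alg.intro seminormed_star_alg_axioms.intro T_star_alg p)
  have d: "star T (delta r) \<otimes>\<^bsub>T\<^esub> delta r = \<one>\<^bsub>T\<^esub>"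
    using r by (simp add: T_star_delta T_bilin T_delta_mult sigma_inv sigma_cnj T_smult_one T_ops(4))
  have "(p \<one>\<^bsub>T\<^esub>)\<^sup>2 = p \<one>\<^bsub>T\<^esub>" using p_star_mult[of "\<one>\<^bsub>T\<^esub>"] by simp
  then have "p \<one>\<^bsub>T\<^esub> \<le> 1" by (auto simp: power2_eq_square)
  then have "(p (delta r))\<^sup>2 \<le> 1" using p_star_mult[of "delta r"] r d by simp
  then show ?thesis by (simp add: power_le_one_iff abs_square_le_1)
qed

lemma seminorm_bound:
  assumes "f \<in> carrier T" shows "\<exists>B. \<forall>p. cstar_seminorm T p \<longrightarrow> p f \<le> B"
  using assms
proof (induction f rule: T_induct)
  case zero
  have "p \<zero>\<^bsub>T\<^esub> = 0" if "cstar_seminorm T p" for p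
    using seminormed_star_alg.p_zero[of T p] that T_star_alg by (simp add: seminormed_star_alg_def seminormed_star_alg_axioms_def)
  then show ?case by (metis order_refl)
next
  case (add f g)
  then obtain B C where B: "\<And>p. cstar_seminorm T p \<Longrightarrow> p f \<le> B" "\<And>p. cstar_seminorm T p \<Longrightarrow> p g \<le> C" by blast
  have "p (f \<oplus>\<^bsub>T\<^esub> g) \<le> B + C" if p: "cstar_seminorm T p" for p
  proof -
    have "p (f \<oplus>\<^bsub>T\<^esub> g) \<le> p f + p g" using p add by (simp add: cstar_seminorm_def)
    then show ?thesis using B[OF p] by linarith
  qed
  then show ?case by blast
next
  case (delta c r)
  have "p (c \<odot>\<^bsub>T\<^esub> delta r) \<le> cmod c" if p: "cstar_seminorm T p" for p
  proof -
    have "p (c \<odot>\<^bsub>T\<^esub> delta r) = cmod c * p (delta r)" using p delta by (simp add: cstar_seminorm_def)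
    then show ?thesis using delta_norm_le_1[OF p delta] by (simp add: mult_left_le)
  qed
  then show ?case by blast
qed

lemma max_norm_upper: "cstar_seminorm T p \<Longrightarrow> f \<in> carrier T \<Longrightarrow> p f \<le> max_norm T f"
  unfolding max_norm_def using seminorm_bound[of f] by (intro cSUP_upper) (auto simp: bdd_above_def)

lemma zero_seminorm: "cstar_seminorm T (\<lambda>f. 0)" by (simp add: cstar_seminorm_def)

lemma max_norm_least: "(\<And>p. cstar_seminorm T p \<Longrightarrow> p f \<le> B) \<Longrightarrow> max_norm T f \<le> B"
  unfolding max_norm_def using zero_seminorm by (intro cSUP_least) auto

lemma max_norm_cstar: "cstar_seminorm T (max_norm T)"
proof -
  let ?n = "max_norm T"
  have nn: "0 \<le> ?n f" if "f \<in> carrier T" for f using max_norm_upper[OF zero_seminorm that] .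
  have sc: "?n (c \<odot>\<^bsub>T\<^esub> f) \<le> cmod c * ?n f" if f: "f \<in> carrier T" for c f
  proof (rule max_norm_least)
    fix p assume p: "cstar_seminorm T p"
    then have "p (c \<odot>\<^bsub>T\<^esub> f) = cmod c * p f" using f by (simp add: cstar_seminorm_def)
    then show "p (c \<odot>\<^bsub>T\<^esub> f) \<le> cmod c * ?n f" using max_norm_upper[OF p f] by (simp add: mult_left_mono)
  qed
  have sm: "?n (c \<odot>\<^bsub>T\<^esub> f) = cmod c * ?n f" if f: "f \<in> carrier T" for c f
  proof (cases "c = 0")
    case True
    then show ?thesis using sc[OF f, of 0] nn[of "0 \<odot>\<^bsub>T\<^esub> f"] f by (simp add: T_closed)
  next
    case False
    have "?n f = ?n (inverse c \<odot>\<^bsub>T\<^esub> (c \<odot>\<^bsub>T\<^esub> f))" using False by (simp add: T_smult_smult T_smult_one)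
    also have "\<dots> \<le> cmod (inverse c) * ?n (c \<odot>\<^bsub>T\<^esub> f)" using f by (intro sc T_closed)
    finally have "cmod c * ?n f \<le> ?n (c \<odot>\<^bsub>T\<^esub> f)" using False unfolding norm_inverse by (simp add: field_simps)
    then show ?thesis using sc[OF f, of c] by simp
  qed
  have ad: "?n (f \<oplus>\<^bsub>T\<^esub> g) \<le> ?n f + ?n g" if f: "f \<in> carrier T" and g: "g \<in> carrier T" for f g
  proof (rule max_norm_least)
    fix p assume p: "cstar_seminorm T p"
    then have "p (f \<oplus>\<^bsub>T\<^esub> g) \<le> p f + p g" using f g by (simp add: cstar_seminorm_def)
    then show "p (f \<oplus>\<^bsub>T\<^esub> g) \<le> ?n f + ?n g" using max_norm_upper[OF p f] max_norm_upper[OF p g] by linarith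
  qed
  have mu: "?n (f \<otimes>\<^bsub>T\<^esub> g) \<le> ?n f * ?n g" if f: "f \<in> carrier T" and g: "g \<in> carrier T" for f g
  proof (rule max_norm_least)
    fix p assume p: "cstar_seminorm T p"
    then have "p (f \<otimes>\<^bsub>T\<^esub> g) \<le> p f * p g" "0 \<le> p g" using f g by (simp_all add: cstar_seminorm_def)
    moreover have "p f * p g \<le> ?n f * ?n g"
      using max_norm_upper[OF p f] max_norm_upper[OF p g] nn[OF f] \<open>0 \<le> p g\<close> by (intro mult_mono)
    ultimately show "p (f \<otimes>\<^bsub>T\<^esub> g) \<le> ?n f * ?n g" by linarith
  qed
  have st: "?n (star T f \<otimes>\<^bsub>T\<^esub> f) = (?n f)\<^sup>2" if f: "f \<in> carrier T" for f
  proof (rule antisym)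
    show "?n (star T f \<otimes>\<^bsub>T\<^esub> f) \<le> (?n f)\<^sup>2"
    proof (rule max_norm_least)
      fix p assume p: "cstar_seminorm T p"
      then have "p (star T f \<otimes>\<^bsub>T\<^esub> f) = (p f)\<^sup>2" "0 \<le> p f" using f by (simp_all add: cstar_seminorm_def)
      then show "p (star T f \<otimes>\<^bsub>T\<^esub> f) \<le> (?n f)\<^sup>2" using max_norm_upper[OF p f] by (simp add: power_mono)
    qed
    have "?n f \<le> sqrt (?n (star T f \<otimes>\<^bsub>T\<^esub> f))"
    proof (rule max_norm_least)
      fix p assume p: "cstar_seminorm T p"
      then have "(p f)\<^sup>2 = p (star T f \<otimes>\<^bsub>T\<^esub> f)" using f by (simp_all add: cstar_seminorm_def)
      also have "\<dots> \<le> ?n (star T f \<otimes>\<^bsub>T\<^esub> f)" using f p by (intro max_norm_upper) (auto simp: T_closed)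
      finally show "p f \<le> sqrt (?n (star T f \<otimes>\<^bsub>T\<^esub> f))" by (rule real_le_rsqrt)
    qed
    then have "(?n f)\<^sup>2 \<le> (sqrt (?n (star T f \<otimes>\<^bsub>T\<^esub> f)))\<^sup>2" using nn[OF f] by (rule power_mono)
    then show "(?n f)\<^sup>2 \<le> ?n (star T f \<otimes>\<^bsub>T\<^esub> f)" using f nn by (simp add: T_closed)
  qed
  show ?thesis unfolding cstar_seminorm_def by (intro conjI ballI allI nn ad sm mu st)
qed

interpretation M: seminormed_star_alg T "max_norm T"
  by (intro seminormed_star_alg.intro seminormed_star_alg_axioms.intro T_star_alg max_norm_cstar)

abbreviation "C \<equiv> twisted_cstar G \<sigma>"
abbreviation "\<iota> \<equiv> twisted_unitary G \<sigma>"

lemma C_cstar_alg: "cstar_alg C"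
  unfolding twisted_cstar_def by (rule M.CC_cstar_alg)

lemma iota_mult: "r \<in> carrier G \<Longrightarrow> s \<in> carrier G \<Longrightarrow> \<iota> r \<otimes>\<^bsub>C\<^esub> \<iota> s = \<sigma> r s \<odot>\<^bsub>C\<^esub> \<iota> (r \<otimes> s)"
  unfolding twisted_cstar_def twisted_unitary_def
  by (simp add: M.CC_mult M.CC_smult M.CS_const T_delta_mult)

lemma iota_unitary: "r \<in> carrier G \<Longrightarrow> unitary_elem C (\<iota> r)"
  unfolding twisted_cstar_def twisted_unitary_def unitary_elem_def
  by (simp add: M.CC_mult M.CC_star M.CC_one M.CS_const M.CS_star T_star_delta T_bilin T_delta_mult
      sigma_inv sigma_cnj T_smult_one T_ops(4))

lemma C_generated:
  assumes S: "S \<subseteq> carrier C" "closed_in C S" "\<And>r. r \<in> carrier G \<Longrightarrow> \<iota> r \<in> S"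
    "\<And>x y. x \<in> S \<Longrightarrow> y \<in> S \<Longrightarrow> x \<oplus>\<^bsub>C\<^esub> y \<in> S" "\<And>c x. x \<in> S \<Longrightarrow> c \<odot>\<^bsub>C\<^esub> x \<in> S"
  shows "S = carrier C"
proof -
  have d: "M.cls (\<lambda>k. f) \<in> S" if "f \<in> carrier T" for f
    using that
  proof (induction f rule: T_induct)
    case zero
    have "0 \<odot>\<^bsub>C\<^esub> \<iota> \<one> \<in> S" using S by simp
    then show ?case unfolding twisted_cstar_def twisted_unitary_def by (simp add: M.CC_smult M.CS_const)
  next
    case (add f g)
    then have "M.cls (\<lambda>k. f) \<oplus>\<^bsub>C\<^esub> M.cls (\<lambda>k. g) \<in> S" using S by simp
    then show ?case using add unfolding twisted_cstar_def by (simp add: M.CC_add M.CS_const)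
  next
    case (delta c r)
    then have "c \<odot>\<^bsub>C\<^esub> \<iota> r \<in> S" using S by simp
    then show ?case using delta unfolding twisted_cstar_def twisted_unitary_def by (simp add: M.CC_smult M.CS_const)
  qed
  have "x \<in> S" if x: "x \<in> carrier C" for x
  proof -
    obtain X where X: "X \<in> M.CS" "x = M.cls X"
      using x unfolding twisted_cstar_def by (elim M.CC_cases)
    have "(\<lambda>m. nrm C (M.cls (\<lambda>k. X m) \<ominus>\<^bsub>C\<^esub> x)) \<longlonglongrightarrow> 0"
      using M.CC_approx[OF X(1)] by (simp add: X twisted_cstar_def)
    moreover have "\<forall>m. M.cls (\<lambda>k. X m) \<in> S" using d M.CS_carrier[OF X(1)] by blast
    ultimately show ?thesis
      using S(2)[unfolded closed_in_def, rule_format, of "\<lambda>m. M.cls (\<lambda>k. X m)" x] x by simp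
  qed
  then show ?thesis using S(1) by blast
qed

lemma C_universal:
  fixes B :: "('b, 'k) cstar_struct_scheme"
  assumes B: "cstar_alg B" and u: "\<And>r. r \<in> carrier G \<Longrightarrow> unitary_elem B (u r)"
    and um: "\<And>r s. r \<in> carrier G \<Longrightarrow> s \<in> carrier G \<Longrightarrow> u r \<otimes>\<^bsub>B\<^esub> u s = \<sigma> r s \<odot>\<^bsub>B\<^esub> u (r \<otimes> s)"
  shows "\<exists>h. star_hom C B h \<and> (\<forall>r\<in>carrier G. h (\<iota> r) = u r)"
proof -
  interpret B: cstar_alg B by (rule B)
  interpret B: seminormed_star_alg B "nrm B"
    by (intro seminormed_star_alg.intro seminormed_star_alg_axioms.intro B.star_alg_axioms B.nrm_cstar)
  have uc [simp]: "u r \<in> carrier B" if "r \<in> carrier G" for r using u[OF that] by (simp add: unitary_elem_def)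
  have us: "star B (u r) \<otimes>\<^bsub>B\<^esub> u r = \<one>\<^bsub>B\<^esub>" if "r \<in> carrier G" for r using u[OF that] by (simp add: unitary_elem_def)
  have cancel: "x = y" if "r \<in> carrier G" "x \<in> carrier B" "y \<in> carrier B" "u r \<otimes>\<^bsub>B\<^esub> x = u r \<otimes>\<^bsub>B\<^esub> y" for r x y
  proof -
    have "(star B (u r) \<otimes>\<^bsub>B\<^esub> u r) \<otimes>\<^bsub>B\<^esub> x = (star B (u r) \<otimes>\<^bsub>B\<^esub> u r) \<otimes>\<^bsub>B\<^esub> y"
      using that by (simp add: B.m_assoc)
    then show ?thesis using that us[of r] by simp
  qed
  have u1: "u \<one> = \<one>\<^bsub>B\<^esub>" by (rule cancel[of "\<one>"]) (simp_all add: um)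
  have ustar: "star B (u r) = cnj (\<sigma> r (inv r)) \<odot>\<^bsub>B\<^esub> u (inv r)" if r: "r \<in> carrier G" for r
  proof (rule cancel[OF r])
    have "u r \<otimes>\<^bsub>B\<^esub> (cnj (\<sigma> r (inv r)) \<odot>\<^bsub>B\<^esub> u (inv r)) = cnj (\<sigma> r (inv r)) \<odot>\<^bsub>B\<^esub> (\<sigma> r (inv r) \<odot>\<^bsub>B\<^esub> \<one>\<^bsub>B\<^esub>)"
      using r by (simp only: B.smult_mult_r um uc inv_closed r_inv u1)
    also have "\<dots> = (cnj (\<sigma> r (inv r)) * \<sigma> r (inv r)) \<odot>\<^bsub>B\<^esub> \<one>\<^bsub>B\<^esub>" by (rule B.smult_assoc1[symmetric]) simp
    also have "\<dots> = \<one>\<^bsub>B\<^esub>" using r by (simp only: sigma_cnj inv_closed B.smult_one B.one_closed)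
    finally show "u r \<otimes>\<^bsub>B\<^esub> star B (u r) = u r \<otimes>\<^bsub>B\<^esub> (cnj (\<sigma> r (inv r)) \<odot>\<^bsub>B\<^esub> u (inv r))"
      using u[OF r] by (simp add: unitary_elem_def)
  qed (use r in auto)
  define \<phi> where "\<phi> f = finsum B (\<lambda>r. f r \<odot>\<^bsub>B\<^esub> u r) {r. f r \<noteq> 0}" for f
  have \<phi>F: "\<phi> f = finsum B (\<lambda>r. f r \<odot>\<^bsub>B\<^esub> u r) F" if "finite F" "{r. f r \<noteq> 0} \<subseteq> F" "F \<subseteq> carrier G" for f F
    unfolding \<phi>_def using that by (intro B.add.finprod_mono_neutral_cong_left) auto
  have \<phi>_closed [simp]: "\<phi> f \<in> carrier B" if "f \<in> carrier T" for f
    unfolding \<phi>_def using that by (intro B.finsum_closed) (auto simp: T_carrier)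
  have \<phi>_zero: "\<phi> \<zero>\<^bsub>T\<^esub> = \<zero>\<^bsub>B\<^esub>" by (simp add: \<phi>_def T_ops)
  have \<phi>_add: "\<phi> (f \<oplus>\<^bsub>T\<^esub> g) = \<phi> f \<oplus>\<^bsub>B\<^esub> \<phi> g" if f: "f \<in> carrier T" and g: "g \<in> carrier T" for f g
  proof -
    let ?F = "{r. f r \<noteq> 0} \<union> {r. g r \<noteq> 0}"
    have F: "finite ?F" "?F \<subseteq> carrier G" using f g by (auto simp: T_carrier)
    have e: "\<phi> f = finsum B (\<lambda>r. f r \<odot>\<^bsub>B\<^esub> u r) ?F" "\<phi> g = finsum B (\<lambda>r. g r \<odot>\<^bsub>B\<^esub> u r) ?F"
      "\<phi> (f \<oplus>\<^bsub>T\<^esub> g) = finsum B (\<lambda>r. (f \<oplus>\<^bsub>T\<^esub> g) r \<odot>\<^bsub>B\<^esub> u r) ?F"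
      by (rule \<phi>F[OF F(1) _ F(2)]; auto simp: T_ops)+
    have "finsum B (\<lambda>r. f r \<odot>\<^bsub>B\<^esub> u r \<oplus>\<^bsub>B\<^esub> g r \<odot>\<^bsub>B\<^esub> u r) ?F = \<phi> f \<oplus>\<^bsub>B\<^esub> \<phi> g"
      unfolding e(1,2) using F by (intro B.finsum_addf) auto
    moreover have "\<phi> (f \<oplus>\<^bsub>T\<^esub> g) = finsum B (\<lambda>r. f r \<odot>\<^bsub>B\<^esub> u r \<oplus>\<^bsub>B\<^esub> g r \<odot>\<^bsub>B\<^esub> u r) ?F"
      unfolding e(3) using F by (intro B.finsum_cong') (auto simp: T_ops B.smult_l_distr)
    ultimately show ?thesis by simp
  qed
  have \<phi>_delta: "\<phi> (c \<odot>\<^bsub>T\<^esub> delta r) = c \<odot>\<^bsub>B\<^esub> u r" if r: "r \<in> carrier G" for c r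
    by (subst \<phi>F[of "{r}"]) (use r in \<open>auto simp: T_ops delta_def\<close>)
  have \<phi>_smult: "\<phi> (c \<odot>\<^bsub>T\<^esub> f) = c \<odot>\<^bsub>B\<^esub> \<phi> f" if "f \<in> carrier T" for c f
    using that
    by (induction f rule: T_induct)
      (simp_all add: T_bilin \<phi>_zero \<phi>_add \<phi>_delta B.smult_r_distr B.smult_assoc1)
  have \<phi>_mult: "\<phi> (f \<otimes>\<^bsub>T\<^esub> g) = \<phi> f \<otimes>\<^bsub>B\<^esub> \<phi> g" if "f \<in> carrier T" "g \<in> carrier T" for f g
    using that
  proof (induction f arbitrary: g rule: T_induct)
    case (delta c r)
    from delta(2,1) show ?case
    proof (induction g rule: T_induct)
      case (delta d s)
      then show ?case
        by (simp add: T_bilin T_delta_mult \<phi>_delta B.smult_mult_l B.smult_mult_r um B.smult_assoc1[symmetric] mult_ac)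
    qed (simp_all add: T_bilin \<phi>_zero \<phi>_add B.r_distr \<phi>_delta)
  qed (simp_all add: T_bilin \<phi>_zero \<phi>_add B.l_distr)
  have \<phi>_star: "\<phi> (star T f) = star B (\<phi> f)" if "f \<in> carrier T" for f
    using that
    by (induction f rule: T_induct)
      (simp_all add: T_closed T_star_zero T_star_add T_star_smult T_star_delta T_smult_smult
        \<phi>_zero \<phi>_add \<phi>_delta B.star_add B.star_smult ustar B.smult_assoc1)
  have \<phi>_one: "\<phi> \<one>\<^bsub>T\<^esub> = \<one>\<^bsub>B\<^esub>" using \<phi>_delta[of "\<one>" 1] by (simp add: T_smult_one T_ops(4) u1)
  have "cstar_seminorm T (\<lambda>f. nrm B (\<phi> f))"
    unfolding cstar_seminorm_def
    by (simp add: \<phi>_add \<phi>_smult \<phi>_mult \<phi>_star B.p_nonneg B.p_add B.p_smult B.p_mult B.p_star_mult)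
  then have bound: "nrm B (\<phi> f) \<le> max_norm T f" if "f \<in> carrier T" for f using max_norm_upper that by blast
  have \<phi>_diff: "\<phi> (f \<ominus>\<^bsub>T\<^esub> g) = \<phi> f \<ominus>\<^bsub>B\<^esub> \<phi> g" if "f \<in> carrier T" "g \<in> carrier T" for f g
    using that by (simp add: T.minus_eq B.minus_eq T.minus_smult B.minus_smult \<phi>_add \<phi>_smult T_closed)
  define L where "L x b \<longleftrightarrow> b \<in> carrier B \<and> (\<lambda>k. nrm B (\<phi> (rep x k) \<ominus>\<^bsub>B\<^esub> b)) \<longlonglongrightarrow> 0" for x b
  define h where "h x = (SOME b. L x b)" for x
  have L: "(\<lambda>k. nrm B (\<phi> (X k) \<ominus>\<^bsub>B\<^esub> h (M.cls X))) \<longlonglongrightarrow> 0" and hc: "h (M.cls X) \<in> carrier B" if X: "X \<in> M.CS" for X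
  proof -
    let ?R = "rep (M.cls X)"
    have R: "?R \<in> M.CS" using M.rep_cls X by blast
    have "(\<lambda>k. \<phi> (?R k)) \<in> cauchy_seqs B (nrm B)"
    proof (rule B.CS_I)
      fix e :: real assume "e > 0"
      from M.CS_D[OF R this] obtain N where N: "\<forall>m\<ge>N. \<forall>k\<ge>N. max_norm T (?R m \<ominus>\<^bsub>T\<^esub> ?R k) < e" by blast
      have "nrm B (\<phi> (?R m) \<ominus>\<^bsub>B\<^esub> \<phi> (?R k)) < e" if "m \<ge> N" "k \<ge> N" for m k
        using N that bound[of "?R m \<ominus>\<^bsub>T\<^esub> ?R k"] M.CS_carrier[OF R] by (fastforce simp: \<phi>_diff)
      then show "\<exists>N. \<forall>m\<ge>N. \<forall>k\<ge>N. nrm B (\<phi> (?R m) \<ominus>\<^bsub>B\<^esub> \<phi> (?R k)) < e" by blast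
    qed (use M.CS_carrier[OF R] in auto)
    from B.nrm_complete[OF this] have "\<exists>b. L (M.cls X) b" by (auto simp: L_def)
    then have "L (M.cls X) (h (M.cls X))" unfolding h_def by (rule someI_ex)
    then have *: "h (M.cls X) \<in> carrier B" "(\<lambda>k. nrm B (\<phi> (?R k) \<ominus>\<^bsub>B\<^esub> h (M.cls X))) \<longlonglongrightarrow> 0" by (auto simp: L_def)
    show "h (M.cls X) \<in> carrier B" by (rule *)
    show "(\<lambda>k. nrm B (\<phi> (X k) \<ominus>\<^bsub>B\<^esub> h (M.cls X))) \<longlonglongrightarrow> 0"
    proof (rule B.null_dominated)
      show "(\<lambda>k. max_norm T (?R k \<ominus>\<^bsub>T\<^esub> X k) + nrm B (\<phi> (?R k) \<ominus>\<^bsub>B\<^esub> h (M.cls X))) \<longlonglongrightarrow> 0"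
        using tendsto_add[OF M.rep_null[OF X] *(2)] by simp
      fix k
      have c: "X k \<in> carrier T" "?R k \<in> carrier T" using M.CS_carrier X R by auto
      show "\<phi> (X k) \<ominus>\<^bsub>B\<^esub> h (M.cls X) \<in> carrier B" using c * by simp
      have "nrm B (\<phi> (X k) \<ominus>\<^bsub>B\<^esub> \<phi> (?R k)) \<le> max_norm T (?R k \<ominus>\<^bsub>T\<^esub> X k)"
        using bound[of "?R k \<ominus>\<^bsub>T\<^esub> X k"] c by (simp add: \<phi>_diff B.p_diff_sym)
      then show "nrm B (\<phi> (X k) \<ominus>\<^bsub>B\<^esub> h (M.cls X)) \<le> max_norm T (?R k \<ominus>\<^bsub>T\<^esub> X k) + nrm B (\<phi> (?R k) \<ominus>\<^bsub>B\<^esub> h (M.cls X))"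
        using B.p_diff_tri[of "\<phi> (X k)" "\<phi> (?R k)" "h (M.cls X)"] c *(1) by simp
    qed
  qed
  have uniq: "h (M.cls X) = b" if X: "X \<in> M.CS" and b: "b \<in> carrier B" "(\<lambda>k. nrm B (\<phi> (X k) \<ominus>\<^bsub>B\<^esub> b)) \<longlonglongrightarrow> 0" for X b
  proof -
    have c: "\<phi> (X k) \<in> carrier B" for k using M.CS_carrier[OF X] by simp
    have "nrm B (h (M.cls X) \<ominus>\<^bsub>B\<^esub> b) \<le> nrm B (\<phi> (X k) \<ominus>\<^bsub>B\<^esub> h (M.cls X)) + nrm B (\<phi> (X k) \<ominus>\<^bsub>B\<^esub> b)" for k
      using B.p_diff_tri[OF hc[OF X] c[of k] b(1)] B.p_diff_sym[OF hc[OF X] c[of k]] by simp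
    then have "nrm B (h (M.cls X) \<ominus>\<^bsub>B\<^esub> b) \<le> 0"
      using tendsto_lowerbound[OF tendsto_add[OF L[OF X] b(2)]] by simp
    then have "nrm B (h (M.cls X) \<ominus>\<^bsub>B\<^esub> b) = 0" using B.p_nonneg[of "h (M.cls X) \<ominus>\<^bsub>B\<^esub> b"] hc[OF X] b by simp
    then have "h (M.cls X) \<ominus>\<^bsub>B\<^esub> b = \<zero>\<^bsub>B\<^esub>" using hc[OF X] b by (intro B.nrm_zero_imp) auto
    then have "\<zero>\<^bsub>B\<^esub> \<oplus>\<^bsub>B\<^esub> b = (h (M.cls X) \<ominus>\<^bsub>B\<^esub> b) \<oplus>\<^bsub>B\<^esub> b" by simp
    also have "\<dots> = h (M.cls X)" using hc[OF X] b(1) by algebra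
    finally show ?thesis using b(1) by simp
  qed
  have h_const: "h (M.cls (\<lambda>k. f)) = \<phi> f" if f: "f \<in> carrier T" for f
    using f by (intro uniq) (auto simp: M.CS_const B.minus_eq B.r_neg)
  have h_add: "h (M.cls (\<lambda>k. X k \<oplus>\<^bsub>T\<^esub> Y k)) = h (M.cls X) \<oplus>\<^bsub>B\<^esub> h (M.cls Y)" if X: "X \<in> M.CS" and Y: "Y \<in> M.CS" for X Y
  proof (rule uniq[OF M.CS_add[OF X Y]])
    show "(\<lambda>k. nrm B (\<phi> (X k \<oplus>\<^bsub>T\<^esub> Y k) \<ominus>\<^bsub>B\<^esub> (h (M.cls X) \<oplus>\<^bsub>B\<^esub> h (M.cls Y)))) \<longlonglongrightarrow> 0"
      using tendsto_add[OF L[OF X] L[OF Y]] hc[OF X] hc[OF Y] M.CS_carrier[OF X] M.CS_carrier[OF Y]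
      by (intro B.null_dominated[where b = "\<lambda>k. nrm B (\<phi> (X k) \<ominus>\<^bsub>B\<^esub> h (M.cls X)) + nrm B (\<phi> (Y k) \<ominus>\<^bsub>B\<^esub> h (M.cls Y))"])
        (simp_all add: T_closed \<phi>_add B.p_diff_add)
  qed (use hc X Y in auto)
  have h_mult: "h (M.cls (\<lambda>k. X k \<otimes>\<^bsub>T\<^esub> Y k)) = h (M.cls X) \<otimes>\<^bsub>B\<^esub> h (M.cls Y)" if X: "X \<in> M.CS" and Y: "Y \<in> M.CS" for X Y
  proof (rule uniq[OF M.CS_mult[OF X Y]])
    obtain K where K: "K > 0" "\<And>k. max_norm T (Y k) \<le> K" using M.CS_bounded[OF Y] by blast
    have YK: "nrm B (\<phi> (Y k)) \<le> K" for k using bound[of "Y k"] M.CS_carrier[OF Y] K(2)[of k] by fastforce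
    let ?b = "\<lambda>k. nrm B (\<phi> (X k) \<ominus>\<^bsub>B\<^esub> h (M.cls X)) * K + nrm B (h (M.cls X)) * nrm B (\<phi> (Y k) \<ominus>\<^bsub>B\<^esub> h (M.cls Y))"
    have b0: "?b \<longlonglongrightarrow> 0"
      using tendsto_add[OF tendsto_mult_right[OF L[OF X], of K] tendsto_mult_left[OF L[OF Y], of "nrm B (h (M.cls X))"]] by simp
    show "(\<lambda>k. nrm B (\<phi> (X k \<otimes>\<^bsub>T\<^esub> Y k) \<ominus>\<^bsub>B\<^esub> (h (M.cls X) \<otimes>\<^bsub>B\<^esub> h (M.cls Y)))) \<longlonglongrightarrow> 0"
    proof (rule B.null_dominated[OF b0])
      fix k
      have c: "X k \<in> carrier T" "Y k \<in> carrier T" "h (M.cls X) \<in> carrier B" "h (M.cls Y) \<in> carrier B"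
        using hc M.CS_carrier X Y by auto
      then show "\<phi> (X k \<otimes>\<^bsub>T\<^esub> Y k) \<ominus>\<^bsub>B\<^esub> (h (M.cls X) \<otimes>\<^bsub>B\<^esub> h (M.cls Y)) \<in> carrier B" by (simp add: T_closed)
      have "nrm B (\<phi> (X k) \<ominus>\<^bsub>B\<^esub> h (M.cls X)) * nrm B (\<phi> (Y k)) \<le> nrm B (\<phi> (X k) \<ominus>\<^bsub>B\<^esub> h (M.cls X)) * K"
        using YK c by (intro mult_left_mono B.p_nonneg) auto
      then show "nrm B (\<phi> (X k \<otimes>\<^bsub>T\<^esub> Y k) \<ominus>\<^bsub>B\<^esub> (h (M.cls X) \<otimes>\<^bsub>B\<^esub> h (M.cls Y))) \<le> ?b k"
        using B.p_diff_mult[of "\<phi> (X k)" "\<phi> (Y k)" "h (M.cls X)" "h (M.cls Y)"] c by (simp add: \<phi>_mult)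
    qed
  qed (use hc X Y in auto)
  have h_smult: "h (M.cls (\<lambda>k. c \<odot>\<^bsub>T\<^esub> X k)) = c \<odot>\<^bsub>B\<^esub> h (M.cls X)" if X: "X \<in> M.CS" for X c
    using X hc[OF X] M.CS_carrier[OF X] tendsto_mult_left[OF L[OF X], of "cmod c"]
    by (intro uniq) (simp_all add: M.CS_smult \<phi>_smult B.p_diff_smult)
  have h_star: "h (M.cls (\<lambda>k. star T (X k))) = star B (h (M.cls X))" if X: "X \<in> M.CS" for X
    using X hc[OF X] M.CS_carrier[OF X] L[OF X]
    by (intro uniq) (simp_all add: M.CS_star \<phi>_star B.p_diff_star)
  have "star_hom C B h"
    unfolding star_hom_def twisted_cstar_def
    by (auto intro!: ring_hom_memI elim!: M.CC_cases
        simp: hc M.CC_mult M.CC_add M.CC_smult M.CC_star M.CC_one h_mult h_add h_smult h_star h_const T_closed \<phi>_one)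
  moreover have "h (\<iota> r) = u r" if "r \<in> carrier G" for r
    using that \<phi>_delta[of r 1] by (simp add: twisted_unitary_def h_const T_smult_one)
  ultimately show ?thesis by blast
qed

end


section \<open>The cocycle on the free nilpotent group\<close>

lemma group_free_nil2: "group (free_nil2 n)"
proof (rule groupI)
  fix x assume "x \<in> carrier (free_nil2 n)"
  then show "\<exists>y\<in>carrier (free_nil2 n). y \<otimes>\<^bsub>free_nil2 n\<^esub> x = \<one>\<^bsub>free_nil2 n\<^esub>"
    by (intro bexI[of _ "(\<lambda>i. - fst x i, \<lambda>j k. if 1 \<le> j \<and> j < k \<and> k \<le> n then fst x j * fst x k - snd x j k else 0)"])
       (auto simp: free_nil2_def fun_eq_iff)
qed (auto simp: free_nil2_def fun_eq_iff algebra_simps)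

lemma powi_cocycle:
  assumes "z \<noteq> (0::complex)" "a + b = c + (d::int)"
  shows "z powi a * z powi b = z powi c * z powi d"
  using assms by (metis power_int_add)

lemma pascal_half: "((r + s) * (r + s - 1)) div 2 = (r * (r - 1)) div 2 + (s * (s - 1)) div 2 + r * (s::int)"
proof -
  have "(r + s) * (r + s - 1) = r * (r - 1) + (s * (s - 1)) + 2 * (r * s)" by (simp add: algebra_simps)
  moreover obtain u v where "r * (r - 1) = 2 * u" "s * (s - 1) = 2 * v"
    by (meson dvd_def even_mult_iff odd_even_add odd_one even_diff_iff)
  ultimately have "(r + s) * (r + s - 1) = 2 * (u + v + r * s)" "r * (r - 1) = 2 * u" "s * (s - 1) = 2 * v"
    by (simp_all add: algebra_simps)
  then show ?thesis by simp
qed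

lemma exponent_jjk:
  fixes rj sj sjk tjk sk tk :: int
  shows "sjk * rj + sk * (rj * (rj - 1) div 2) + (tjk * (rj + sj) + tk * ((rj + sj) * (rj + sj - 1) div 2)) =
    (sjk + tjk + sj * tk) * rj + (sk + tk) * (rj * (rj - 1) div 2) + (tjk * sj + tk * (sj * (sj - 1) div 2))"
proof -
  define u v where "u = rj * (rj - 1) div 2" and "v = sj * (sj - 1) div 2"
  show ?thesis unfolding pascal_half u_def[symmetric] v_def[symmetric] by (simp add: algebra_simps)
qed

lemma exponent_kjk:
  fixes rj sj rk sk sjk tjk tk :: int
  shows "rk * (sjk + rj * sk) + rj * (sk * (sk - 1) div 2) +
      ((rk + sk) * (tjk + (rj + sj) * tk) + (rj + sj) * (tk * (tk - 1) div 2)) =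
    rk * (sjk + tjk + sj * tk + rj * (sk + tk)) + rj * ((sk + tk) * (sk + tk - 1) div 2) +
      (sk * (tjk + sj * tk) + sj * (tk * (tk - 1) div 2))"
proof -
  define u v where "u = sk * (sk - 1) div 2" and "v = tk * (tk - 1) div 2"
  show ?thesis unfolding pascal_half u_def[symmetric] v_def[symmetric] by (simp add: algebra_simps)
qed

lemma prod_pairs:
  fixes f g f' g' :: "'z \<Rightarrow> complex"
  assumes "\<And>x. x \<in> S \<Longrightarrow> f x * g x = f' x * g' x"
  shows "prod f S * prod g S = prod f' S * prod g' S"
  using assms by (simp add: prod.distrib[symmetric] cong: prod.cong)

lemma cmod_prod_one: "(\<And>x. x \<in> S \<Longrightarrow> cmod (f x) = 1) \<Longrightarrow> cmod (prod f S) = 1"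
  by (simp add: prod_norm[symmetric])

lemma two_cocycle_nil2_cocycle:
  assumes l: "\<And>i j k. 1 \<le> i \<Longrightarrow> i \<le> k \<Longrightarrow> 1 \<le> j \<Longrightarrow> j < k \<Longrightarrow> k \<le> n \<Longrightarrow> cmod (l i j k) = 1"
  shows "two_cocycle (free_nil2 n) (nil2_cocycle n l)"
proof -
  let ?T = "{(i, j, k). 1 \<le> i \<and> i < j \<and> j < k \<and> k \<le> n}"
  let ?D = "{(j, k). 1 \<le> j \<and> j < k \<and> k \<le> n}"
  have nz: "l i j k \<noteq> 0" if "1 \<le> i" "i \<le> k" "1 \<le> j" "j < k" "k \<le> n" for i j k
    using l[OF that] by auto
  have one: "cmod (nil2_cocycle n l r s) = 1" for r s
  proof -
    obtain r1 r2 s1 s2 where e: "r = (r1, r2)" "s = (s1, s2)" by (metis surj_pair)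
    have "cmod (\<Prod>x\<in>?T. f x) = 1" if "\<And>i j k. 1 \<le> i \<Longrightarrow> i < j \<Longrightarrow> j < k \<Longrightarrow> k \<le> n \<Longrightarrow> cmod (f (i, j, k)) = 1" for f
      by (rule cmod_prod_one) (use that in auto)
    moreover have "cmod (\<Prod>x\<in>?D. f x) = 1" if "\<And>j k. 1 \<le> j \<Longrightarrow> j < k \<Longrightarrow> k \<le> n \<Longrightarrow> cmod (f (j, k)) = 1" for f
      by (rule cmod_prod_one) (use that in auto)
    ultimately show ?thesis unfolding e nil2_cocycle_def prod.case norm_mult
      by (simp add: norm_mult norm_power_int l)
  qed
  have coc: "nil2_cocycle n l r s * nil2_cocycle n l (r \<otimes>\<^bsub>free_nil2 n\<^esub> s) t =
     nil2_cocycle n l r (s \<otimes>\<^bsub>free_nil2 n\<^esub> t) * nil2_cocycle n l s t" for r s t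
  proof -
    obtain r1 r2 s1 s2 t1 t2 where e: "r = (r1, r2)" "s = (s1, s2)" "t = (t1, t2)" by (metis surj_pair)
    have mm: "(a * b) * (c * d) = (a * c) * (b * d)" for a b c d :: complex by (simp add: mult_ac)
    have tr: "prod f ?T * prod g ?T = prod f' ?T * prod g' ?T"
      if "\<And>i j k. 1 \<le> i \<Longrightarrow> i < j \<Longrightarrow> j < k \<Longrightarrow> k \<le> n \<Longrightarrow> f (i, j, k) * g (i, j, k) = f' (i, j, k) * g' (i, j, k)"
      for f g f' g' :: "_ \<Rightarrow> complex" using that by (intro prod_pairs) auto
    have db: "prod f ?D * prod g ?D = prod f' ?D * prod g' ?D"
      if "\<And>j k. 1 \<le> j \<Longrightarrow> j < k \<Longrightarrow> k \<le> n \<Longrightarrow> f (j, k) * g (j, k) = f' (j, k) * g' (j, k)"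
      for f g f' g' :: "_ \<Rightarrow> complex" using that by (intro prod_pairs) auto
    show ?thesis
      unfolding e nil2_cocycle_def free_nil2_def prod.case monoid.simps
      apply (subst (1 2) mm)
      apply (rule arg_cong2[of _ _ _ _ "(*)"])
       apply (rule tr, unfold prod.case, subst (1 2) mm, rule arg_cong2[of _ _ _ _ "(*)"];
          rule powi_cocycle, rule nz; simp add: algebra_simps)
      apply (rule db, unfold prod.case, subst (1 2) mm, rule arg_cong2[of _ _ _ _ "(*)"])
       apply (rule powi_cocycle, rule nz)
            apply (simp_all add: exponent_jjk)
      apply (rule powi_cocycle, rule nz)
           apply (simp_all add: exponent_kjk)
      done
  qed
  show ?thesis unfolding two_cocycle_def using one coc
    by (auto simp: nil2_cocycle_def free_nil2_def split: prod.splits intro!: prod.neutral)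
qed

lemma center_free_nil2:
  assumes "n \<ge> 2"
  shows "mult_center (free_nil2 n) = {(a, b). (a, b) \<in> carrier (free_nil2 n) \<and> a = (\<lambda>i. 0)}"
proof -
  have "a i = 0" if z: "(a, b) \<in> mult_center (free_nil2 n)" for a b i
  proof (cases "1 \<le> i \<and> i \<le> n")
    case True
    obtain m where m: "1 \<le> m" "m \<le> n" "m \<noteq> i" using assms True by (cases "i = 1") (use that[of 2] that[of 1] in auto)
    let ?x = "((\<lambda>k. if k = m then 1 else 0, \<lambda>j k. 0)) :: nil2"
    have "?x \<in> carrier (free_nil2 n)" using m by (auto simp: free_nil2_def)
    then have "(a, b) \<otimes>\<^bsub>free_nil2 n\<^esub> ?x = ?x \<otimes>\<^bsub>free_nil2 n\<^esub> (a, b)"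
      using z unfolding mult_center_def by blast
    then have "snd ((a, b) \<otimes>\<^bsub>free_nil2 n\<^esub> ?x) (min i m) (max i m) = snd (?x \<otimes>\<^bsub>free_nil2 n\<^esub> (a, b)) (min i m) (max i m)"
      by simp
    then show ?thesis using True m by (auto simp: free_nil2_def min_def max_def split: if_splits)
  next
    case False
    then show ?thesis using z by (auto simp: mult_center_def free_nil2_def)
  qed
  then have "mult_center (free_nil2 n) \<subseteq> {(a, b). (a, b) \<in> carrier (free_nil2 n) \<and> a = (\<lambda>i. 0)}"
    unfolding mult_center_def by blast
  moreover have "(a, b) \<in> mult_center (free_nil2 n)" if "(a, b) \<in> carrier (free_nil2 n)" "a = (\<lambda>i. 0)" for a b
    using that by (auto simp: mult_center_def free_nil2_def intro!: ext)
  ultimately show ?thesis by blast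
qed

lemma twisted_group_free_nil2:
  assumes "\<And>i j k. 1 \<le> i \<Longrightarrow> i \<le> k \<Longrightarrow> 1 \<le> j \<Longrightarrow> j < k \<Longrightarrow> k \<le> n \<Longrightarrow> cmod (l i j k) = 1"
  shows "twisted_group (free_nil2 n) (nil2_cocycle n l)"
  using assms by (intro twisted_group.intro twisted_group_axioms.intro group_free_nil2 two_cocycle_nil2_cocycle)

end

(* Let Z be the center of G = G(n) and tau the canonical trace f |-> f(e).  Averages are compositions of
   the maps x |-> (x + u x u^{-1})/2 with u = i(s); the key is that, without nontrivial central regular
   elements, suitable averages of every x converge in norm to tau(x) I.

   For i(z) with z in Z - {e}, non-regularity gives a u with u i(z) u^{-1} = chi i(z), chi /= 1, so that
   iterated averaging multiplies i(z) by powers of (1 + chi)/2.  For t outside Z, conjugation moves finite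
   subsets of the coset tZ off themselves, so averaging halves the square of the 2-norm of elements
   supported on tZ.  Once y has small 2-norm, y^* y is supported on Z, its averages tend to tau(y^* y), and
   the Kadison inequality Phi(y)^* Phi(y) <= Phi(y^* y) bounds the norm of Phi(y).

   Central elements are fixed by averaging, hence scalar.  Since G has polynomial growth, the full norm is
   the norm of the regular representation, so tau is faithful; a nonzero closed ideal then contains
   some x^* x with tau(x^* x) /= 0, hence the identity.

   Conversely, if r /= e is central and regular, then u = i(r) is central and not scalar.  As r has
   infinite order, the vectors 1 + u + ... + u^(L-1), divided by sqrt L, are approximately fixed by u, so
   1 has distance at least 1 from (u - 1)C*(G, sigma), whose closure is a proper nonzero ideal. *)

theory Submission
  imports Defs "HOL-Analysis.L2_Norm"
begin

text \<open>All estimates are made on the dense *-algebra \<open>T\<close> of finitely supported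
  functions, with the 2-norm \<open>l2\<close>, and then carried to the completion along Cauchy
  sequences. The obstacle is that \<open>max_norm\<close> is a supremum over all C*-seminorms, so
  computing with vectors bounds it only from below. Polynomial growth removes this:
  \<open>max_norm T f\<close> is at most any \<open>l2\<close>-operator bound of left multiplication
  by \<open>f\<close>. It serves twice, to turn positivity of quadratic forms into a norm estimate
  in the Kadison step, and to make the trace faithful on the completion.

  Different elements need different averages, so convergence of suitable averages is not obviously
  additive. The property proved is therefore stronger: after any preliminary average, a further one
  comes close to the trace.

  Class two enters because commutators are central, so that conjugation preserves each coset tZ.
  Torsion-freeness of Z is used in both directions: it makes conjugation displace finite subsets of
  tZ, and it gives every nontrivial central element infinite order.\<close>

definition l2 :: "('a \<Rightarrow> complex) \<Rightarrow> real" where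
  "l2 f = L2_set (\<lambda>r. cmod (f r)) {r. f r \<noteq> 0}"

text \<open>Lets the norms of several functions be written over one common finite set.\<close>

lemma l2_eq:
  assumes "finite F" "{r. f r \<noteq> 0} \<subseteq> F"
  shows "l2 f = L2_set (\<lambda>r. cmod (f r)) F"
proof -
  have "(\<Sum>r | f r \<noteq> 0. (cmod (f r))\<^sup>2) = (\<Sum>r\<in>F. (cmod (f r))\<^sup>2)"
    by (rule sum.mono_neutral_left) (use assms in auto)
  then show ?thesis by (simp add: l2_def L2_set_def)
qed

lemma l2_nonneg [simp]: "0 \<le> l2 f" by (simp add: l2_def)

lemma l2_delta [simp]: "l2 (delta r) = 1"
  by (subst l2_eq[of "{r}"]) (auto simp: delta_def)

section \<open>The trace inner product and the 2-norm\<close>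

context twisted_group
begin

interpretation T: star_alg T by (rule T_star_alg)
interpretation M: seminormed_star_alg T "max_norm T"
  by (intro seminormed_star_alg.intro seminormed_star_alg_axioms.intro T_star_alg max_norm_cstar)

lemma T_finite: "f \<in> carrier T \<Longrightarrow> finite {r. f r \<noteq> 0}"
  by (simp add: T_carrier)

text \<open>The inner product tau(f^* g), conjugate linear in the first variable. Defining it by the
  trace makes left multiplication by \<open>star T a\<close> the adjoint of left multiplication by
  \<open>a\<close> at once; \<open>ip_sum\<close> recovers the coordinate formula.\<close>

definition ip :: "('g \<Rightarrow> complex) \<Rightarrow> ('g \<Rightarrow> complex) \<Rightarrow> complex" where
  "ip f g = (star T f \<otimes>\<^bsub>T\<^esub> g) \<one>"

lemma ip_add_left: "f \<in> carrier T \<Longrightarrow> f' \<in> carrier T \<Longrightarrow> g \<in> carrier T \<Longrightarrow>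
    ip (f \<oplus>\<^bsub>T\<^esub> f') g = ip f g + ip f' g"
  and ip_add_right: "f \<in> carrier T \<Longrightarrow> g \<in> carrier T \<Longrightarrow> g' \<in> carrier T \<Longrightarrow>
    ip f (g \<oplus>\<^bsub>T\<^esub> g') = ip f g + ip f g'"
  and ip_smult_left: "f \<in> carrier T \<Longrightarrow> g \<in> carrier T \<Longrightarrow> ip (c \<odot>\<^bsub>T\<^esub> f) g = cnj c * ip f g"
  and ip_smult_right: "f \<in> carrier T \<Longrightarrow> g \<in> carrier T \<Longrightarrow> ip f (c \<odot>\<^bsub>T\<^esub> g) = c * ip f g"
  by (simp_all add: ip_def T_star_add T_star_smult T_bilin, simp_all add: T_ops)

lemma ip_mult: "a \<in> carrier T \<Longrightarrow> f \<in> carrier T \<Longrightarrow> g \<in> carrier T \<Longrightarrow> ip f (a \<otimes>\<^bsub>T\<^esub> g) = ip (star T a \<otimes>\<^bsub>T\<^esub> f) g"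
  by (simp add: ip_def T_star_mult T_star_star T_assoc T_closed)

lemma ip_delta_delta: "r \<in> carrier G \<Longrightarrow> s \<in> carrier G \<Longrightarrow> ip (delta r) (delta s) = (if r = s then 1 else 0)"
  using sigma_cnj[of r "inv r"] inv_comm[of "inv r" s] inv_equality[of s "inv r"]
  by (auto simp: ip_def T_star_delta T_bilin T_delta_mult sigma_inv)
    (auto simp: T_ops delta_def mult.commute)

lemma ip_zero: "ip f \<zero>\<^bsub>T\<^esub> = 0" "ip \<zero>\<^bsub>T\<^esub> g = 0"
  by (simp_all add: ip_def T_bilin T_star_zero) (simp_all add: T_ops)

lemma ip_delta: "f \<in> carrier T \<Longrightarrow> s \<in> carrier G \<Longrightarrow> ip (delta s) f = f s"
  by (induction f rule: T_induct)
    (auto simp: ip_add_right ip_smult_right ip_delta_delta T_closed ip_zero, auto simp: T_ops delta_def)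

text \<open>Both sides are conjugate linear in \<open>f\<close>, so it is enough to take
  \<open>f = delta r\<close>, where \<open>ip_delta\<close> reads off the coefficient
  \<open>g r\<close>.\<close>

lemma ip_sum:
  assumes f: "f \<in> carrier T" and g: "g \<in> carrier T" and F: "finite F" "{r. f r \<noteq> 0} \<subseteq> F"
  shows "ip f g = (\<Sum>r\<in>F. cnj (f r) * g r)"
proof -
  have "ip f g = (\<Sum>r | f r \<noteq> 0. cnj (f r) * g r)" using f
  proof (induction f rule: T_induct)
    case (add f f')
    let ?F = "{r. f r \<noteq> 0} \<union> {r. f' r \<noteq> 0}"
    have fin: "finite ?F" using add T_finite by auto
    have "(\<Sum>r | h r \<noteq> 0. cnj (h r) * g r) = (\<Sum>r\<in>?F. cnj (h r) * g r)" if "{r. h r \<noteq> 0} \<subseteq> ?F" for h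
      by (rule sum.mono_neutral_left) (use that fin in auto)
    moreover have "{r. (f \<oplus>\<^bsub>T\<^esub> f') r \<noteq> 0} \<subseteq> ?F" by (auto simp: T_ops)
    ultimately show ?case using add g
      by (simp add: ip_add_left) (simp add: T_ops sum.distrib[symmetric] algebra_simps)
  next
    case (delta c r)
    have "(\<Sum>t | (c \<odot>\<^bsub>T\<^esub> delta r) t \<noteq> 0. cnj ((c \<odot>\<^bsub>T\<^esub> delta r) t) * g t) = (\<Sum>t\<in>{r}. cnj ((c \<odot>\<^bsub>T\<^esub> delta r) t) * g t)"
      by (rule sum.mono_neutral_left) (auto simp: T_ops delta_def split: if_splits)
    then show ?case using delta g by (simp add: ip_smult_left ip_delta T_closed) (simp add: T_ops delta_def)
  qed (simp add: ip_zero, simp add: T_ops)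
  also have "\<dots> = (\<Sum>r\<in>F. cnj (f r) * g r)" by (rule sum.mono_neutral_left) (use F in auto)
  finally show ?thesis .
qed

lemma ip_self: "f \<in> carrier T \<Longrightarrow> ip f f = of_real ((l2 f)\<^sup>2)"
  using ip_sum[of f f, OF _ _ _ subset_refl]
  by (simp add: T_finite l2_def L2_set_def sum_nonneg mult.commute flip: complex_norm_square)

lemma ip_cauchy_schwarz:
  assumes f: "f \<in> carrier T" and g: "g \<in> carrier T"
  shows "cmod (ip f g) \<le> l2 f * l2 g"
proof -
  let ?F = "{r. f r \<noteq> 0} \<union> {r. g r \<noteq> 0}"
  have fin: "finite ?F" using f g T_finite by auto
  have "cmod (ip f g) \<le> (\<Sum>r\<in>?F. cmod (cnj (f r) * g r))"
    using f g fin by (subst ip_sum[of _ _ ?F]) (auto intro: norm_sum)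
  also have "\<dots> = (\<Sum>r\<in>?F. \<bar>cmod (f r)\<bar> * \<bar>cmod (g r)\<bar>)" by (simp add: norm_mult)
  also have "\<dots> \<le> L2_set (\<lambda>r. cmod (f r)) ?F * L2_set (\<lambda>r. cmod (g r)) ?F" by (rule L2_set_mult_ineq)
  also have "\<dots> = l2 f * l2 g" by (subst (1 2) l2_eq[OF fin]) auto
  finally show ?thesis .
qed

lemma l2_add:
  assumes f: "f \<in> carrier T" and g: "g \<in> carrier T"
  shows "l2 (f \<oplus>\<^bsub>T\<^esub> g) \<le> l2 f + l2 g"
proof -
  let ?F = "{r. f r \<noteq> 0} \<union> {r. g r \<noteq> 0}"
  have fin: "finite ?F" using f g T_finite by auto
  have "{r. (f \<oplus>\<^bsub>T\<^esub> g) r \<noteq> 0} \<subseteq> ?F" by (auto simp: T_ops)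
  then have "l2 (f \<oplus>\<^bsub>T\<^esub> g) = L2_set (\<lambda>r. cmod (f r + g r)) ?F" using l2_eq[OF fin] by (simp add: T_ops)
  also have "\<dots> \<le> L2_set (\<lambda>r. cmod (f r) + cmod (g r)) ?F"
    by (intro L2_set_mono) (auto intro: norm_triangle_ineq)
  also have "\<dots> \<le> L2_set (\<lambda>r. cmod (f r)) ?F + L2_set (\<lambda>r. cmod (g r)) ?F" by (rule L2_set_triangle_ineq)
  also have "\<dots> = l2 f + l2 g" by (subst (1 2) l2_eq[OF fin]) auto
  finally show ?thesis .
qed

lemma l2_of_ip: "f \<in> carrier T \<Longrightarrow> l2 f = sqrt (Re (ip f f))"
  by (simp add: ip_self real_sqrt_unique flip: of_real_power)

lemma l2_smult: "f \<in> carrier T \<Longrightarrow> l2 (c \<odot>\<^bsub>T\<^esub> f) = cmod c * l2 f"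
proof -
  assume f: "f \<in> carrier T"
  have "ip (c \<odot>\<^bsub>T\<^esub> f) (c \<odot>\<^bsub>T\<^esub> f) = of_real ((cmod c * l2 f)\<^sup>2)"
    using f complex_norm_square[of c] ip_self[OF f]
    by (simp add: ip_smult_left ip_smult_right T_closed power_mult_distrib mult_ac)
  then have "(l2 (c \<odot>\<^bsub>T\<^esub> f))\<^sup>2 = (cmod c * l2 f)\<^sup>2"
    using f by (metis T_smult_closed ip_self of_real_eq_iff)
  then show ?thesis by (simp add: power2_eq_iff_nonneg)
qed

lemma l2_zero [simp]: "l2 \<zero>\<^bsub>T\<^esub> = 0" by (simp add: l2_def T_ops)

lemma l2_eq_zero: "f \<in> carrier T \<Longrightarrow> l2 f = 0 \<Longrightarrow> f = \<zero>\<^bsub>T\<^esub>"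
  by (auto simp: l2_def L2_set_eq_0_iff T_finite T_ops)

lemma delta_unitary: "r \<in> carrier G \<Longrightarrow> star T (delta r) \<otimes>\<^bsub>T\<^esub> delta r = \<one>\<^bsub>T\<^esub>"
  "r \<in> carrier G \<Longrightarrow> delta r \<otimes>\<^bsub>T\<^esub> star T (delta r) = \<one>\<^bsub>T\<^esub>"
  by (simp_all add: T_star_delta T_bilin T_delta_mult sigma_inv sigma_cnj T_smult_one T_ops(4))

lemma l2_mult_isometry:
  assumes "u \<in> carrier T" "star T u \<otimes>\<^bsub>T\<^esub> u = \<one>\<^bsub>T\<^esub>" "f \<in> carrier T"
  shows "l2 (u \<otimes>\<^bsub>T\<^esub> f) = l2 f"
  using assms by (simp add: l2_of_ip ip_mult T_closed flip: T_assoc)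

lemma l2_delta_mult: "r \<in> carrier G \<Longrightarrow> f \<in> carrier T \<Longrightarrow> l2 (delta r \<otimes>\<^bsub>T\<^esub> f) = l2 f"
  by (simp add: l2_mult_isometry delta_unitary)

text \<open>On unitaries \<open>delta r\<close>, \<open>delta s\<close> both sides vanish unless
  \<open>s = inv r\<close>, and there the claim is the symmetry \<open>sigma_inv\<close> of the
  cocycle.\<close>

lemma trace_commute:
  assumes "f \<in> carrier T" "g \<in> carrier T" shows "(f \<otimes>\<^bsub>T\<^esub> g) \<one> = (g \<otimes>\<^bsub>T\<^esub> f) \<one>"
  using assms
proof (induction f arbitrary: g rule: T_induct)
  case (delta c r)
  from delta(2,1) show ?case
  proof (induction g rule: T_induct)
    case (delta d s)
    have "r \<otimes> s = \<one> \<longleftrightarrow> s = inv r" "s \<otimes> r = \<one> \<longleftrightarrow> s = inv r"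
      using delta inv_equality[of s r] inv_unique'[of r s] r_inv[of r] l_inv[of r] inv_comm[of r s] by auto
    then show ?case using delta sigma_inv[of r] by (auto simp: T_bilin T_delta_mult) (auto simp: T_ops delta_def)
  qed (simp_all add: T_bilin, auto simp: T_ops distrib_left)
qed (simp_all add: T_bilin, simp_all add: T_ops)

text \<open>The trace property in norm form; it transfers bounds for left multiplication to right
  multiplication.\<close>

lemma l2_star: "f \<in> carrier T \<Longrightarrow> l2 (star T f) = l2 f"
  using trace_commute[of f "star T f"] by (simp add: l2_of_ip T_closed ip_def T_star_star)

section \<open>The reduced norm\<close>

lemma l2_mult_bounded_left: "f \<in> carrier T \<Longrightarrow> \<exists>B\<ge>0. \<forall>g\<in>carrier T. l2 (f \<otimes>\<^bsub>T\<^esub> g) \<le> B * l2 g"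
proof (induction f rule: T_induct)
  case (add f f')
  then obtain B B' where B: "B \<ge> 0" "B' \<ge> 0" "\<And>g. g \<in> carrier T \<Longrightarrow> l2 (f \<otimes>\<^bsub>T\<^esub> g) \<le> B * l2 g"
     "\<And>g. g \<in> carrier T \<Longrightarrow> l2 (f' \<otimes>\<^bsub>T\<^esub> g) \<le> B' * l2 g" by blast
  have "l2 ((f \<oplus>\<^bsub>T\<^esub> f') \<otimes>\<^bsub>T\<^esub> g) \<le> (B + B') * l2 g" if g: "g \<in> carrier T" for g
    using B(3,4)[OF g] l2_add[of "f \<otimes>\<^bsub>T\<^esub> g" "f' \<otimes>\<^bsub>T\<^esub> g"] add g by (simp add: T_bilin algebra_simps)
  then show ?case using B by (intro exI[of _ "B + B'"]) auto
next
  case (delta c r)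
  then show ?case by (intro exI[of _ "cmod c"]) (simp add: T_bilin l2_smult l2_delta_mult)
qed (auto simp: T_bilin)

text \<open>Follows from the left version by \<open>star\<close>. It shows that
  \<open>l2 (X k)\<close> tending to 0 forces \<open>l2\<close> of \<open>X k\<close> times a fixed
  \<open>g\<close> to tend to 0.\<close>

lemma l2_mult_bounded_right: "g \<in> carrier T \<Longrightarrow> \<exists>B\<ge>0. \<forall>f\<in>carrier T. l2 (f \<otimes>\<^bsub>T\<^esub> g) \<le> B * l2 f"
proof -
  assume g: "g \<in> carrier T"
  from l2_mult_bounded_left[of "star T g"] g obtain B where B: "B \<ge> 0"
    "\<And>f. f \<in> carrier T \<Longrightarrow> l2 (star T g \<otimes>\<^bsub>T\<^esub> f) \<le> B * l2 f" by (auto simp: T_closed)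
  have "l2 (f \<otimes>\<^bsub>T\<^esub> g) \<le> B * l2 f" if f: "f \<in> carrier T" for f
    using B(2)[of "star T f"] l2_star[of "f \<otimes>\<^bsub>T\<^esub> g"] f g by (simp add: T_closed T_star_mult l2_star)
  then show ?thesis using B by blast
qed

text \<open>The operator norm of \<open>f\<close> in the regular representation, tested on the dense
  subspace of finitely supported vectors.\<close>

definition red_norm :: "('g \<Rightarrow> complex) \<Rightarrow> real" where
  "red_norm f = Inf {B. B \<ge> 0 \<and> (\<forall>g\<in>carrier T. l2 (f \<otimes>\<^bsub>T\<^esub> g) \<le> B * l2 g)}"

lemma red_norm_nonneg: "f \<in> carrier T \<Longrightarrow> 0 \<le> red_norm f"
  unfolding red_norm_def using l2_mult_bounded_left[of f] by (intro cInf_greatest) auto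

lemma red_norm_le: "B \<ge> 0 \<Longrightarrow> (\<And>g. g \<in> carrier T \<Longrightarrow> l2 (f \<otimes>\<^bsub>T\<^esub> g) \<le> B * l2 g) \<Longrightarrow> red_norm f \<le> B"
  unfolding red_norm_def by (rule cInf_lower) (auto intro: bdd_belowI[of _ 0])

lemma l2_mult_red_norm:
  assumes f: "f \<in> carrier T" and g: "g \<in> carrier T"
  shows "l2 (f \<otimes>\<^bsub>T\<^esub> g) \<le> red_norm f * l2 g"
proof (cases "l2 g = 0")
  case True
  then show ?thesis using l2_eq_zero[OF g] by (simp add: T_bilin)
next
  case False
  then have p: "l2 g > 0" using l2_nonneg[of g] by linarith
  have "l2 (f \<otimes>\<^bsub>T\<^esub> g) / l2 g \<le> red_norm f"
    unfolding red_norm_def using l2_mult_bounded_left[OF f] p g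
    by (intro cInf_greatest) (auto simp: field_simps)
  then show ?thesis using p by (simp add: field_simps)
qed

text \<open>An operator and its adjoint have the same bound: with \<open>h = f^* g\<close>,
  Cauchy-Schwarz gives \<open>|h|^2 = <g, f h> \<le> |g| B |h|\<close>, and \<open>|h|\<close>
  cancels.\<close>

lemma l2_star_mult_le:
  assumes f: "f \<in> carrier T" and B: "B \<ge> 0" "\<And>g. g \<in> carrier T \<Longrightarrow> l2 (f \<otimes>\<^bsub>T\<^esub> g) \<le> B * l2 g" and g: "g \<in> carrier T"
  shows "l2 (star T f \<otimes>\<^bsub>T\<^esub> g) \<le> B * l2 g"
proof (cases "l2 (star T f \<otimes>\<^bsub>T\<^esub> g) = 0")
  case False
  let ?h = "star T f \<otimes>\<^bsub>T\<^esub> g"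
  have c: "?h \<in> carrier T" using f g by (simp add: T_closed)
  have "ip ?h ?h = ip g (f \<otimes>\<^bsub>T\<^esub> ?h)" using f g c by (simp add: ip_mult)
  then have "(l2 ?h)\<^sup>2 = cmod (ip g (f \<otimes>\<^bsub>T\<^esub> ?h))"
    using ip_self[OF c] by (metis norm_of_real abs_power2)
  also have "\<dots> \<le> l2 g * l2 (f \<otimes>\<^bsub>T\<^esub> ?h)" using f g c by (simp add: ip_cauchy_schwarz T_closed)
  also have "\<dots> \<le> l2 g * (B * l2 ?h)" using B(2)[OF c] by (intro mult_left_mono) auto
  finally have "l2 ?h * l2 ?h \<le> (B * l2 g) * l2 ?h" by (simp add: power2_eq_square mult_ac)
  moreover have "l2 ?h > 0" using False l2_nonneg[of ?h] by linarith
  ultimately show ?thesis by simp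
qed (use B in simp)

text \<open>Puts \<open>red_norm\<close> among the seminorms over which \<open>max_norm\<close> is
  the supremum, so that \<open>max_norm\<close> bounds multiplication on \<open>l2\<close>. The
  C*-identity rests on \<open>|f g|^2 = <g, f^* f g>\<close>.\<close>

lemma red_norm_cstar: "cstar_seminorm T red_norm"
  unfolding cstar_seminorm_def
proof (intro conjI ballI allI)
  fix f assume f: "f \<in> carrier T"
  show "0 \<le> red_norm f" by (rule red_norm_nonneg[OF f])
  have sc: "red_norm (c \<odot>\<^bsub>T\<^esub> h) \<le> cmod c * red_norm h" if "h \<in> carrier T" for c h
    using that by (intro red_norm_le) (auto simp: T_bilin l2_smult l2_mult_red_norm red_norm_nonneg mult.assoc mult_left_mono)
  show "red_norm (c \<odot>\<^bsub>T\<^esub> f) = cmod c * red_norm f" for c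
  proof (cases "c = 0")
    case True
    then show ?thesis using sc[OF f, of 0] red_norm_nonneg[of "0 \<odot>\<^bsub>T\<^esub> f"] f by (simp add: T_closed)
  next
    case False
    have "red_norm f = red_norm (inverse c \<odot>\<^bsub>T\<^esub> (c \<odot>\<^bsub>T\<^esub> f))" using False by (simp add: T_smult_smult T_smult_one)
    also have "\<dots> \<le> cmod (inverse c) * red_norm (c \<odot>\<^bsub>T\<^esub> f)" using f by (intro sc T_closed)
    finally have "cmod c * red_norm f \<le> red_norm (c \<odot>\<^bsub>T\<^esub> f)" using False unfolding norm_inverse by (simp add: field_simps)
    then show ?thesis using sc[OF f, of c] by simp
  qed
  have mu: "red_norm (h \<otimes>\<^bsub>T\<^esub> k) \<le> red_norm h * red_norm k" if h: "h \<in> carrier T" and k: "k \<in> carrier T" for h k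
  proof (rule red_norm_le)
    fix g assume g: "g \<in> carrier T"
    have "l2 (h \<otimes>\<^bsub>T\<^esub> (k \<otimes>\<^bsub>T\<^esub> g)) \<le> red_norm h * l2 (k \<otimes>\<^bsub>T\<^esub> g)" using h k g by (simp add: l2_mult_red_norm T_closed)
    also have "\<dots> \<le> red_norm h * (red_norm k * l2 g)"
      using h k g by (intro mult_left_mono l2_mult_red_norm red_norm_nonneg)
    finally show "l2 (h \<otimes>\<^bsub>T\<^esub> k \<otimes>\<^bsub>T\<^esub> g) \<le> red_norm h * red_norm k * l2 g" using h k g by (simp add: T_assoc mult.assoc)
  qed (use h k in \<open>simp add: red_norm_nonneg\<close>)
  show "red_norm (star T f \<otimes>\<^bsub>T\<^esub> f) = (red_norm f)\<^sup>2"
  proof (rule antisym)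
    have "red_norm (star T f) \<le> red_norm f"
      using f by (intro red_norm_le l2_star_mult_le l2_mult_red_norm red_norm_nonneg)
    then have "red_norm (star T f) * red_norm f \<le> red_norm f * red_norm f"
      using f by (intro mult_right_mono red_norm_nonneg)
    then show "red_norm (star T f \<otimes>\<^bsub>T\<^esub> f) \<le> (red_norm f)\<^sup>2"
      using mu[of "star T f" f] f by (simp add: T_closed power2_eq_square)
    have "red_norm f \<le> sqrt (red_norm (star T f \<otimes>\<^bsub>T\<^esub> f))"
    proof (rule red_norm_le)
      fix g assume g: "g \<in> carrier T"
      have "ip (f \<otimes>\<^bsub>T\<^esub> g) (f \<otimes>\<^bsub>T\<^esub> g) = ip g ((star T f \<otimes>\<^bsub>T\<^esub> f) \<otimes>\<^bsub>T\<^esub> g)"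
        using f g by (simp add: ip_mult T_closed T_assoc T_star_mult T_star_star)
      then have "(l2 (f \<otimes>\<^bsub>T\<^esub> g))\<^sup>2 = cmod (ip g ((star T f \<otimes>\<^bsub>T\<^esub> f) \<otimes>\<^bsub>T\<^esub> g))"
        using ip_self[OF T_mult_closed[OF f g]] by (metis norm_of_real abs_power2)
      also have "\<dots> \<le> l2 g * l2 ((star T f \<otimes>\<^bsub>T\<^esub> f) \<otimes>\<^bsub>T\<^esub> g)" using f g by (simp add: ip_cauchy_schwarz T_closed)
      also have "\<dots> \<le> l2 g * (red_norm (star T f \<otimes>\<^bsub>T\<^esub> f) * l2 g)"
        using f g by (intro mult_left_mono l2_mult_red_norm) (auto simp: T_closed)
      finally have "l2 (f \<otimes>\<^bsub>T\<^esub> g) \<le> sqrt (red_norm (star T f \<otimes>\<^bsub>T\<^esub> f) * (l2 g)\<^sup>2)"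
        by (intro real_le_rsqrt) (simp add: power2_eq_square mult_ac)
      then show "l2 (f \<otimes>\<^bsub>T\<^esub> g) \<le> sqrt (red_norm (star T f \<otimes>\<^bsub>T\<^esub> f)) * l2 g" by (simp add: real_sqrt_mult)
    qed (use f in \<open>simp add: red_norm_nonneg T_closed\<close>)
    then have "(red_norm f)\<^sup>2 \<le> (sqrt (red_norm (star T f \<otimes>\<^bsub>T\<^esub> f)))\<^sup>2" using red_norm_nonneg[OF f] by (rule power_mono)
    then show "(red_norm f)\<^sup>2 \<le> red_norm (star T f \<otimes>\<^bsub>T\<^esub> f)" using f by (simp add: red_norm_nonneg T_closed)
  qed
  fix g assume g: "g \<in> carrier T"
  show "red_norm (f \<otimes>\<^bsub>T\<^esub> g) \<le> red_norm f * red_norm g" by (rule mu[OF f g])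
  show "red_norm (f \<oplus>\<^bsub>T\<^esub> g) \<le> red_norm f + red_norm g"
  proof (rule red_norm_le)
    fix h assume h: "h \<in> carrier T"
    have "l2 ((f \<oplus>\<^bsub>T\<^esub> g) \<otimes>\<^bsub>T\<^esub> h) \<le> l2 (f \<otimes>\<^bsub>T\<^esub> h) + l2 (g \<otimes>\<^bsub>T\<^esub> h)"
      using f g h by (simp add: T_bilin l2_add)
    then show "l2 ((f \<oplus>\<^bsub>T\<^esub> g) \<otimes>\<^bsub>T\<^esub> h) \<le> (red_norm f + red_norm g) * l2 h"
      using l2_mult_red_norm[OF f h] l2_mult_red_norm[OF g h] by (simp add: distrib_right)
  qed (use f g in \<open>simp add: red_norm_nonneg\<close>)
qed

lemma l2_mult_max_norm:
  assumes "f \<in> carrier T" "g \<in> carrier T"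
  shows "l2 (f \<otimes>\<^bsub>T\<^esub> g) \<le> max_norm T f * l2 g"
  using l2_mult_red_norm[OF assms] max_norm_upper[OF red_norm_cstar assms(1)] mult_right_mono[OF _ l2_nonneg[of g]]
  by (meson order_trans)

lemma l2_le_max_norm: "f \<in> carrier T \<Longrightarrow> l2 f \<le> max_norm T f"
  using l2_mult_max_norm[of f "delta \<one>"] T_one(2)[of f] by (simp add: T_ops(4))

end

section \<open>Polynomial growth\<close>

text \<open>Exponential growth beats polynomial growth already along the exponents
  \<open>2 ^ k\<close>, the only ones that repeated squaring provides.\<close>

lemma power_le_poly_imp_le_one:
  fixes q K :: real
  assumes le: "\<And>k. q ^ 2 ^ k \<le> K * real (2 ^ k) ^ d"
  shows "q \<le> 1"
proof (rule ccontr)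
  assume "\<not> q \<le> 1"
  then have q: "q > 1" by simp
  \<comment> \<open>With \<open>x ^ (d + 1) = q\<close>, the quotient of
    \<open>(2 ^ k) ^ (d + 1)\<close> by \<open>q ^ 2 ^ k\<close> is a power of
    \<open>2 ^ k / x ^ 2 ^ k\<close>, which tends to 0. The order \<open>Suc d\<close> is positive
    also for \<open>d = 0\<close>.\<close>
  define x where "x = root (Suc d) q"
  have x: "x > 1" "x ^ Suc d = q" using q real_root_pow_pos2[of "Suc d" q] by (simp_all add: x_def del: power_Suc)
  have "(\<lambda>n. real n / x ^ n) \<longlonglongrightarrow> 0" using lim_n_over_pown[of x] x by simp
  then have "(\<lambda>n. K * (real n / x ^ n) ^ Suc d) \<longlonglongrightarrow> K * 0 ^ Suc d" by (intro tendsto_intros)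
  then have "(\<lambda>n. K * (real n / x ^ n) ^ Suc d) \<longlonglongrightarrow> 0" by simp
  moreover have "strict_mono (\<lambda>k. 2 ^ k :: nat)" by (simp add: strict_mono_def)
  ultimately have "((\<lambda>n. K * (real n / x ^ n) ^ Suc d) \<circ> (\<lambda>k. 2 ^ k)) \<longlonglongrightarrow> 0"
    by (rule LIMSEQ_subseq_LIMSEQ)
  then have "\<forall>\<^sub>F k in sequentially. K * (real (2 ^ k) / x ^ 2 ^ k) ^ Suc d < 1"
    by (intro order_tendstoD(2)[of _ 0]) (auto simp: o_def)
  then obtain k where k: "K * (real (2 ^ k) / x ^ 2 ^ k) ^ Suc d < 1"
    by (auto simp: eventually_sequentially)
  have "(x ^ 2 ^ k) ^ Suc d = q ^ 2 ^ k" using x(2) by (metis power_mult mult.commute)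
  then have "K * real (2 ^ k) ^ Suc d < q ^ 2 ^ k" using k q by (simp only: power_divide) (simp add: field_simps)
  moreover have "K \<ge> 0" using le[of 0] q by simp
  then have "K * real (2 ^ k) ^ d \<le> K * real (2 ^ k) ^ Suc d" by (intro mult_left_mono power_increasing) auto
  ultimately show False using le[of k] by linarith
qed

context twisted_group
begin

interpretation T: star_alg T by (rule T_star_alg)
interpretation M: seminormed_star_alg T "max_norm T"
  by (intro seminormed_star_alg.intro seminormed_star_alg_axioms.intro T_star_alg max_norm_cstar)

lemma max_norm_le_l1:
  assumes F: "finite F" "F \<subseteq> carrier G"
  shows "{r. f r \<noteq> 0} \<subseteq> F \<Longrightarrow> max_norm T f \<le> (\<Sum>r\<in>F. cmod (f r))"
  using F
proof (induction F arbitrary: f rule: finite_induct)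
  case empty
  then have "f = \<zero>\<^bsub>T\<^esub>" by (auto simp: T_ops)
  then show ?case by simp
next
  case (insert r F)
  have e: "f = (f(r := 0)) \<oplus>\<^bsub>T\<^esub> (f r \<odot>\<^bsub>T\<^esub> delta r)" by (auto simp: T_ops delta_def)
  have s: "{t. (f(r := 0)) t \<noteq> 0} \<subseteq> F" using insert by auto
  have c: "f(r := 0) \<in> carrier T" using s insert finite_subset[OF s] unfolding T_carrier by blast
  have "max_norm T f \<le> max_norm T (f(r := 0)) + max_norm T (f r \<odot>\<^bsub>T\<^esub> delta r)"
    by (subst e, rule M.p_add) (use c insert in \<open>auto simp: T_closed\<close>)
  also have "max_norm T (f r \<odot>\<^bsub>T\<^esub> delta r) \<le> cmod (f r)"
    using insert delta_norm_le_1[OF max_norm_cstar, of r] by (simp add: M.p_smult mult_left_le)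
  also have "max_norm T (f(r := 0)) \<le> (\<Sum>t\<in>F. cmod ((f(r := 0)) t))" by (rule insert(3)) (use insert s in auto)
  also have "\<dots> = (\<Sum>t\<in>F. cmod (f t))" using insert by (intro sum.cong) auto
  finally show ?case using insert by simp
qed

text \<open>Cauchy-Schwarz applied to the l1 bound. This is the only upper bound for the full norm
  obtained from coefficients; the loss is the size of the support.\<close>

lemma max_norm_le_card:
  assumes F: "finite F" "F \<subseteq> carrier G" "{r. f r \<noteq> 0} \<subseteq> F"
  shows "(max_norm T f)\<^sup>2 \<le> real (card F) * (l2 f)\<^sup>2"
proof -
  have fT: "f \<in> carrier T" using F finite_subset[OF F(3)] by (auto simp: T_carrier)
  have "max_norm T f \<le> (\<Sum>r\<in>F. \<bar>1\<bar> * \<bar>cmod (f r)\<bar>)" using max_norm_le_l1[OF F] by simp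
  also have "\<dots> \<le> L2_set (\<lambda>r. 1) F * L2_set (\<lambda>r. cmod (f r)) F" by (rule L2_set_mult_ineq)
  also have "\<dots> = sqrt (real (card F)) * l2 f" using l2_eq[OF F(1,3)] by (simp add: L2_set_def)
  finally have "(max_norm T f)\<^sup>2 \<le> (sqrt (real (card F)) * l2 f)\<^sup>2"
    using M.p_nonneg[OF fT] by (intro power_mono)
  then show ?thesis by (simp add: power_mult_distrib)
qed

end

text \<open>A filtration of the group takes the place of the balls of a word metric: products add
  radii. The bound uses \<open>m + 1\<close> so that \<open>ball 0\<close> may be nonempty.\<close>

locale poly_growth_twisted_group = twisted_group +
  fixes ball :: "nat \<Rightarrow> 'a set" and K :: real and d :: nat
  assumes ball_subset: "ball m \<subseteq> carrier G"
    and ball_finite: "finite (ball m)"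
    and ball_mult: "r \<in> ball i \<Longrightarrow> s \<in> ball j \<Longrightarrow> r \<otimes> s \<in> ball (i + j)"
    and ball_exhaust: "finite F \<Longrightarrow> F \<subseteq> carrier G \<Longrightarrow> \<exists>m. F \<subseteq> ball m"
    and card_ball: "real (card (ball m)) \<le> K * real (m + 1) ^ d"
begin

interpretation T: star_alg T by (rule T_star_alg)
interpretation M: seminormed_star_alg T "max_norm T"
  by (intro seminormed_star_alg.intro seminormed_star_alg_axioms.intro T_star_alg max_norm_cstar)

lemma K_nonneg: "K \<ge> 0"
  using card_ball[of 0] by simp

text \<open>By the C*-identity \<open>\<parallel>h\<parallel> ^ 2 ^ k = \<parallel>h ^ 2 ^ k\<parallel>\<close>, which is at most the \<open>l2\<close> norm of \<open>h ^ 2 ^ k\<close> times the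
  square root of the size of its support; the latter grows polynomially in \<open>2 ^ k\<close>.  Hence the
  maximal norm is already attained in the regular representation.\<close>

lemma power_max_norm_le:
  assumes "h \<in> carrier T" "star T h = h" "{r. h r \<noteq> 0} \<subseteq> ball R"
    "\<And>g. g \<in> carrier T \<Longrightarrow> l2 (h \<otimes>\<^bsub>T\<^esub> g) \<le> B * l2 g"
  shows "((max_norm T h)\<^sup>2) ^ 2 ^ k \<le> K * real (R * 2 ^ k + 1) ^ d * (B\<^sup>2) ^ 2 ^ k"
  using assms
proof (induction k arbitrary: h R B)
  case 0
  have "(max_norm T h)\<^sup>2 \<le> real (card (ball R)) * (l2 h)\<^sup>2"
    using 0 by (intro max_norm_le_card ball_finite ball_subset)
  also have "l2 h \<le> B" using 0(4)[of "delta \<one>"] T_one(2)[OF 0(1)] by (simp add: T_ops(4))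
  then have "real (card (ball R)) * (l2 h)\<^sup>2 \<le> (K * real (R + 1) ^ d) * B\<^sup>2"
    using K_nonneg by (intro mult_mono card_ball power_mono) auto
  finally show ?case by simp
next
  case (Suc k)
  let ?h = "h \<otimes>\<^bsub>T\<^esub> h"
  have B: "B \<ge> 0" using Suc(5)[of "delta \<one>"] l2_nonneg[of "h \<otimes>\<^bsub>T\<^esub> delta \<one>"] by (simp del: l2_nonneg)
  \<comment> \<open>Squaring \<open>h\<close> doubles the radius of the support and squares the
    operator bound, while the C*-identity for the self-adjoint \<open>h\<close> squares the norm; so
    the induction hypothesis applies with \<open>R + R\<close> and \<open>B * B\<close>.\<close>
  have "((max_norm T ?h)\<^sup>2) ^ 2 ^ k \<le> K * real ((R + R) * 2 ^ k + 1) ^ d * ((B * B)\<^sup>2) ^ 2 ^ k"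
  proof (rule Suc(1))
    show "{r. ?h r \<noteq> 0} \<subseteq> ball (R + R)"
    proof safe
      fix t assume t: "?h t \<noteq> 0"
      have f: "finite {r. h r \<noteq> 0}" using Suc(2) by (rule T_finite)
      have "\<exists>r s. h r \<noteq> 0 \<and> h s \<noteq> 0 \<and> r \<otimes> s = t"
      proof (rule ccontr)
        assume "\<not> (\<exists>r s. h r \<noteq> 0 \<and> h s \<noteq> 0 \<and> r \<otimes> s = t)"
        then have "?h t = 0" unfolding T_mult[OF f subset_refl f subset_refl] by (intro sum.neutral ballI) auto
        then show False using t by simp
      qed
      then show "t \<in> ball (R + R)" using Suc(4) ball_mult by blast
    qed
    show "l2 (?h \<otimes>\<^bsub>T\<^esub> g) \<le> B * B * l2 g" if g: "g \<in> carrier T" for g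
    proof -
      have "l2 (h \<otimes>\<^bsub>T\<^esub> (h \<otimes>\<^bsub>T\<^esub> g)) \<le> B * l2 (h \<otimes>\<^bsub>T\<^esub> g)" using Suc g by (simp add: T_closed)
      also have "\<dots> \<le> B * (B * l2 g)" using Suc g B by (intro mult_left_mono) auto
      finally show ?thesis using Suc g by (simp add: T_assoc mult.assoc)
    qed
  qed (use Suc in \<open>simp_all add: T_closed T_star_mult\<close>)
  moreover have "max_norm T ?h = (max_norm T h)\<^sup>2" using M.p_star_mult[of h] Suc by simp
  ultimately show ?case by (simp add: power_mult[symmetric] power2_eq_square[symmetric] mult_ac)
qed

text \<open>For the self-adjoint \<open>h = f^* f\<close>, the ratio of the full norm to the
  operator bound has \<open>2 ^ k\<close>-th powers of polynomial growth, hence is at most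
  1.\<close>

lemma max_norm_le_regular:
  assumes f: "f \<in> carrier T" and B: "\<And>g. g \<in> carrier T \<Longrightarrow> l2 (f \<otimes>\<^bsub>T\<^esub> g) \<le> B * l2 g"
  shows "max_norm T f \<le> B"
proof -
  have B0: "B \<ge> 0" using B[of "delta \<one>"] l2_nonneg[of "f \<otimes>\<^bsub>T\<^esub> delta \<one>"] by (simp del: l2_nonneg)
  let ?h = "star T f \<otimes>\<^bsub>T\<^esub> f"
  have h: "?h \<in> carrier T" using f by (simp add: T_closed)
  obtain R where R: "{r. ?h r \<noteq> 0} \<subseteq> ball R" using ball_exhaust[of "{r. ?h r \<noteq> 0}"] h by (auto simp: T_carrier)
  \<comment> \<open>A strict upper bound \<open>D\<close> is positive even when
    \<open>B = 0\<close>, so it can be divided by.\<close>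
  have "max_norm T f \<le> D" if D: "D > B" for D
  proof -
    have D0: "D > 0" using D B0 by simp
    have hB: "l2 (?h \<otimes>\<^bsub>T\<^esub> g) \<le> (D * D) * l2 g" if g: "g \<in> carrier T" for g
    proof -
      have "l2 (star T f \<otimes>\<^bsub>T\<^esub> (f \<otimes>\<^bsub>T\<^esub> g)) \<le> B * l2 (f \<otimes>\<^bsub>T\<^esub> g)"
        using f g B B0 by (intro l2_star_mult_le) (auto simp: T_closed)
      also have "\<dots> \<le> B * (B * l2 g)" using B[OF g] B0 by (intro mult_left_mono)
      also have "\<dots> \<le> D * (D * l2 g)" using D B0 by (intro mult_mono) auto
      finally show ?thesis using f g by (simp add: T_assoc T_closed)
    qed
    \<comment> \<open>Squared because \<open>power_max_norm_le\<close> controls powers of the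
      squared norm. Below, \<open>R * 2 ^ k + 1 \<le> (R + 1) * 2 ^ k\<close> separates the factor
      depending on \<open>k\<close>.\<close>
    define q where "q = (max_norm T ?h / (D * D))\<^sup>2"
    have "q ^ 2 ^ k \<le> (K * real (R + 1) ^ d) * real (2 ^ k) ^ d" for k
    proof -
      have "((max_norm T ?h)\<^sup>2) ^ 2 ^ k \<le> K * real (R * 2 ^ k + 1) ^ d * ((D * D)\<^sup>2) ^ 2 ^ k"
        using f h R hB by (intro power_max_norm_le) (auto simp: T_star_mult T_star_star T_closed)
      then have "q ^ 2 ^ k \<le> K * real (R * 2 ^ k + 1) ^ d"
        using D0 by (simp add: q_def power_divide divide_le_eq)
      also have "\<dots> \<le> K * real ((R + 1) * 2 ^ k) ^ d"
        using K_nonneg by (intro mult_left_mono power_mono) auto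
      also have "\<dots> = K * real (R + 1) ^ d * real (2 ^ k) ^ d" by (simp only: of_nat_mult power_mult_distrib mult.assoc)
      finally show ?thesis .
    qed
    then have "q \<le> 1" by (rule power_le_poly_imp_le_one)
    then have "max_norm T ?h / (D * D) \<le> 1"
      using abs_square_le_1[of "max_norm T ?h / (D * D)"] M.p_nonneg[OF h] by (simp add: q_def)
    then have "(max_norm T f)\<^sup>2 \<le> D\<^sup>2"
      using D0 M.p_star_mult[OF f] by (simp add: field_simps power2_eq_square)
    then show ?thesis using D0 by (simp add: power2_le_iff_abs_le)
  qed
  then show ?thesis by (rule dense_ge)
qed

text \<open>That is, the canonical trace is faithful on the completion.\<close>

lemma max_norm_null_of_l2_null:
  assumes X: "X \<in> M.CS" and l: "(\<lambda>k. l2 (X k)) \<longlonglongrightarrow> 0"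
  shows "(\<lambda>k. max_norm T (X k)) \<longlonglongrightarrow> 0"
proof (rule LIMSEQ_I)
  fix e :: real assume "e > 0"
  then have "e / 2 > 0" by simp
  from M.CS_D[OF X this] obtain N where N: "\<And>m k. m \<ge> N \<Longrightarrow> k \<ge> N \<Longrightarrow> max_norm T (X m \<ominus>\<^bsub>T\<^esub> X k) < e / 2" by blast
  have Xc: "X k \<in> carrier T" for k using X by (rule M.CS_carrier)
  have "max_norm T (X m) \<le> e / 2" if m: "m \<ge> N" for m
  proof (rule max_norm_le_regular[OF Xc])
    fix g assume g: "g \<in> carrier T"
    \<comment> \<open>\<open>C\<close> depends on \<open>g\<close>, which is harmless:
      \<open>g\<close> stays fixed while \<open>k\<close> tends to infinity and removes the term
      \<open>C * l2 (X k)\<close>.\<close>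
    obtain C where C: "C \<ge> 0" "\<And>f. f \<in> carrier T \<Longrightarrow> l2 (f \<otimes>\<^bsub>T\<^esub> g) \<le> C * l2 f"
      using l2_mult_bounded_right[OF g] by blast
    have "l2 (X m \<otimes>\<^bsub>T\<^esub> g) \<le> e / 2 * l2 g + C * l2 (X k)" if k: "k \<ge> N" for k
    proof -
      have "X m = (X m \<ominus>\<^bsub>T\<^esub> X k) \<oplus>\<^bsub>T\<^esub> X k" using Xc[of m] Xc[of k] by algebra
      then have "X m \<otimes>\<^bsub>T\<^esub> g = (X m \<ominus>\<^bsub>T\<^esub> X k) \<otimes>\<^bsub>T\<^esub> g \<oplus>\<^bsub>T\<^esub> X k \<otimes>\<^bsub>T\<^esub> g"
        using Xc g by (metis T.l_distr T.minus_closed)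
      then have "l2 (X m \<otimes>\<^bsub>T\<^esub> g) \<le> l2 ((X m \<ominus>\<^bsub>T\<^esub> X k) \<otimes>\<^bsub>T\<^esub> g) + l2 (X k \<otimes>\<^bsub>T\<^esub> g)"
        using Xc g by (simp add: l2_add T_closed)
      also have "l2 ((X m \<ominus>\<^bsub>T\<^esub> X k) \<otimes>\<^bsub>T\<^esub> g) \<le> max_norm T (X m \<ominus>\<^bsub>T\<^esub> X k) * l2 g"
        using Xc g by (intro l2_mult_max_norm) auto
      also have "\<dots> \<le> e / 2 * l2 g" using N[OF m k] by (intro mult_right_mono) auto
      finally show ?thesis using C(2)[OF Xc, of k] by linarith
    qed
    then have "\<forall>\<^sub>F k in sequentially. l2 (X m \<otimes>\<^bsub>T\<^esub> g) \<le> e / 2 * l2 g + C * l2 (X k)"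
      by (auto simp: eventually_sequentially)
    moreover have "(\<lambda>k. e / 2 * l2 g + C * l2 (X k)) \<longlonglongrightarrow> e / 2 * l2 g + C * 0"
      by (intro tendsto_intros l)
    ultimately show "l2 (X m \<otimes>\<^bsub>T\<^esub> g) \<le> e / 2 * l2 g"
      using tendsto_lowerbound[of "\<lambda>k. e / 2 * l2 g + C * l2 (X k)" "e / 2 * l2 g + C * 0"] by simp
  qed
  then have "\<forall>m\<ge>N. norm (max_norm T (X m) - 0) < e"
    using \<open>e > 0\<close> M.p_nonneg[OF Xc] by (smt (verit) field_sum_of_halves real_norm_def)
  then show "\<exists>N. \<forall>m\<ge>N. norm (max_norm T (X m) - 0) < e" by blast
qed

end

section \<open>Averages of conjugates\<close>

context twisted_group
begin

interpretation T: star_alg T by (rule T_star_alg)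
interpretation M: seminormed_star_alg T "max_norm T"
  by (intro seminormed_star_alg.intro seminormed_star_alg_axioms.intro T_star_alg max_norm_cstar)

definition conj_by :: "'g \<Rightarrow> ('g \<Rightarrow> complex) \<Rightarrow> 'g \<Rightarrow> complex" where
  "conj_by s f = delta s \<otimes>\<^bsub>T\<^esub> f \<otimes>\<^bsub>T\<^esub> star T (delta s)"

definition avg_step :: "'g \<Rightarrow> ('g \<Rightarrow> complex) \<Rightarrow> 'g \<Rightarrow> complex" where
  "avg_step s f = (1 / 2) \<odot>\<^bsub>T\<^esub> (f \<oplus>\<^bsub>T\<^esub> conj_by s f)"

inductive avg :: "(('g \<Rightarrow> complex) \<Rightarrow> 'g \<Rightarrow> complex) \<Rightarrow> bool" where
  avg_id: "avg (\<lambda>f. f)"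
| avg_avg_step: "avg \<Phi> \<Longrightarrow> s \<in> carrier G \<Longrightarrow> avg (\<lambda>f. avg_step s (\<Phi> f))"

lemma avg_comp: "avg \<Psi> \<Longrightarrow> avg \<Phi> \<Longrightarrow> avg (\<lambda>f. \<Psi> (\<Phi> f))"
  by (induction \<Psi> rule: avg.induct) (auto intro: avg_avg_step)

lemma conj_by_closed [simp]: "s \<in> carrier G \<Longrightarrow> f \<in> carrier T \<Longrightarrow> conj_by s f \<in> carrier T"
  by (simp add: conj_by_def T_closed)

lemma conj_by_add: "s \<in> carrier G \<Longrightarrow> f \<in> carrier T \<Longrightarrow> g \<in> carrier T \<Longrightarrow>
    conj_by s (f \<oplus>\<^bsub>T\<^esub> g) = conj_by s f \<oplus>\<^bsub>T\<^esub> conj_by s g"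
  and conj_by_smult: "s \<in> carrier G \<Longrightarrow> f \<in> carrier T \<Longrightarrow> conj_by s (c \<odot>\<^bsub>T\<^esub> f) = c \<odot>\<^bsub>T\<^esub> conj_by s f"
  and conj_by_star: "s \<in> carrier G \<Longrightarrow> f \<in> carrier T \<Longrightarrow> star T (conj_by s f) = conj_by s (star T f)"
  by (simp_all add: conj_by_def T_bilin T_star_mult T_star_star T_assoc)

lemma conj_by_mult:
  assumes "s \<in> carrier G" "f \<in> carrier T" "g \<in> carrier T"
  shows "conj_by s (f \<otimes>\<^bsub>T\<^esub> g) = conj_by s f \<otimes>\<^bsub>T\<^esub> conj_by s g"
proof -
  have "conj_by s f \<otimes>\<^bsub>T\<^esub> conj_by s g =
      delta s \<otimes>\<^bsub>T\<^esub> f \<otimes>\<^bsub>T\<^esub> (star T (delta s) \<otimes>\<^bsub>T\<^esub> delta s) \<otimes>\<^bsub>T\<^esub> g \<otimes>\<^bsub>T\<^esub> star T (delta s)"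
    using assms by (simp add: conj_by_def T_assoc T_closed)
  then show ?thesis using assms by (simp add: delta_unitary conj_by_def T_assoc T_closed)
qed

lemma conj_by_one: "s \<in> carrier G \<Longrightarrow> conj_by s \<one>\<^bsub>T\<^esub> = \<one>\<^bsub>T\<^esub>"
  using T.r_one[of "delta s"] by (simp add: conj_by_def delta_unitary)

lemma max_norm_conj_by: "s \<in> carrier G \<Longrightarrow> f \<in> carrier T \<Longrightarrow> max_norm T (conj_by s f) \<le> max_norm T f"
proof -
  assume s: "s \<in> carrier G" and f: "f \<in> carrier T"
  have 1: "max_norm T (delta s) \<le> 1" using delta_norm_le_1[OF max_norm_cstar s] .
  have "max_norm T (conj_by s f) \<le> max_norm T (delta s \<otimes>\<^bsub>T\<^esub> f) * max_norm T (star T (delta s))"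
    unfolding conj_by_def using s f by (intro M.p_mult) (auto simp: T_closed)
  also have "\<dots> \<le> (max_norm T (delta s) * max_norm T f) * max_norm T (delta s)"
    using s f by (simp add: M.p_mult M.p_nonneg mult_right_mono)
  also have "\<dots> \<le> (1 * max_norm T f) * 1"
    using s f 1 by (intro mult_mono mult_nonneg_nonneg M.p_nonneg) auto
  finally show ?thesis by simp
qed

text \<open>The scalar arising when the unitary of \<open>t\<close> is conjugated by that of
  \<open>s\<close>. Support arguments use it only as a factor; for commuting elements
  \<open>conj_by_delta_commute\<close> gives a more useful form.\<close>

definition conj_phase :: "'g \<Rightarrow> 'g \<Rightarrow> complex" where
  "conj_phase s t = cnj (\<sigma> s (inv s)) * \<sigma> s t * \<sigma> (s \<otimes> t) (inv s)"

lemma conj_by_delta: "s \<in> carrier G \<Longrightarrow> t \<in> carrier G \<Longrightarrow>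
    conj_by s (delta t) = conj_phase s t \<odot>\<^bsub>T\<^esub> delta (s \<otimes> t \<otimes> inv s)"
  by (simp add: conj_by_def T_star_delta T_bilin T_delta_mult conj_phase_def mult_ac)

lemma conj_by_apply:
  assumes s: "s \<in> carrier G" and r: "r \<in> carrier G"
  shows "f \<in> carrier T \<Longrightarrow> conj_by s f r = conj_phase s (inv s \<otimes> r \<otimes> s) * f (inv s \<otimes> r \<otimes> s)"
proof (induction f rule: T_induct)
  case (delta c t)
  have "r = s \<otimes> t \<otimes> inv s \<longleftrightarrow> inv s \<otimes> r \<otimes> s = t"
    using s r delta by (metis inv_closed inv_solve_left inv_solve_right m_assoc m_closed)
  then show ?case using s delta by (simp add: conj_by_smult conj_by_delta) (auto simp: T_ops delta_def)
qed (use s in \<open>simp_all add: conj_by_add\<close>, use s in \<open>simp_all add: conj_by_def T_bilin, simp_all add: T_ops algebra_simps\<close>)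

text \<open>\<open>delta t\<close> is an eigenvector of conjugation by \<open>s\<close>. Its
  eigenvalue differs from 1 exactly when \<open>\<sigma> s t\<close> and \<open>\<sigma> t s\<close>
  differ, which is how failure of regularity becomes visible to averaging.\<close>

lemma conj_by_delta_commute:
  assumes s: "s \<in> carrier G" and t: "t \<in> carrier G" and c: "s \<otimes> t = t \<otimes> s"
  shows "conj_by s (delta t) = (\<sigma> s t * cnj (\<sigma> t s)) \<odot>\<^bsub>T\<^esub> delta t"
proof -
  have "delta t \<otimes>\<^bsub>T\<^esub> delta s = \<sigma> t s \<odot>\<^bsub>T\<^esub> delta (s \<otimes> t)" using c by (simp add: T_delta_mult)
  then have "delta s \<otimes>\<^bsub>T\<^esub> delta t = (\<sigma> s t * cnj (\<sigma> t s)) \<odot>\<^bsub>T\<^esub> (delta t \<otimes>\<^bsub>T\<^esub> delta s)"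
    using s t sigma_cnj[OF t s] by (simp add: T_delta_mult T_smult_smult mult.assoc)
  then have "conj_by s (delta t) = (\<sigma> s t * cnj (\<sigma> t s)) \<odot>\<^bsub>T\<^esub> (delta t \<otimes>\<^bsub>T\<^esub> (delta s \<otimes>\<^bsub>T\<^esub> star T (delta s)))"
    using s t by (simp add: conj_by_def T_smult_mult T_closed T_assoc)
  then show ?thesis using s t T.r_one[of "delta t"] by (simp add: delta_unitary)
qed

lemma avg_step_closed [simp]: "s \<in> carrier G \<Longrightarrow> f \<in> carrier T \<Longrightarrow> avg_step s f \<in> carrier T"
  by (simp add: avg_step_def T_closed)

lemma avg_step_add: "s \<in> carrier G \<Longrightarrow> f \<in> carrier T \<Longrightarrow> g \<in> carrier T \<Longrightarrow>
    avg_step s (f \<oplus>\<^bsub>T\<^esub> g) = avg_step s f \<oplus>\<^bsub>T\<^esub> avg_step s g"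
  by (simp add: avg_step_def conj_by_add) (simp add: T_ops algebra_simps)

lemma avg_step_smult: "s \<in> carrier G \<Longrightarrow> f \<in> carrier T \<Longrightarrow> avg_step s (c \<odot>\<^bsub>T\<^esub> f) = c \<odot>\<^bsub>T\<^esub> avg_step s f"
  by (simp add: avg_step_def conj_by_smult) (simp add: T_ops algebra_simps)

lemma avg_step_one: "s \<in> carrier G \<Longrightarrow> avg_step s \<one>\<^bsub>T\<^esub> = \<one>\<^bsub>T\<^esub>"
  by (simp add: avg_step_def conj_by_one) (simp add: T_ops)

lemma max_norm_avg_step: "s \<in> carrier G \<Longrightarrow> f \<in> carrier T \<Longrightarrow> max_norm T (avg_step s f) \<le> max_norm T f"
  using M.p_add[of f "conj_by s f"] max_norm_conj_by[of s f]
  by (simp add: avg_step_def M.p_smult T_closed)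

lemma avg_closed: "avg \<Phi> \<Longrightarrow> f \<in> carrier T \<Longrightarrow> \<Phi> f \<in> carrier T"
  by (induction \<Phi> rule: avg.induct) auto

lemma avg_add: "avg \<Phi> \<Longrightarrow> f \<in> carrier T \<Longrightarrow> g \<in> carrier T \<Longrightarrow> \<Phi> (f \<oplus>\<^bsub>T\<^esub> g) = \<Phi> f \<oplus>\<^bsub>T\<^esub> \<Phi> g"
  and avg_smult: "avg \<Phi> \<Longrightarrow> f \<in> carrier T \<Longrightarrow> \<Phi> (c \<odot>\<^bsub>T\<^esub> f) = c \<odot>\<^bsub>T\<^esub> \<Phi> f"
  and avg_one: "avg \<Phi> \<Longrightarrow> \<Phi> \<one>\<^bsub>T\<^esub> = \<one>\<^bsub>T\<^esub>"
  by (induction \<Phi> rule: avg.induct; simp add: avg_step_add avg_step_smult avg_step_one avg_closed)+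

lemma max_norm_avg: "avg \<Phi> \<Longrightarrow> f \<in> carrier T \<Longrightarrow> max_norm T (\<Phi> f) \<le> max_norm T f"
proof (induction \<Phi> rule: avg.induct)
  case (avg_avg_step \<Phi> s)
  then show ?case using max_norm_avg_step[of s "\<Phi> f"] by (simp add: avg_closed)
qed simp

lemma avg_diff: "avg \<Phi> \<Longrightarrow> f \<in> carrier T \<Longrightarrow> g \<in> carrier T \<Longrightarrow> \<Phi> (f \<ominus>\<^bsub>T\<^esub> g) = \<Phi> f \<ominus>\<^bsub>T\<^esub> \<Phi> g"
  by (simp add: T.minus_eq T.minus_smult avg_add avg_smult avg_closed T_closed)

section \<open>Positivity of quadratic forms and the Kadison inequality\<close>

definition pos_elem :: "('g \<Rightarrow> complex) \<Rightarrow> bool" where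
  "pos_elem a \<longleftrightarrow> (\<forall>g\<in>carrier T. 0 \<le> Re (ip g (a \<otimes>\<^bsub>T\<^esub> g)))"

lemma pos_elem_add: "a \<in> carrier T \<Longrightarrow> b \<in> carrier T \<Longrightarrow> pos_elem a \<Longrightarrow> pos_elem b \<Longrightarrow> pos_elem (a \<oplus>\<^bsub>T\<^esub> b)"
  by (simp add: pos_elem_def T_bilin ip_add_right)

lemma pos_elem_half: "a \<in> carrier T \<Longrightarrow> pos_elem a \<Longrightarrow> pos_elem ((1 / 2) \<odot>\<^bsub>T\<^esub> a)"
  by (simp add: pos_elem_def T_bilin ip_smult_right)

lemma pos_elem_star_mult: "a \<in> carrier T \<Longrightarrow> pos_elem (star T a \<otimes>\<^bsub>T\<^esub> a)"
  unfolding pos_elem_def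
proof
  fix g assume a: "a \<in> carrier T" and g: "g \<in> carrier T"
  have "ip g (star T a \<otimes>\<^bsub>T\<^esub> a \<otimes>\<^bsub>T\<^esub> g) = ip (a \<otimes>\<^bsub>T\<^esub> g) (a \<otimes>\<^bsub>T\<^esub> g)"
    using a g ip_mult[of "star T a" g "a \<otimes>\<^bsub>T\<^esub> g"] by (simp add: T_assoc T_closed T_star_star)
  also have "\<dots> = of_real ((l2 (a \<otimes>\<^bsub>T\<^esub> g))\<^sup>2)" using a g by (intro ip_self T_closed)
  finally show "0 \<le> Re (ip g (star T a \<otimes>\<^bsub>T\<^esub> a \<otimes>\<^bsub>T\<^esub> g))" by (simp flip: of_real_power)
qed

lemma pos_elem_conj_by: "s \<in> carrier G \<Longrightarrow> a \<in> carrier T \<Longrightarrow> pos_elem a \<Longrightarrow> pos_elem (conj_by s a)"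
  unfolding pos_elem_def
proof
  fix g assume s: "s \<in> carrier G" and a: "a \<in> carrier T" and g: "g \<in> carrier T"
    and p: "\<forall>g\<in>carrier T. 0 \<le> Re (ip g (a \<otimes>\<^bsub>T\<^esub> g))"
  have "ip g (conj_by s a \<otimes>\<^bsub>T\<^esub> g) = ip (star T (delta s) \<otimes>\<^bsub>T\<^esub> g) (a \<otimes>\<^bsub>T\<^esub> (star T (delta s) \<otimes>\<^bsub>T\<^esub> g))"
    using s a g by (simp add: conj_by_def T_assoc T_closed ip_mult T_star_star)
  then show "0 \<le> Re (ip g (conj_by s a \<otimes>\<^bsub>T\<^esub> g))" using p s g by (simp add: T_closed)
qed

lemma pos_elem_avg_step: "s \<in> carrier G \<Longrightarrow> a \<in> carrier T \<Longrightarrow> pos_elem a \<Longrightarrow> pos_elem (avg_step s a)"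
  unfolding avg_step_def by (intro pos_elem_half pos_elem_add pos_elem_conj_by) (auto simp: T_closed)

text \<open>The identity behind the Kadison inequality is
  \<open>(x\<^sup>*x + y\<^sup>*y)/2 = ((x + y)/2)\<^sup>*((x + y)/2) + ((x - y)/2)\<^sup>*((x - y)/2)\<close> with \<open>y = u x u\<^sup>*\<close>.\<close>

lemma avg_step_kadison:
  assumes s: "s \<in> carrier G" and b: "b \<in> carrier T"
  defines "h \<equiv> (1 / 2) \<odot>\<^bsub>T\<^esub> (b \<oplus>\<^bsub>T\<^esub> (-1) \<odot>\<^bsub>T\<^esub> conj_by s b)"
  shows "avg_step s (star T b \<otimes>\<^bsub>T\<^esub> b) =
    star T (avg_step s b) \<otimes>\<^bsub>T\<^esub> avg_step s b \<oplus>\<^bsub>T\<^esub> star T h \<otimes>\<^bsub>T\<^esub> h"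
  using s b unfolding h_def avg_step_def
  by (simp add: conj_by_mult conj_by_star[symmetric] T_bilin T_star_add T_star_smult)
    (simp add: T_ops(1,3) fun_eq_iff field_simps)

text \<open>The inequality is kept as an equation with a positive remainder, so that it survives
  induction: a new step averages the old remainder and adds one square \<open>h^* h\<close>.\<close>

lemma avg_kadison:
  assumes "avg \<Phi>" "a \<in> carrier T"
  shows "\<exists>p\<in>carrier T. pos_elem p \<and> \<Phi> (star T a \<otimes>\<^bsub>T\<^esub> a) = star T (\<Phi> a) \<otimes>\<^bsub>T\<^esub> \<Phi> a \<oplus>\<^bsub>T\<^esub> p"
  using assms
proof (induction \<Phi> rule: avg.induct)
  case avg_id
  then show ?case
    by (intro bexI[of _ "\<zero>\<^bsub>T\<^esub>"]) (auto simp: T_closed pos_elem_def T_mult_zero ip_zero)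
next
  case (avg_avg_step \<Phi> s)
  then obtain p where p: "p \<in> carrier T" "pos_elem p" "\<Phi> (star T a \<otimes>\<^bsub>T\<^esub> a) = star T (\<Phi> a) \<otimes>\<^bsub>T\<^esub> \<Phi> a \<oplus>\<^bsub>T\<^esub> p" by blast
  let ?b = "\<Phi> a"
  have b: "?b \<in> carrier T" using avg_avg_step by (simp add: avg_closed)
  let ?h = "(1 / 2) \<odot>\<^bsub>T\<^esub> (?b \<oplus>\<^bsub>T\<^esub> (-1) \<odot>\<^bsub>T\<^esub> conj_by s ?b)"
  have h: "?h \<in> carrier T" using b avg_avg_step by (simp add: T_closed)
  have "avg_step s (\<Phi> (star T a \<otimes>\<^bsub>T\<^esub> a)) = avg_step s (star T ?b \<otimes>\<^bsub>T\<^esub> ?b) \<oplus>\<^bsub>T\<^esub> avg_step s p"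
    using avg_avg_step p b by (simp add: avg_step_add T_closed)
  also have "\<dots> = star T (avg_step s ?b) \<otimes>\<^bsub>T\<^esub> avg_step s ?b \<oplus>\<^bsub>T\<^esub> (star T ?h \<otimes>\<^bsub>T\<^esub> ?h \<oplus>\<^bsub>T\<^esub> avg_step s p)"
    using avg_step_kadison[OF avg_avg_step(2) b] avg_avg_step p b h by (simp add: T.a_assoc T_closed)
  finally have "avg_step s (\<Phi> (star T a \<otimes>\<^bsub>T\<^esub> a)) =
    star T (avg_step s ?b) \<otimes>\<^bsub>T\<^esub> avg_step s ?b \<oplus>\<^bsub>T\<^esub> (star T ?h \<otimes>\<^bsub>T\<^esub> ?h \<oplus>\<^bsub>T\<^esub> avg_step s p)" .
  moreover have "pos_elem (star T ?h \<otimes>\<^bsub>T\<^esub> ?h \<oplus>\<^bsub>T\<^esub> avg_step s p)"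
    using avg_avg_step p h by (intro pos_elem_add pos_elem_star_mult[OF h] pos_elem_avg_step T_mult_closed T_star_closed h avg_step_closed)
  moreover have "star T ?h \<otimes>\<^bsub>T\<^esub> ?h \<oplus>\<^bsub>T\<^esub> avg_step s p \<in> carrier T"
    using avg_avg_step p by (intro T_add_closed T_mult_closed T_star_closed h avg_step_closed)
  ultimately show ?case by blast
qed

end

context poly_growth_twisted_group
begin

interpretation T: star_alg T by (rule T_star_alg)
interpretation M: seminormed_star_alg T "max_norm T"
  by (intro seminormed_star_alg.intro seminormed_star_alg_axioms.intro T_star_alg max_norm_cstar)

text \<open>On vectors, \<open>|\<Phi>(a) g|^2 \<le> <g, \<Phi>(a^* a) g>\<close>, which is at most
  the norm of \<open>\<Phi>(a^* a)\<close> times \<open>|g|^2\<close>.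
  \<open>max_norm_le_regular\<close> converts this vector bound into a bound of the full
  norm.\<close>

lemma max_norm_avg_kadison:
  assumes \<Phi>: "avg \<Phi>" and a: "a \<in> carrier T"
  shows "(max_norm T (\<Phi> a))\<^sup>2 \<le> max_norm T (\<Phi> (star T a \<otimes>\<^bsub>T\<^esub> a))"
proof -
  obtain p where p: "p \<in> carrier T" "pos_elem p" "\<Phi> (star T a \<otimes>\<^bsub>T\<^esub> a) = star T (\<Phi> a) \<otimes>\<^bsub>T\<^esub> \<Phi> a \<oplus>\<^bsub>T\<^esub> p"
    using avg_kadison[OF assms] by blast
  define q where "q = \<Phi> (star T a \<otimes>\<^bsub>T\<^esub> a)"
  have q: "q \<in> carrier T" and b: "\<Phi> a \<in> carrier T" using assms by (simp_all add: q_def avg_closed T_closed)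
  have "max_norm T (\<Phi> a) \<le> sqrt (max_norm T q)"
  proof (rule max_norm_le_regular[OF b])
    fix g assume g: "g \<in> carrier T"
    have "ip g (q \<otimes>\<^bsub>T\<^esub> g) = ip (\<Phi> a \<otimes>\<^bsub>T\<^esub> g) (\<Phi> a \<otimes>\<^bsub>T\<^esub> g) + ip g (p \<otimes>\<^bsub>T\<^esub> g)"
      unfolding q_def p(3) using b p(1) g by (simp add: T_bilin ip_add_right T_assoc ip_mult T_star_star)
    then have "(l2 (\<Phi> a \<otimes>\<^bsub>T\<^esub> g))\<^sup>2 \<le> Re (ip g (q \<otimes>\<^bsub>T\<^esub> g))"
      using p(2) g ip_self[of "\<Phi> a \<otimes>\<^bsub>T\<^esub> g"] b by (simp add: pos_elem_def T_closed flip: of_real_power)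
    also have "\<dots> \<le> l2 g * l2 (q \<otimes>\<^bsub>T\<^esub> g)"
      using ip_cauchy_schwarz[of g "q \<otimes>\<^bsub>T\<^esub> g"] complex_Re_le_cmod[of "ip g (q \<otimes>\<^bsub>T\<^esub> g)"] g q by (simp add: T_closed)
    also have "\<dots> \<le> l2 g * (max_norm T q * l2 g)"
      using g q by (intro mult_left_mono l2_mult_max_norm) auto
    finally have "l2 (\<Phi> a \<otimes>\<^bsub>T\<^esub> g) \<le> sqrt (max_norm T q * (l2 g)\<^sup>2)"
      by (intro real_le_rsqrt) (simp add: power2_eq_square mult_ac)
    then show "l2 (\<Phi> a \<otimes>\<^bsub>T\<^esub> g) \<le> sqrt (max_norm T q) * l2 g" by (simp add: real_sqrt_mult)
  qed
  then have "(max_norm T (\<Phi> a))\<^sup>2 \<le> (sqrt (max_norm T q))\<^sup>2" using M.p_nonneg[OF b] by (rule power_mono)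
  then show ?thesis using M.p_nonneg[OF q] by (simp add: q_def)
qed

end

section \<open>The Dixmier averaging property\<close>

text \<open>The commutator is arranged as \<open>r^-1 (s r s^-1)\<close>, so centrality says that
  conjugates of \<open>r\<close> stay in its coset of the center.\<close>

locale nil2_twisted_group = poly_growth_twisted_group +
  assumes commutator_central: "r \<in> carrier G \<Longrightarrow> s \<in> carrier G \<Longrightarrow> inv r \<otimes> s \<otimes> r \<otimes> inv s \<in> mult_center G"
    and center_torsion_free: "z \<in> mult_center G \<Longrightarrow> 0 < m \<Longrightarrow> z [^] (m::nat) = \<one> \<Longrightarrow> z = \<one>"
begin

interpretation T: star_alg T by (rule T_star_alg)
interpretation M: seminormed_star_alg T "max_norm T"
  by (intro seminormed_star_alg.intro seminormed_star_alg_axioms.intro T_star_alg max_norm_cstar)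

section \<open>Cosets of the center under conjugation\<close>

lemma centerD: "z \<in> mult_center G \<Longrightarrow> z \<in> carrier G" "z \<in> mult_center G \<Longrightarrow> s \<in> carrier G \<Longrightarrow> z \<otimes> s = s \<otimes> z"
  by (auto simp: mult_center_def)

lemma center_mult:
  assumes z: "z \<in> mult_center G" and w: "w \<in> mult_center G"
  shows "z \<otimes> w \<in> mult_center G"
proof -
  have "z \<otimes> w \<otimes> s = s \<otimes> (z \<otimes> w)" if s: "s \<in> carrier G" for s
  proof -
    have "z \<otimes> w \<otimes> s = (z \<otimes> s) \<otimes> w" using s centerD(1)[OF z] centerD(1)[OF w] by (simp add: m_assoc centerD(2)[OF w s])
    then show ?thesis using s centerD(1)[OF z] centerD(1)[OF w] by (simp add: m_assoc centerD(2)[OF z s])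
  qed
  then show ?thesis using centerD(1)[OF z] centerD(1)[OF w] by (simp add: mult_center_def)
qed

lemma cancel_inv: "s \<in> carrier G \<Longrightarrow> x \<in> carrier G \<Longrightarrow> s \<otimes> (inv s \<otimes> x) = x"
  "s \<in> carrier G \<Longrightarrow> x \<in> carrier G \<Longrightarrow> inv s \<otimes> (s \<otimes> x) = x"
  by (simp_all add: m_assoc[symmetric])

definition center_coset :: "'a \<Rightarrow> 'a set" where
  "center_coset t = {t \<otimes> z | z. z \<in> mult_center G}"

lemma center_coset_subset: "t \<in> carrier G \<Longrightarrow> center_coset t \<subseteq> carrier G"
  by (auto simp: center_coset_def dest: centerD)

text \<open>\<open>r = s (t z) s^-1 = (s t s^-1) z\<close>, and \<open>s t s^-1\<close> is
  \<open>t\<close> times a central commutator.\<close>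

lemma conj_center_coset:
  assumes t: "t \<in> carrier G" and s: "s \<in> carrier G" and r: "r \<in> carrier G" and c: "inv s \<otimes> r \<otimes> s \<in> center_coset t"
  shows "r \<in> center_coset t"
proof -
  obtain z where z: "z \<in> mult_center G" "inv s \<otimes> r \<otimes> s = t \<otimes> z" using c by (auto simp: center_coset_def)
  note zc = centerD[OF z(1)]
  define w where "w = inv t \<otimes> s \<otimes> t \<otimes> inv s"
  have w: "w \<in> mult_center G" "w \<in> carrier G" using t s commutator_central[of t s] by (auto simp: w_def)
  have "r = s \<otimes> (inv s \<otimes> r \<otimes> s) \<otimes> inv s" using s r by (simp add: m_assoc cancel_inv)
  also have "\<dots> = s \<otimes> t \<otimes> inv s \<otimes> z" using s t zc(1) zc(2)[of "inv s"] by (simp add: z(2) m_assoc)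
  also have "s \<otimes> t \<otimes> inv s = t \<otimes> w" using s t by (simp add: w_def m_assoc cancel_inv)
  finally have "r = t \<otimes> (w \<otimes> z)" using t w zc(1) by (simp add: m_assoc)
  then show ?thesis using center_mult[OF w(1) z(1)] by (auto simp: center_coset_def)
qed

lemma avg_support:
  assumes t: "t \<in> carrier G"
  shows "avg \<Phi> \<Longrightarrow> f \<in> carrier T \<Longrightarrow> {r. f r \<noteq> 0} \<subseteq> center_coset t \<Longrightarrow> {r. \<Phi> f r \<noteq> 0} \<subseteq> center_coset t"
proof (induction \<Phi> rule: avg.induct)
  case (avg_avg_step \<Phi> s)
  show ?case
  proof safe
    fix r assume r: "avg_step s (\<Phi> f) r \<noteq> 0"
    have c: "\<Phi> f \<in> carrier T" "avg_step s (\<Phi> f) \<in> carrier T" using avg_avg_step by (auto simp: avg_closed)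
    then have rG: "r \<in> carrier G" using r by (auto simp: T_carrier)
    have "\<Phi> f r \<noteq> 0 \<or> \<Phi> f (inv s \<otimes> r \<otimes> s) \<noteq> 0"
      using r conj_by_apply[OF avg_avg_step(2) rG c(1)] by (auto simp: avg_step_def T_ops)
    then show "r \<in> center_coset t"
      using avg_avg_step conj_center_coset[OF t avg_avg_step(2) rG] by blast
  qed
qed simp

text \<open>If \<open>s\<close> does not commute with \<open>t\<close>, then
  \<open>s^-1 t s = t z\<close> with \<open>z\<close> central and nontrivial, and conjugation by
  \<open>s^m\<close> translates the whole coset by \<open>z^m\<close>. As \<open>z\<close> has
  infinite order, each of the finitely many \<open>r\<close> in \<open>F\<close> excludes only
  finitely many \<open>m\<close>.\<close>

lemma displace:
  assumes t: "t \<in> carrier G" "t \<notin> mult_center G" and F: "finite F" "F \<subseteq> center_coset t"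
  shows "\<exists>s\<in>carrier G. \<forall>r\<in>F. inv s \<otimes> r \<otimes> s \<notin> F"
proof -
  obtain s where s: "s \<in> carrier G" "t \<otimes> s \<noteq> s \<otimes> t" using t by (auto simp: mult_center_def)
  define z where "z = inv t \<otimes> inv s \<otimes> t \<otimes> s"
  have z: "z \<in> mult_center G" "z \<in> carrier G" 
    using commutator_central[of t "inv s"] t s by (auto simp: z_def)
  have z1: "z \<noteq> \<one>"
  proof
    assume "z = \<one>"
    then have "inv s \<otimes> t \<otimes> s = t" using t s unfolding z_def
      by (metis cancel_inv(1) inv_closed m_assoc m_closed r_one)
    then show False using s t by (metis cancel_inv(1) inv_closed m_assoc m_closed)
  qed
  have sp: "s [^] m \<in> carrier G" "z [^] m \<in> carrier G" for m :: nat using s z by auto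
  have pow: "inv (s [^] m) \<otimes> t \<otimes> s [^] m = t \<otimes> z [^] m" for m :: nat
  proof (induction m)
    case (Suc m)
    have "inv (s [^] Suc m) \<otimes> t \<otimes> s [^] Suc m = inv s \<otimes> (inv (s [^] m) \<otimes> t \<otimes> s [^] m) \<otimes> s"
      using s t sp by (simp add: inv_mult_group m_assoc)
    also have "\<dots> = inv s \<otimes> t \<otimes> (z [^] m \<otimes> s)" using s t sp by (simp add: Suc m_assoc)
    also have "z [^] m \<otimes> s = s \<otimes> z [^] m" using z s centerD(2)[OF z(1)] by (intro group_commutes_pow) auto
    finally have "inv (s [^] Suc m) \<otimes> t \<otimes> s [^] Suc m = (inv s \<otimes> t \<otimes> s) \<otimes> z [^] m"
      using s t sp by (simp add: m_assoc)
    also have "inv s \<otimes> t \<otimes> s = t \<otimes> z" using s t by (simp add: z_def m_assoc cancel_inv)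
    also have "t \<otimes> z \<otimes> z [^] m = t \<otimes> z [^] Suc m" using t z sp nat_pow_Suc2[of z m] by (simp add: m_assoc del: nat_pow_Suc)
    finally show ?case .
  qed (use t in simp)
  have conj: "inv (s [^] m) \<otimes> r \<otimes> s [^] m = r \<otimes> z [^] m" if r: "r \<in> center_coset t" for r and m :: nat
  proof -
    obtain w where w: "w \<in> mult_center G" "r = t \<otimes> w" using r by (auto simp: center_coset_def)
    note wc = centerD[OF w(1)]
    have "inv (s [^] m) \<otimes> r \<otimes> s [^] m = (inv (s [^] m) \<otimes> t \<otimes> s [^] m) \<otimes> w"
      using s t sp wc(1) wc(2)[of "s [^] m"] by (simp add: w m_assoc)
    then show ?thesis using t wc(1) sp wc(2)[of "z [^] m"] by (simp add: pow w m_assoc)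
  qed
  have inj: "m = k" if r: "r \<in> carrier G" and e: "r \<otimes> z [^] m = r \<otimes> z [^] k" for r and m k :: nat
  proof -
    have zmk: "z [^] m = z [^] k" by (rule Units_l_cancel[THEN iffD1, OF _ _ _ e]) (use r sp in \<open>simp_all add: Units_eq\<close>)
    have 1: "m = k" if "m \<le> k" "z [^] m = z [^] k" for m k :: nat
    proof (rule ccontr)
      assume "m \<noteq> k"
      then have "z [^] m \<otimes> z [^] (k - m) = z [^] k" "k - m > 0"
        using that(1) nat_pow_mult[of z m "k - m"] z(2) by simp_all
      then have "z [^] (k - m) = \<one>" using that(2) sp l_cancel_one[of "z [^] m" "z [^] (k - m)"] by metis
      then show False using z z1 center_torsion_free[of z "k - m"] \<open>k - m > 0\<close> by blast
    qed
    show ?thesis using 1[OF _ zmk] 1[OF _ zmk[symmetric]] nat_le_linear[of m k] by blast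
  qed
  have FG: "F \<subseteq> carrier G" using F center_coset_subset[OF t(1)] by blast
  have "finite {m::nat. r \<otimes> z [^] m \<in> F}" if "r \<in> F" for r
  proof -
    have "inj (\<lambda>m::nat. r \<otimes> z [^] m)" by (rule injI, rule inj[of r]) (use that FG in auto)
    from finite_vimageI[OF F(1) this] show ?thesis by (simp add: vimage_def)
  qed
  then have "finite (\<Union>r\<in>F. {m::nat. r \<otimes> z [^] m \<in> F})" using F(1) by blast
  then obtain m :: nat where "m \<notin> (\<Union>r\<in>F. {m::nat. r \<otimes> z [^] m \<in> F})" using ex_new_if_finite by (metis infinite_UNIV_nat)
  then have "inv (s [^] m) \<otimes> r \<otimes> s [^] m \<notin> F" if "r \<in> F" for r
    using conj[of r m] that F(2) by (metis (no_types, lifting) UN_iff mem_Collect_eq subsetD)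
  then show ?thesis using sp(1)[of m] by (intro bexI[of _ "s [^] m"] ballI)
qed

text \<open>\<open>f\<close> and its conjugate are orthogonal and of equal norm, so the squared norm
  of the sum is doubled, and the factor 1/2 contributes 1/4.\<close>

lemma l2_avg_step_disjoint:
  assumes s: "s \<in> carrier G" and f: "f \<in> carrier T" and dis: "\<And>r. f r \<noteq> 0 \<Longrightarrow> f (inv s \<otimes> r \<otimes> s) = 0"
  shows "(l2 (avg_step s f))\<^sup>2 = (l2 f)\<^sup>2 / 2"
proof -
  let ?g = "conj_by s f"
  have g: "?g \<in> carrier T" using s f by simp
  have "ip f ?g = (\<Sum>r | f r \<noteq> 0. cnj (f r) * ?g r)" using f g by (intro ip_sum) (auto simp: T_finite)
  also have "\<dots> = 0"
  proof (intro sum.neutral ballI)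
    fix r assume "r \<in> {r. f r \<noteq> 0}"
    then show "cnj (f r) * ?g r = 0" using dis[of r] conj_by_apply[OF s _ f, of r] f by (auto simp: T_carrier)
  qed
  finally have fg: "ip f ?g = 0" .
  have "ip ?g f = cnj (ip f ?g)"
  proof -
    let ?F = "{r. f r \<noteq> 0} \<union> {r. ?g r \<noteq> 0}"
    have "finite ?F" using f g T_finite by auto
    then show ?thesis using f g by (subst (1 2) ip_sum[of _ _ ?F]) (auto simp: mult.commute)
  qed
  then have gf: "ip ?g f = 0" using fg by simp
  have "l2 ?g = l2 (f \<otimes>\<^bsub>T\<^esub> star T (delta s))"
    using s f by (simp add: conj_by_def T_assoc T_closed l2_delta_mult)
  also have "\<dots> = l2 (star T (f \<otimes>\<^bsub>T\<^esub> star T (delta s)))" using s f by (intro l2_star[symmetric] T_closed)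
  also have "\<dots> = l2 f" using s f by (simp add: T_star_mult T_star_star T_closed l2_delta_mult l2_star)
  finally have lg: "l2 ?g = l2 f" .
  have "ip (f \<oplus>\<^bsub>T\<^esub> ?g) (f \<oplus>\<^bsub>T\<^esub> ?g) = of_real (2 * (l2 f)\<^sup>2)"
    using f g ip_self[OF f] ip_self[OF g] by (simp add: ip_add_left ip_add_right T_closed fg gf lg)
  then have "(l2 (f \<oplus>\<^bsub>T\<^esub> ?g))\<^sup>2 = 2 * (l2 f)\<^sup>2"
    using ip_self[OF T_add_closed[OF f g]] by (metis of_real_eq_iff)
  then show ?thesis using f g by (simp add: avg_step_def l2_smult T_closed power_divide)
qed

text \<open>After each step the support is still finite and in the same coset, so it can be
  displaced and the squared norm halved again.\<close>

lemma avg_l2_small: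
  assumes t: "t \<in> carrier G" "t \<notin> mult_center G" and f: "f \<in> carrier T" "{r. f r \<noteq> 0} \<subseteq> center_coset t" and e: "e > 0"
  shows "\<exists>\<Psi>. avg \<Psi> \<and> (l2 (\<Psi> f))\<^sup>2 < e"
proof -
  have "\<exists>\<Psi>. avg \<Psi> \<and> (l2 (\<Psi> f))\<^sup>2 = (l2 f)\<^sup>2 / 2 ^ k" for k
  proof (induction k)
    case 0
    show ?case by (intro exI[of _ "\<lambda>f. f"]) (simp add: avg_id)
  next
    case (Suc k)
    then obtain \<Psi> where \<Psi>: "avg \<Psi>" "(l2 (\<Psi> f))\<^sup>2 = (l2 f)\<^sup>2 / 2 ^ k" by blast
    have c: "\<Psi> f \<in> carrier T" "{r. \<Psi> f r \<noteq> 0} \<subseteq> center_coset t"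
      using \<Psi> f t avg_closed avg_support[OF t(1)] by auto
    obtain s where s: "s \<in> carrier G" "\<forall>r\<in>{r. \<Psi> f r \<noteq> 0}. inv s \<otimes> r \<otimes> s \<notin> {r. \<Psi> f r \<noteq> 0}"
      using displace[OF t T_finite[OF c(1)] c(2)] by blast
    have "(l2 (avg_step s (\<Psi> f)))\<^sup>2 = (l2 f)\<^sup>2 / 2 ^ Suc k"
      using s c \<Psi> by (subst l2_avg_step_disjoint) auto
    then show ?case using avg_avg_step[OF \<Psi>(1) s(1)] by blast
  qed
  moreover have "(\<lambda>k. (l2 f)\<^sup>2 / 2 ^ k) \<longlonglongrightarrow> 0" by (rule LIMSEQ_divide_realpow_zero) simp
  then have "\<exists>k. (l2 f)\<^sup>2 / 2 ^ k < e" using order_tendstoD(2)[OF _ e] by (fastforce simp: eventually_sequentially)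
  ultimately show ?thesis by metis
qed

section \<open>Averages converging to the trace\<close>

definition averages_to_trace :: "('a \<Rightarrow> complex) \<Rightarrow> bool" where
  "averages_to_trace f \<longleftrightarrow> (\<forall>\<Phi> e. avg \<Phi> \<longrightarrow> e > 0 \<longrightarrow>
     (\<exists>\<Psi>. avg \<Psi> \<and> max_norm T (\<Psi> (\<Phi> f) \<ominus>\<^bsub>T\<^esub> f \<one> \<odot>\<^bsub>T\<^esub> \<one>\<^bsub>T\<^esub>) < e))"

lemma averages_to_traceD:
  assumes "averages_to_trace f" "avg \<Phi>" "e > 0"
  obtains \<Psi> where "avg \<Psi>" "max_norm T (\<Psi> (\<Phi> f) \<ominus>\<^bsub>T\<^esub> f \<one> \<odot>\<^bsub>T\<^esub> \<one>\<^bsub>T\<^esub>) < e"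
  using assms(1)[unfolded averages_to_trace_def, rule_format, OF assms(2,3)] that by (elim exE conjE)

lemma averages_to_trace_add:
  assumes f: "f \<in> carrier T" "averages_to_trace f" and g: "g \<in> carrier T" "averages_to_trace g"
  shows "averages_to_trace (f \<oplus>\<^bsub>T\<^esub> g)"
  unfolding averages_to_trace_def
proof (intro allI impI)
  fix \<Phi> and e :: real assume \<Phi>: "avg \<Phi>" and "e > 0"
  then have e: "e / 2 > 0" by simp
  obtain \<Psi> where \<Psi>: "avg \<Psi>" "max_norm T (\<Psi> (\<Phi> f) \<ominus>\<^bsub>T\<^esub> f \<one> \<odot>\<^bsub>T\<^esub> \<one>\<^bsub>T\<^esub>) < e / 2"
    by (rule averages_to_traceD[OF f(2) \<Phi> e])
  \<comment> \<open>The average for \<open>g\<close> is chosen after the one for \<open>f\<close>,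
    with \<open>\<Psi>\<close> counted as preliminary. It does not spoil the estimate for
    \<open>f\<close>, because \<open>\<Psi>'\<close> is contractive and fixes scalars.\<close>
  obtain \<Psi>' where \<Psi>': "avg \<Psi>'" "max_norm T (\<Psi>' (\<Psi> (\<Phi> g)) \<ominus>\<^bsub>T\<^esub> g \<one> \<odot>\<^bsub>T\<^esub> \<one>\<^bsub>T\<^esub>) < e / 2"
    by (rule averages_to_traceD[OF g(2) avg_comp[OF \<Psi>(1) \<Phi>] e])
  have c1: "\<Phi> f \<in> carrier T" "\<Phi> g \<in> carrier T" using f(1) g(1) by (simp_all only: avg_closed[OF \<Phi>])
  then have c2: "\<Psi> (\<Phi> f) \<in> carrier T" "\<Psi> (\<Phi> g) \<in> carrier T" by (simp_all only: avg_closed[OF \<Psi>(1)])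
  then have c3: "\<Psi>' (\<Psi> (\<Phi> f)) \<in> carrier T" "\<Psi>' (\<Psi> (\<Phi> g)) \<in> carrier T" by (simp_all only: avg_closed[OF \<Psi>'(1)])
  have tc: "f \<one> \<odot>\<^bsub>T\<^esub> \<one>\<^bsub>T\<^esub> \<in> carrier T" "g \<one> \<odot>\<^bsub>T\<^esub> \<one>\<^bsub>T\<^esub> \<in> carrier T" by auto
  have "\<Psi>' (\<Psi> (\<Phi> f) \<ominus>\<^bsub>T\<^esub> f \<one> \<odot>\<^bsub>T\<^esub> \<one>\<^bsub>T\<^esub>) = \<Psi>' (\<Psi> (\<Phi> f)) \<ominus>\<^bsub>T\<^esub> f \<one> \<odot>\<^bsub>T\<^esub> \<one>\<^bsub>T\<^esub>"
    using c2(1) tc(1) by (simp only: avg_diff[OF \<Psi>'(1)] avg_smult[OF \<Psi>'(1)] avg_one[OF \<Psi>'(1)] T.one_closed)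
  from arg_cong[OF this, of "max_norm T"]
  have 1: "max_norm T (\<Psi>' (\<Psi> (\<Phi> f)) \<ominus>\<^bsub>T\<^esub> f \<one> \<odot>\<^bsub>T\<^esub> \<one>\<^bsub>T\<^esub>) < e / 2"
    using max_norm_avg[OF \<Psi>'(1) T.minus_closed[OF c2(1) tc(1)]] \<Psi>(2) by linarith
  have eq: "\<Psi>' (\<Psi> (\<Phi> (f \<oplus>\<^bsub>T\<^esub> g))) \<ominus>\<^bsub>T\<^esub> (f \<oplus>\<^bsub>T\<^esub> g) \<one> \<odot>\<^bsub>T\<^esub> \<one>\<^bsub>T\<^esub> =
      (\<Psi>' (\<Psi> (\<Phi> f)) \<oplus>\<^bsub>T\<^esub> \<Psi>' (\<Psi> (\<Phi> g))) \<ominus>\<^bsub>T\<^esub> (f \<one> \<odot>\<^bsub>T\<^esub> \<one>\<^bsub>T\<^esub> \<oplus>\<^bsub>T\<^esub> g \<one> \<odot>\<^bsub>T\<^esub> \<one>\<^bsub>T\<^esub>)"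
  proof -
    have "\<Psi>' (\<Psi> (\<Phi> (f \<oplus>\<^bsub>T\<^esub> g))) = \<Psi>' (\<Psi> (\<Phi> f)) \<oplus>\<^bsub>T\<^esub> \<Psi>' (\<Psi> (\<Phi> g))"
      using f(1) g(1) c1 c2 by (simp only: avg_add[OF \<Phi>] avg_add[OF \<Psi>(1)] avg_add[OF \<Psi>'(1)])
    moreover have "(f \<oplus>\<^bsub>T\<^esub> g) \<one> = f \<one> + g \<one>" by (simp add: T_ops)
    ultimately show ?thesis by (simp only: T.smult_l_distr[OF T.one_closed])
  qed
  have "max_norm T (\<Psi>' (\<Psi> (\<Phi> (f \<oplus>\<^bsub>T\<^esub> g))) \<ominus>\<^bsub>T\<^esub> (f \<oplus>\<^bsub>T\<^esub> g) \<one> \<odot>\<^bsub>T\<^esub> \<one>\<^bsub>T\<^esub>) < e"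
    unfolding eq using M.p_diff_add[OF c3 tc] 1 \<Psi>'(2) by linarith
  then show "\<exists>\<Psi>. avg \<Psi> \<and> max_norm T (\<Psi> (\<Phi> (f \<oplus>\<^bsub>T\<^esub> g)) \<ominus>\<^bsub>T\<^esub> (f \<oplus>\<^bsub>T\<^esub> g) \<one> \<odot>\<^bsub>T\<^esub> \<one>\<^bsub>T\<^esub>) < e"
    by (intro exI[of _ "\<lambda>f. \<Psi>' (\<Psi> f)"] conjI avg_comp[OF \<Psi>'(1) \<Psi>(1)])
qed

lemma averages_to_trace_scalar: "averages_to_trace (c \<odot>\<^bsub>T\<^esub> delta \<one>)"
  unfolding averages_to_trace_def
proof (intro allI impI)
  fix \<Phi> and e :: real assume \<Phi>: "avg \<Phi>" and e: "e > 0"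
  have "\<Phi> (c \<odot>\<^bsub>T\<^esub> \<one>\<^bsub>T\<^esub>) = c \<odot>\<^bsub>T\<^esub> \<one>\<^bsub>T\<^esub>"
    by (simp only: avg_smult[OF \<Phi> T.one_closed] avg_one[OF \<Phi>])
  moreover have "(c \<odot>\<^bsub>T\<^esub> \<one>\<^bsub>T\<^esub>) \<one> = c" by (simp add: T_ops delta_def)
  ultimately have "max_norm T (\<Phi> (c \<odot>\<^bsub>T\<^esub> delta \<one>) \<ominus>\<^bsub>T\<^esub> (c \<odot>\<^bsub>T\<^esub> delta \<one>) \<one> \<odot>\<^bsub>T\<^esub> \<one>\<^bsub>T\<^esub>) < e"
    using e by (simp add: T_ops(4)[symmetric] T.minus_eq T.r_neg)
  then show "\<exists>\<Psi>. avg \<Psi> \<and> max_norm T (\<Psi> (\<Phi> (c \<odot>\<^bsub>T\<^esub> delta \<one>)) \<ominus>\<^bsub>T\<^esub> (c \<odot>\<^bsub>T\<^esub> delta \<one>) \<one> \<odot>\<^bsub>T\<^esub> \<one>\<^bsub>T\<^esub>) < e"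
    by (intro exI[of _ "\<lambda>f. f"] conjI avg_id)
qed

lemma avg_step_delta_commute:
  assumes "s \<in> carrier G" "t \<in> carrier G" "s \<otimes> t = t \<otimes> s"
  shows "avg_step s (delta t) = ((1 + \<sigma> s t * cnj (\<sigma> t s)) / 2) \<odot>\<^bsub>T\<^esub> delta t"
  unfolding avg_step_def conj_by_delta_commute[OF assms] by (simp add: T_ops algebra_simps add_divide_distrib)

text \<open>A central unitary is an eigenvector of every step, with eigenvalue
  \<open>(1 + x) / 2\<close> for some \<open>x\<close> of modulus 1. Preliminary averages therefore
  only shrink it.\<close>

lemma avg_delta_center:
  assumes z: "z \<in> mult_center G" shows "avg \<Phi> \<Longrightarrow> \<exists>a. cmod a \<le> 1 \<and> \<Phi> (delta z) = a \<odot>\<^bsub>T\<^esub> delta z"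
proof (induction \<Phi> rule: avg.induct)
  case avg_id
  show ?case by (intro exI[of _ 1]) (simp add: T_smult_one)
next
  case (avg_avg_step \<Phi> s)
  then obtain a where a: "cmod a \<le> 1" "\<Phi> (delta z) = a \<odot>\<^bsub>T\<^esub> delta z" by (elim exE conjE)
  let ?x = "\<sigma> s z * cnj (\<sigma> z s)"
  note zc = centerD(1)[OF z]
  have "cmod ?x = 1" using zc avg_avg_step(2) by (simp add: norm_mult sigma_norm)
  then have "cmod (1 + ?x) \<le> 2" using norm_triangle_ineq[of 1 ?x] by simp
  then have "cmod (a * ((1 + ?x) / 2)) \<le> 1"
    using mult_mono[OF a(1), of "cmod ((1 + ?x) / 2)" 1] by (simp add: norm_mult norm_divide)
  moreover have "avg_step s (\<Phi> (delta z)) = (a * ((1 + ?x) / 2)) \<odot>\<^bsub>T\<^esub> delta z"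
    using avg_avg_step(2) zc centerD(2)[OF z avg_avg_step(2)]
    by (simp add: a avg_step_smult avg_step_delta_commute T_smult_smult)
  ultimately show ?case by (intro exI conjI)
qed

text \<open>Strict convexity of the disc: the squared modulus is \<open>2 + 2 * Re x\<close>, and
  \<open>x = 1\<close> is the only point of the circle with real part 1.\<close>

lemma norm_one_plus_lt_two:
  fixes x :: complex
  assumes "cmod x = 1" "x \<noteq> 1" shows "cmod (1 + x) < 2"
proof -
  have 1: "(Re x)\<^sup>2 + (Im x)\<^sup>2 = 1" using assms(1) cmod_power2[of x] by simp
  have "Re x < 1"
  proof (rule ccontr)
    assume "\<not> Re x < 1"
    then have "Re x = 1" using complex_Re_le_cmod[of x] assms(1) by simp
    then have "x = 1" using 1 by (simp add: complex_eq_iff)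
    then show False using assms(2) by simp
  qed
  moreover have "(cmod (1 + x))\<^sup>2 = 2 + 2 * Re x"
    unfolding cmod_power2 using 1 by (simp add: power2_eq_square algebra_simps)
  ultimately have "(cmod (1 + x))\<^sup>2 < 2\<^sup>2" by simp
  then show ?thesis by (rule power_less_imp_less_base) simp
qed

lemma averages_to_trace_center:
  assumes z: "z \<in> mult_center G" and nr: "z \<noteq> \<one> \<Longrightarrow> \<not> cocycle_regular G \<sigma> z"
  shows "averages_to_trace (c \<odot>\<^bsub>T\<^esub> delta z)"
proof (cases "z = \<one>")
  case False
  note zc = centerD(1)[OF z]
  obtain s where s: "s \<in> carrier G" "\<sigma> z s \<noteq> \<sigma> s z"
    using nr[OF False] zc by (auto simp: cocycle_regular_def)
  have sz: "s \<otimes> z = z \<otimes> s" using centerD(2)[OF z s(1)] by simp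
  define x where "x = \<sigma> s z * cnj (\<sigma> z s)"
  have x1: "cmod x = 1" using zc s by (simp add: x_def norm_mult sigma_norm)
  have "x * \<sigma> z s = \<sigma> s z" using sigma_cnj[OF zc s(1)] by (simp add: x_def mult.assoc)
  then have "x \<noteq> 1" using s(2) by auto
  from norm_one_plus_lt_two[OF x1 this] have q: "cmod ((1 + x) / 2) < 1" by (simp add: norm_divide)
  have P: "\<exists>\<Psi>. avg \<Psi> \<and> \<Psi> (delta z) = (((1 + x) / 2) ^ k) \<odot>\<^bsub>T\<^esub> delta z" for k
  proof (induction k)
    case 0
    show ?case by (intro exI[of _ "\<lambda>f. f"] conjI avg_id) (simp add: T_smult_one)
  next
    case (Suc k)
    then obtain \<Psi> where \<Psi>: "avg \<Psi>" "\<Psi> (delta z) = (((1 + x) / 2) ^ k) \<odot>\<^bsub>T\<^esub> delta z" by (elim exE conjE)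
    have "avg_step s (\<Psi> (delta z)) = (((1 + x) / 2) ^ Suc k) \<odot>\<^bsub>T\<^esub> delta z"
      using s zc by (simp add: \<Psi>(2) avg_step_smult avg_step_delta_commute[OF s(1) zc sz] T_smult_smult x_def mult.commute)
    then show ?case by (intro exI[of _ "\<lambda>f. avg_step s (\<Psi> f)"] conjI avg_avg_step[OF \<Psi>(1) s(1)])
  qed
  show ?thesis
    unfolding averages_to_trace_def
  proof (intro allI impI)
    fix \<Phi> and e :: real assume \<Phi>: "avg \<Phi>" and e: "e > 0"
    \<comment> \<open>The preliminary average contributes only a factor \<open>a\<close> of modulus
      at most 1, so the number \<open>k\<close> of steps depends on \<open>c\<close>,
      \<open>x\<close> and \<open>e\<close> alone.\<close>
    obtain a where a: "cmod a \<le> 1" "\<Phi> (delta z) = a \<odot>\<^bsub>T\<^esub> delta z"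
      using avg_delta_center[OF z \<Phi>] by (elim exE conjE)
    have "(\<lambda>k. cmod c * cmod ((1 + x) / 2) ^ k) \<longlonglongrightarrow> cmod c * 0"
      using q by (intro tendsto_intros LIMSEQ_power_zero) simp
    then have "\<forall>\<^sub>F k in sequentially. cmod c * cmod ((1 + x) / 2) ^ k < e"
      using e by (intro order_tendstoD(2)[of _ "cmod c * 0"]) auto
    then obtain k where k: "cmod c * cmod ((1 + x) / 2) ^ k < e" by (auto simp: eventually_sequentially)
    obtain \<Psi> where \<Psi>: "avg \<Psi>" "\<Psi> (delta z) = (((1 + x) / 2) ^ k) \<odot>\<^bsub>T\<^esub> delta z"
      using P[of k] by (elim exE conjE)
    have dz: "delta z \<in> carrier T" using zc by simp
    have "\<Psi> (\<Phi> (c \<odot>\<^bsub>T\<^esub> delta z)) = (c * a * ((1 + x) / 2) ^ k) \<odot>\<^bsub>T\<^esub> delta z"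
      by (simp only: avg_smult[OF \<Phi> dz] a(2) avg_smult[OF \<Psi>(1) dz] T_smult_smult T_smult_closed[OF dz] \<Psi>(2))
    moreover have "(c \<odot>\<^bsub>T\<^esub> delta z) \<one> \<odot>\<^bsub>T\<^esub> \<one>\<^bsub>T\<^esub> = \<zero>\<^bsub>T\<^esub>" using False by (simp add: T_ops delta_def)
    ultimately have "max_norm T (\<Psi> (\<Phi> (c \<odot>\<^bsub>T\<^esub> delta z)) \<ominus>\<^bsub>T\<^esub> (c \<odot>\<^bsub>T\<^esub> delta z) \<one> \<odot>\<^bsub>T\<^esub> \<one>\<^bsub>T\<^esub>)
        = cmod (c * a * ((1 + x) / 2) ^ k) * max_norm T (delta z)"
      using dz by (simp add: T.minus_eq M.p_smult T_closed)
    also have "\<dots> \<le> cmod (c * a * ((1 + x) / 2) ^ k)"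
      using delta_norm_le_1[OF max_norm_cstar zc] by (intro mult_left_le) auto
    also have "\<dots> = cmod a * (cmod c * cmod ((1 + x) / 2) ^ k)" by (simp add: norm_mult norm_power)
    also have "\<dots> \<le> 1 * (cmod c * cmod ((1 + x) / 2) ^ k)" using a(1) by (intro mult_right_mono) auto
    also have "\<dots> < e" using k by simp
    finally show "\<exists>\<Psi>. avg \<Psi> \<and> max_norm T (\<Psi> (\<Phi> (c \<odot>\<^bsub>T\<^esub> delta z)) \<ominus>\<^bsub>T\<^esub> (c \<odot>\<^bsub>T\<^esub> delta z) \<one> \<odot>\<^bsub>T\<^esub> \<one>\<^bsub>T\<^esub>) < e"
      by (intro exI[of _ \<Psi>] conjI \<Psi>(1))
  qed
qed (simp add: averages_to_trace_scalar)

lemma averages_to_trace_center_support: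
  assumes nr: "\<And>z. z \<in> mult_center G \<Longrightarrow> z \<noteq> \<one> \<Longrightarrow> \<not> cocycle_regular G \<sigma> z"
  shows "finite F \<Longrightarrow> F \<subseteq> mult_center G \<Longrightarrow> {r. f r \<noteq> 0} \<subseteq> F \<Longrightarrow> averages_to_trace f"
proof (induction F arbitrary: f rule: finite_induct)
  case empty
  then have "f = 0 \<odot>\<^bsub>T\<^esub> delta \<one>" by (auto simp: T_ops)
  then show ?case by (simp only: averages_to_trace_scalar)
next
  case (insert r F)
  have r: "r \<in> mult_center G" and F: "F \<subseteq> carrier G" using insert centerD(1) by auto
  have e: "f = (f(r := 0)) \<oplus>\<^bsub>T\<^esub> (f r \<odot>\<^bsub>T\<^esub> delta r)" by (auto simp: T_ops delta_def)
  have s: "{t. (f(r := 0)) t \<noteq> 0} \<subseteq> F" using insert by auto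
  have c: "f(r := 0) \<in> carrier T" using s F finite_subset[OF s insert(1)] unfolding T_carrier by blast
  show ?case
    by (subst e, rule averages_to_trace_add[OF c _ T_smult_closed[OF T_delta[OF centerD(1)[OF r]]]])
      (use insert s r nr in \<open>auto intro: averages_to_trace_center\<close>)
qed

lemma star_mult_support:
  assumes f: "f \<in> carrier T" and x: "(star T f \<otimes>\<^bsub>T\<^esub> f) x \<noteq> 0"
  obtains r s where "f r \<noteq> 0" "f s \<noteq> 0" "x = inv r \<otimes> s"
proof -
  have fin: "finite {r. star T f r \<noteq> 0}" "finite {r. f r \<noteq> 0}" using f by (auto simp: T_finite T_closed)
  have "\<exists>r s. star T f r \<noteq> 0 \<and> f s \<noteq> 0 \<and> r \<otimes> s = x"
  proof (rule ccontr)
    assume "\<not> ?thesis"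
    then have "(star T f \<otimes>\<^bsub>T\<^esub> f) x = 0"
      unfolding T_mult[OF fin(1) subset_refl fin(2) subset_refl] by (intro sum.neutral ballI) auto
    then show False using x by simp
  qed
  then obtain r s where rs: "star T f r \<noteq> 0" "f s \<noteq> 0" "r \<otimes> s = x" by blast
  then have "r \<in> carrier G" "f (inv r) \<noteq> 0" by (auto simp: T_ops split: if_splits)
  then show ?thesis using that[of "inv r" s] rs by simp
qed

text \<open>\<open>(t z)^-1 (t w) = z^-1 w\<close>. Hence \<open>y^* y\<close> is supported on the
  center whenever \<open>y\<close> is supported on a single coset.\<close>

lemma center_coset_quotient:
  assumes t: "t \<in> carrier G" and r: "r \<in> center_coset t" and s: "s \<in> center_coset t"
  shows "inv r \<otimes> s \<in> mult_center G"
proof -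
  obtain z w where z: "z \<in> mult_center G" "r = t \<otimes> z" and w: "w \<in> mult_center G" "s = t \<otimes> w"
    using r s by (auto simp: center_coset_def)
  note zc = centerD(1)[OF z(1)] note wc = centerD(1)[OF w(1)]
  have e: "inv r \<otimes> s = inv z \<otimes> w" using t zc wc by (simp add: z w inv_mult_group m_assoc cancel_inv)
  have "inv z \<otimes> w \<otimes> x = x \<otimes> (inv z \<otimes> w)" if x: "x \<in> carrier G" for x
  proof -
    have "inv z \<otimes> x = x \<otimes> inv z"
      using centerD(2)[OF z(1), of "inv x"] x zc by (metis inv_closed inv_inv inv_mult_group)
    then show ?thesis using x zc wc centerD(2)[OF w(1) x] by (metis inv_closed m_assoc)
  qed
  then show ?thesis using zc wc by (simp add: e mult_center_def)
qed

text \<open>Off the center, averaging first makes the trace norm small; then the Kadison inequality reduces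
  to the centrally supported element \<open>y\<^sup>*y\<close>, whose trace is \<open>(l2 y)\<^sup>2\<close>.\<close>

lemma averages_to_trace_noncenter:
  assumes nr: "\<And>z. z \<in> mult_center G \<Longrightarrow> z \<noteq> \<one> \<Longrightarrow> \<not> cocycle_regular G \<sigma> z"
    and t: "t \<in> carrier G" "t \<notin> mult_center G"
  shows "averages_to_trace (c \<odot>\<^bsub>T\<^esub> delta t)"
  unfolding averages_to_trace_def
proof (intro allI impI)
  fix \<Phi> and e :: real assume \<Phi>: "avg \<Phi>" and e: "e > 0"
  have oc: "\<one> \<in> mult_center G" by (simp add: mult_center_def)
  then have t1: "t \<noteq> \<one>" using t by auto
  define f where "f = c \<odot>\<^bsub>T\<^esub> delta t"
  have f: "f \<in> carrier T" using t by (simp add: f_def T_closed)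
  have "t \<in> center_coset t" unfolding center_coset_def using t oc by (auto intro!: exI[of _ \<one>])
  then have "{r. f r \<noteq> 0} \<subseteq> center_coset t" by (auto simp: f_def T_ops delta_def split: if_splits)
  from avg_support[OF t(1) \<Phi> f this] have sup: "{r. \<Phi> f r \<noteq> 0} \<subseteq> center_coset t" .
  have \<Phi>f: "\<Phi> f \<in> carrier T" by (rule avg_closed[OF \<Phi> f])
  \<comment> \<open>Kadison compares squares, so the budget is the square of \<open>e\<close>: one
    half for the trace of \<open>y^* y\<close>, the other for the distance of its average from that
    trace.\<close>
  have e2: "e\<^sup>2 / 2 > 0" using e by simp
  obtain \<Psi> where \<Psi>: "avg \<Psi>" "(l2 (\<Psi> (\<Phi> f)))\<^sup>2 < e\<^sup>2 / 2"
    using avg_l2_small[OF t \<Phi>f sup e2] by (elim exE conjE)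
  define y where "y = \<Psi> (\<Phi> f)"
  have y: "y \<in> carrier T" unfolding y_def by (rule avg_closed[OF \<Psi>(1) \<Phi>f])
  have ysup: "{r. y r \<noteq> 0} \<subseteq> center_coset t" unfolding y_def by (rule avg_support[OF t(1) \<Psi>(1) \<Phi>f sup])
  let ?a = "star T y \<otimes>\<^bsub>T\<^esub> y"
  have a: "?a \<in> carrier T" using y by (simp add: T_closed)
  have "{r. ?a r \<noteq> 0} \<subseteq> mult_center G"
  proof
    fix x assume "x \<in> {r. ?a r \<noteq> 0}"
    then obtain r s where "y r \<noteq> 0" "y s \<noteq> 0" "x = inv r \<otimes> s" using star_mult_support[OF y] by blast
    then show "x \<in> mult_center G" using center_coset_quotient[OF t(1)] ysup by blast
  qed
  then have "averages_to_trace ?a"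
    using averages_to_trace_center_support[OF nr T_finite[OF a]] by blast
  then obtain \<Psi>' where \<Psi>': "avg \<Psi>'" "max_norm T (\<Psi>' ?a \<ominus>\<^bsub>T\<^esub> ?a \<one> \<odot>\<^bsub>T\<^esub> \<one>\<^bsub>T\<^esub>) < e\<^sup>2 / 2"
    by (rule averages_to_traceD[OF _ avg_id e2])
  have \<Psi>a: "\<Psi>' ?a \<in> carrier T" and \<Psi>y: "\<Psi>' y \<in> carrier T" using avg_closed[OF \<Psi>'(1)] a y by blast+
  have tr: "?a \<one> = of_real ((l2 y)\<^sup>2)" using ip_self[OF y] by (simp add: ip_def)
  have "max_norm T (\<Psi>' ?a) \<le> max_norm T (\<Psi>' ?a \<ominus>\<^bsub>T\<^esub> ?a \<one> \<odot>\<^bsub>T\<^esub> \<one>\<^bsub>T\<^esub>) + max_norm T (?a \<one> \<odot>\<^bsub>T\<^esub> \<one>\<^bsub>T\<^esub>)"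
    using M.p_diff_abs[OF \<Psi>a T.smult_closed[OF T.one_closed, of "?a \<one>"]] by linarith
  also have "max_norm T (?a \<one> \<odot>\<^bsub>T\<^esub> \<one>\<^bsub>T\<^esub>) = cmod (?a \<one>) * max_norm T (delta \<one>)"
    unfolding T_ops(4) by (rule M.p_smult[OF T_delta[OF one_closed]])
  also have "\<dots> \<le> cmod (?a \<one>)"
    using delta_norm_le_1[OF max_norm_cstar one_closed] by (intro mult_left_le) auto
  also have "\<dots> = (l2 y)\<^sup>2" unfolding tr norm_of_real by simp
  finally have "max_norm T (\<Psi>' ?a) < e\<^sup>2" using \<Psi>'(2) \<Psi>(2) by (simp add: y_def)
  then have "(max_norm T (\<Psi>' y))\<^sup>2 < e\<^sup>2" using max_norm_avg_kadison[OF \<Psi>'(1) y] by linarith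
  then have "max_norm T (\<Psi>' y) < e" by (rule power_less_imp_less_base) (use e in simp)
  moreover have "\<Psi>' y \<ominus>\<^bsub>T\<^esub> f \<one> \<odot>\<^bsub>T\<^esub> \<one>\<^bsub>T\<^esub> = \<Psi>' y"
  proof -
    have "f \<one> \<odot>\<^bsub>T\<^esub> \<one>\<^bsub>T\<^esub> = \<zero>\<^bsub>T\<^esub>" using t1 by (simp add: f_def T_ops delta_def)
    then show ?thesis using \<Psi>y by (simp add: T.minus_eq)
  qed
  ultimately have "max_norm T (\<Psi>' (\<Psi> (\<Phi> f)) \<ominus>\<^bsub>T\<^esub> f \<one> \<odot>\<^bsub>T\<^esub> \<one>\<^bsub>T\<^esub>) < e" by (simp add: y_def)
  then show "\<exists>\<Psi>. avg \<Psi> \<and> max_norm T (\<Psi> (\<Phi> (c \<odot>\<^bsub>T\<^esub> delta t)) \<ominus>\<^bsub>T\<^esub> (c \<odot>\<^bsub>T\<^esub> delta t) \<one> \<odot>\<^bsub>T\<^esub> \<one>\<^bsub>T\<^esub>) < e"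
    unfolding f_def by (intro exI[of _ "\<lambda>f. \<Psi>' (\<Psi> f)"] conjI avg_comp[OF \<Psi>'(1) \<Psi>(1)])
qed

text \<open>Additivity leaves a single \<open>delta r\<close>, which lies in one coset of the
  center.\<close>

theorem averages_to_trace:
  assumes nr: "\<And>z. z \<in> mult_center G \<Longrightarrow> z \<noteq> \<one> \<Longrightarrow> \<not> cocycle_regular G \<sigma> z" and f: "f \<in> carrier T"
  shows "averages_to_trace f"
  using f
proof (induction f rule: T_induct)
  case zero
  have "\<zero>\<^bsub>T\<^esub> = 0 \<odot>\<^bsub>T\<^esub> delta \<one>" by (simp add: T_ops)
  then show ?case by (simp only: averages_to_trace_scalar)
next
  case (add f g)
  then show ?case by (intro averages_to_trace_add)
next
  case (delta c r)
  then show ?case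
    by (cases "r \<in> mult_center G") (use nr averages_to_trace_center averages_to_trace_noncenter in auto)
qed

end

section \<open>Simplicity and the center\<close>

text \<open>\<open>J\<close> is the closure of the right ideal generated by \<open>w\<close>,
  written as the points at distance 0 from it. Centrality of \<open>w\<close> makes it
  two-sided.\<close>

lemma (in cstar_alg) central_ideal_closure:
  assumes w: "w \<in> mult_center A"
  defines "J \<equiv> {x \<in> carrier A. \<forall>e>0. \<exists>y\<in>carrier A. nrm A (x \<ominus> w \<otimes> y) < e}"
  shows "ideal J A" "closed_in A J" "w \<in> J"
proof -
  interpret N: seminormed_star_alg A "nrm A"
    by (intro seminormed_star_alg.intro seminormed_star_alg_axioms.intro star_alg_axioms nrm_cstar)
  have wc: "w \<in> carrier A" and wx: "\<And>x. x \<in> carrier A \<Longrightarrow> w \<otimes> x = x \<otimes> w"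
    using w by (auto simp: mult_center_def)
  have Jc: "J \<subseteq> carrier A" by (auto simp: J_def)
  have JD: "\<exists>y\<in>carrier A. nrm A (x \<ominus> w \<otimes> y) < e" if "x \<in> J" "e > 0" for x e
    using that unfolding J_def by blast
  have Jadd: "x \<oplus> y \<in> J" if x: "x \<in> J" and y: "y \<in> J" for x y
  proof -
    have c: "x \<in> carrier A" "y \<in> carrier A" using x y Jc by auto
    have "\<exists>u\<in>carrier A. nrm A (x \<oplus> y \<ominus> w \<otimes> u) < e" if e: "e > 0" for e
    proof -
      obtain u v where u: "u \<in> carrier A" "nrm A (x \<ominus> w \<otimes> u) < e / 2" and v: "v \<in> carrier A" "nrm A (y \<ominus> w \<otimes> v) < e / 2"
        using JD[OF x half_gt_zero[OF e]] JD[OF y half_gt_zero[OF e]] by blast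
      have "nrm A (x \<oplus> y \<ominus> (w \<otimes> u \<oplus> w \<otimes> v)) < e"
        using N.p_diff_add[OF c, of "w \<otimes> u" "w \<otimes> v"] u v wc by simp
      then show ?thesis using u v wc by (intro bexI[of _ "u \<oplus> v"]) (auto simp: r_distr)
    qed
    then show ?thesis using c by (simp add: J_def)
  qed
  have Jmult: "a \<otimes> x \<in> J" "x \<otimes> a \<in> J" if x: "x \<in> J" and a: "a \<in> carrier A" for a x
  proof -
    have c: "x \<in> carrier A" using x Jc by auto
    \<comment> \<open>One approximation of \<open>x\<close> by \<open>w b\<close> serves both
      products: \<open>a x\<close> is close to \<open>w (a b)\<close> because \<open>w\<close> is
      central, and \<open>x a\<close> to \<open>w (b a)\<close>.\<close>
    have "\<exists>b\<in>carrier A. nrm A (a \<otimes> x \<ominus> w \<otimes> (a \<otimes> b)) < e \<and> nrm A (x \<otimes> a \<ominus> w \<otimes> (b \<otimes> a)) < e" if e: "e > 0" for e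
    proof -
      have na: "nrm A a \<ge> 0" using a by (rule N.p_nonneg)
      \<comment> \<open>The summand 1 covers the case that \<open>a\<close> has norm 0.\<close>
      have "e / (nrm A a + 1) > 0" using e na by simp
      then obtain b where b: "b \<in> carrier A" "nrm A (x \<ominus> w \<otimes> b) < e / (nrm A a + 1)"
        using x unfolding J_def by blast
      have d: "x \<ominus> w \<otimes> b \<in> carrier A" using c wc b by simp
      have lt: "nrm A a * nrm A (x \<ominus> w \<otimes> b) < e"
      proof -
        have "nrm A a * nrm A (x \<ominus> w \<otimes> b) \<le> (nrm A a + 1) * nrm A (x \<ominus> w \<otimes> b)"
          using N.p_nonneg[OF d] by (simp add: distrib_right)
        also have "\<dots> < e" using b(2) na by (simp add: field_simps)
        finally show ?thesis .
      qed
      have "a \<otimes> x \<ominus> w \<otimes> (a \<otimes> b) = a \<otimes> (x \<ominus> w \<otimes> b)"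
        using a b c wc wx[OF a] by (simp add: minus_eq r_distr r_minus m_assoc[symmetric])
      moreover have "x \<otimes> a \<ominus> w \<otimes> (b \<otimes> a) = (x \<ominus> w \<otimes> b) \<otimes> a"
        using a b c wc by (simp add: minus_eq l_distr l_minus m_assoc)
      ultimately show ?thesis
        using N.p_mult[OF a d] N.p_mult[OF d a] lt b(1) by (intro bexI[of _ b]) (auto simp: mult.commute)
    qed
    then show "a \<otimes> x \<in> J" "x \<otimes> a \<in> J" using a c unfolding J_def by (blast intro: m_closed)+
  qed
  have J0: "\<zero> \<in> J"
    unfolding J_def using wc by (auto intro!: bexI[of _ "\<zero>"] simp: minus_eq)
  have Jneg: "\<ominus> x \<in> J" if "x \<in> J" for x
    using Jmult(1)[OF that, of "\<ominus> \<one>"] that Jc by (auto simp: l_minus)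
  show "ideal J A"
  proof (rule idealI[OF ring_axioms])
    show "subgroup J (add_monoid A)"
      by (rule add.subgroupI) (use Jc J0 Jadd Jneg in \<open>auto simp: a_inv_def\<close>)
  qed (use Jmult in auto)
  show "closed_in A J"
    unfolding closed_in_def
  proof (intro allI impI, elim conjE)
    fix X x assume X: "\<forall>k. X k \<in> J" and x: "x \<in> carrier A" and l: "(\<lambda>k. nrm A (X k \<ominus> x)) \<longlonglongrightarrow> 0"
    have "\<exists>y\<in>carrier A. nrm A (x \<ominus> w \<otimes> y) < e" if e: "e > 0" for e
    proof -
      have e2: "e / 2 > 0" using e by simp
      from order_tendstoD(2)[OF l e2] obtain k where k: "nrm A (X k \<ominus> x) < e / 2"
        by (auto simp: eventually_sequentially)
      obtain y where y: "y \<in> carrier A" "nrm A (X k \<ominus> w \<otimes> y) < e / 2"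
        using X e2 unfolding J_def by blast
      have Xk: "X k \<in> carrier A" using X Jc by auto
      have "nrm A (x \<ominus> w \<otimes> y) < e"
        using N.p_diff_tri[OF x Xk, of "w \<otimes> y"] N.p_diff_sym[OF x Xk] k y wc by simp
      then show ?thesis using y by blast
    qed
    then show "x \<in> J" using x by (simp add: J_def)
  qed
  show "w \<in> J" unfolding J_def using wc by (auto intro!: bexI[of _ "\<one>"] simp: minus_eq r_neg)
qed

section \<open>The trace and the averages on the completion\<close>

context twisted_group
begin

interpretation T: star_alg T by (rule T_star_alg)
interpretation M: seminormed_star_alg T "max_norm T"
  by (intro seminormed_star_alg.intro seminormed_star_alg_axioms.intro T_star_alg max_norm_cstar)
interpretation CC: cstar_alg M.CC by (rule M.CC_cstar_alg)
interpretation CC: seminormed_star_alg M.CC "nrm M.CC"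
  by (intro seminormed_star_alg.intro seminormed_star_alg_axioms.intro M.CC_star_alg M.CC_cstar_seminorm)

text \<open>A coefficient is an inner product with a unit vector. So coefficients, the trace among
  them, are continuous for the full norm.\<close>

lemma cmod_apply_le: "f \<in> carrier T \<Longrightarrow> r \<in> carrier G \<Longrightarrow> cmod (f r) \<le> max_norm T f"
  using ip_cauchy_schwarz[of "delta r" f] l2_le_max_norm[of f] by (simp add: ip_delta)

lemma max_norm_one_le: "max_norm T \<one>\<^bsub>T\<^esub> \<le> 1"
  unfolding T_ops(4) by (rule delta_norm_le_1[OF max_norm_cstar one_closed])

lemma CC_one_nonzero: "\<one>\<^bsub>M.CC\<^esub> \<noteq> \<zero>\<^bsub>M.CC\<^esub>"
proof
  assume "\<one>\<^bsub>M.CC\<^esub> = \<zero>\<^bsub>M.CC\<^esub>"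
  then have "max_norm T \<one>\<^bsub>T\<^esub> = 0" using M.nrm_const[OF T.one_closed] CC.p_zero by (simp add: M.CC_one)
  then show False using cmod_apply_le[OF T.one_closed one_closed] by (simp add: T_ops(4) delta_def)
qed

text \<open>The trace on the completion appears only as this limit along a representing
  sequence.\<close>

lemma CS_trace_convergent: 
  assumes X: "X \<in> M.CS" shows "convergent (\<lambda>k. X k \<one>)"
proof -
  have "Cauchy (\<lambda>k. X k \<one>)"
  proof (rule metric_CauchyI)
    fix e :: real assume "e > 0"
    from M.CS_D[OF X this] obtain N where N: "\<forall>m\<ge>N. \<forall>k\<ge>N. max_norm T (X m \<ominus>\<^bsub>T\<^esub> X k) < e" by blast
    have "dist (X m \<one>) (X k \<one>) < e" if "m \<ge> N" "k \<ge> N" for m k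
    proof -
      have c: "X m \<in> carrier T" "X k \<in> carrier T" using M.CS_carrier[OF X] by auto
      have "(X m \<ominus>\<^bsub>T\<^esub> X k) \<one> = X m \<one> - X k \<one>"
        unfolding T.minus_eq T.minus_smult[OF c(2)] by (simp add: T_ops)
      then have "dist (X m \<one>) (X k \<one>) \<le> max_norm T (X m \<ominus>\<^bsub>T\<^esub> X k)"
        using cmod_apply_le[OF T.minus_closed[OF c] one_closed] by (simp add: dist_norm)
      then show ?thesis using N that by (meson order_le_less_trans)
    qed
    then show "\<exists>N. \<forall>m\<ge>N. \<forall>n\<ge>N. dist (X m \<one>) (X n \<one>) < e" by blast
  qed
  then show ?thesis by (rule Cauchy_convergent)
qed

lemma avg_CS: 
  assumes \<Phi>: "avg \<Phi>" and X: "X \<in> M.CS" shows "(\<lambda>k. \<Phi> (X k)) \<in> M.CS"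
proof (rule M.CS_dominated[OF X, of _ 1])
  have c: "X k \<in> carrier T" for k using M.CS_carrier[OF X] .
  show "\<Phi> (X k) \<in> carrier T" for k by (rule avg_closed[OF \<Phi> c])
  show "max_norm T (\<Phi> (X m) \<ominus>\<^bsub>T\<^esub> \<Phi> (X k)) \<le> 1 * max_norm T (X m \<ominus>\<^bsub>T\<^esub> X k)" for m k
    using max_norm_avg[OF \<Phi> T.minus_closed[OF c c]] by (simp only: avg_diff[OF \<Phi> c c] mult_1)
qed simp

lemma cls_avg_step:
  assumes s: "s \<in> carrier G" and X: "X \<in> M.CS"
  shows "M.cls (\<lambda>k. avg_step s (X k)) = (1 / 2) \<odot>\<^bsub>M.CC\<^esub> (M.cls X \<oplus>\<^bsub>M.CC\<^esub> \<iota> s \<otimes>\<^bsub>M.CC\<^esub> M.cls X \<otimes>\<^bsub>M.CC\<^esub> star M.CC (\<iota> s))"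
  using s X unfolding twisted_unitary_def avg_step_def conj_by_def
  by (simp add: M.CC_mult M.CC_add M.CC_smult M.CC_star M.CS_const M.CS_mult M.CS_add M.CS_star)

lemma iota_closed: "s \<in> carrier G \<Longrightarrow> \<iota> s \<in> carrier M.CC"
  by (simp add: twisted_unitary_def M.CS_const)

text \<open>A step multiplies by \<open>\<iota> s\<close> on the left and its adjoint on the right,
  adds, and halves; a two-sided ideal allows all of this.\<close>

lemma cls_avg_ideal:
  assumes I: "ideal I M.CC" and X: "X \<in> M.CS" "M.cls X \<in> I"
  shows "avg \<Phi> \<Longrightarrow> M.cls (\<lambda>k. \<Phi> (X k)) \<in> I"
proof (induction \<Phi> rule: avg.induct)
  case avg_id
  then show ?case using X by simp
next
  case (avg_avg_step \<Phi> s)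
  interpret I: ideal I M.CC by (rule I)
  have Ic: "x \<in> carrier M.CC" if "x \<in> I" for x using that I.a_subset by blast
  define U where "U = M.cls (\<lambda>k. \<Phi> (X k))"
  have U: "U \<in> I" unfolding U_def by (rule avg_avg_step(3))
  note i = iota_closed[OF avg_avg_step(2)]
  have "U \<oplus>\<^bsub>M.CC\<^esub> \<iota> s \<otimes>\<^bsub>M.CC\<^esub> U \<otimes>\<^bsub>M.CC\<^esub> star M.CC (\<iota> s) \<in> I" (is "?V \<in> I")
    using U i by (intro I.a_closed I.I_r_closed I.I_l_closed CC.star_closed)
  \<comment> \<open>A ring ideal absorbs scalars because they are multiples of the identity.\<close>
  then have "((1 / 2) \<odot>\<^bsub>M.CC\<^esub> \<one>\<^bsub>M.CC\<^esub>) \<otimes>\<^bsub>M.CC\<^esub> ?V \<in> I" by (intro I.I_l_closed CC.smult_closed CC.one_closed)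
  then have "(1 / 2) \<odot>\<^bsub>M.CC\<^esub> ?V \<in> I"
    using CC.smult_mult_l[OF CC.one_closed Ic[OF \<open>?V \<in> I\<close>], of "1 / 2"] CC.l_one[OF Ic[OF \<open>?V \<in> I\<close>]] by simp
  then show ?case unfolding U_def cls_avg_step[OF avg_avg_step(2) avg_CS[OF avg_avg_step(1) X(1)]] .
qed

lemma cls_avg_center:
  assumes X: "X \<in> M.CS" "M.cls X \<in> mult_center M.CC"
  shows "avg \<Phi> \<Longrightarrow> M.cls (\<lambda>k. \<Phi> (X k)) = M.cls X"
proof (induction \<Phi> rule: avg.induct)
  case avg_id
  then show ?case by simp
next
  case (avg_avg_step \<Phi> s)
  define U where "U = M.cls X"
  have U: "U \<in> carrier M.CC" and Uc: "\<And>x. x \<in> carrier M.CC \<Longrightarrow> U \<otimes>\<^bsub>M.CC\<^esub> x = x \<otimes>\<^bsub>M.CC\<^esub> U"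
    using X by (auto simp: U_def mult_center_def)
  note i = iota_closed[OF avg_avg_step(2)]
  have "\<iota> s \<otimes>\<^bsub>M.CC\<^esub> star M.CC (\<iota> s) = \<one>\<^bsub>M.CC\<^esub>"
    using iota_unitary[OF avg_avg_step(2)] by (simp add: unitary_elem_def twisted_cstar_def)
  then have "\<iota> s \<otimes>\<^bsub>M.CC\<^esub> U \<otimes>\<^bsub>M.CC\<^esub> star M.CC (\<iota> s) = U"
    using U i by (simp add: Uc[OF i, symmetric] CC.m_assoc)
  then have "(1 / 2) \<odot>\<^bsub>M.CC\<^esub> (U \<oplus>\<^bsub>M.CC\<^esub> \<iota> s \<otimes>\<^bsub>M.CC\<^esub> U \<otimes>\<^bsub>M.CC\<^esub> star M.CC (\<iota> s)) = U"
    using CC.smult_l_distr[OF U, of "1 / 2" "1 / 2"] U by (simp add: CC.smult_r_distr)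
  then show ?case
    using cls_avg_step[OF avg_avg_step(2) avg_CS[OF avg_avg_step(1) X(1)]] avg_avg_step(3) by (simp add: U_def)
qed

end

lemma (in ring) eq_of_minus_eq_zero:
  assumes "x \<in> carrier R" "y \<in> carrier R" "x \<ominus> y = \<zero>" shows "x = y"
proof -
  have "x = (x \<ominus> y) \<oplus> y" using assms(1,2) by algebra
  then show ?thesis using assms by simp
qed

context nil2_twisted_group
begin

interpretation T: star_alg T by (rule T_star_alg)
interpretation M: seminormed_star_alg T "max_norm T"
  by (intro seminormed_star_alg.intro seminormed_star_alg_axioms.intro T_star_alg max_norm_cstar)
interpretation CC: cstar_alg M.CC by (rule M.CC_cstar_alg)
interpretation CC: seminormed_star_alg M.CC "nrm M.CC"
  by (intro seminormed_star_alg.intro seminormed_star_alg_axioms.intro M.CC_star_alg M.CC_cstar_seminorm)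

text \<open>Three errors of \<open>e / 3\<close>: replacing the sequence by one term
  \<open>X k\<close>, averaging \<open>X k\<close> to its trace, and replacing that trace by the
  limit \<open>c\<close>. Contractivity keeps the first error small after the average chosen for
  \<open>X k\<close> is applied to the whole sequence.\<close>

lemma cls_avg_approx_trace:
  assumes nr: "\<And>z. z \<in> mult_center G \<Longrightarrow> z \<noteq> \<one> \<Longrightarrow> \<not> cocycle_regular G \<sigma> z"
    and X: "X \<in> M.CS" and c: "(\<lambda>k. X k \<one>) \<longlonglongrightarrow> c" and e: "e > 0"
  obtains \<Phi> where "avg \<Phi>" "nrm M.CC (M.cls (\<lambda>k. \<Phi> (X k)) \<ominus>\<^bsub>M.CC\<^esub> c \<odot>\<^bsub>M.CC\<^esub> \<one>\<^bsub>M.CC\<^esub>) < e"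
proof -
  have e3: "e / 3 > 0" using e by simp
  have Xc: "X k \<in> carrier T" for k using X by (rule M.CS_carrier)
  have "\<forall>\<^sub>F k in sequentially. nrm M.CC (M.cls (\<lambda>j. X k) \<ominus>\<^bsub>M.CC\<^esub> M.cls X) < e / 3"
    using order_tendstoD(2)[OF M.CC_approx[OF X] e3] .
  moreover have "\<forall>\<^sub>F k in sequentially. cmod (X k \<one> - c) < e / 3"
    using tendstoD[OF c e3] by (simp add: dist_norm)
  ultimately have "\<forall>\<^sub>F k in sequentially. nrm M.CC (M.cls (\<lambda>j. X k) \<ominus>\<^bsub>M.CC\<^esub> M.cls X) < e / 3 \<and> cmod (X k \<one> - c) < e / 3"
    by (rule eventually_conj)
  then obtain k where k: "nrm M.CC (M.cls (\<lambda>j. X k) \<ominus>\<^bsub>M.CC\<^esub> M.cls X) < e / 3" "cmod (X k \<one> - c) < e / 3"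
    by (auto simp: eventually_sequentially)
  obtain \<Phi> where \<Phi>: "avg \<Phi>" "max_norm T (\<Phi> (X k) \<ominus>\<^bsub>T\<^esub> X k \<one> \<odot>\<^bsub>T\<^esub> \<one>\<^bsub>T\<^esub>) < e / 3"
    by (rule averages_to_traceD[OF averages_to_trace[OF nr Xc] avg_id e3])
  have \<Phi>c: "\<Phi> (X j) \<in> carrier T" for j by (rule avg_closed[OF \<Phi>(1) Xc])
  let ?U = "M.cls (\<lambda>j. \<Phi> (X j))" and ?V = "M.cls (\<lambda>j. \<Phi> (X k))" and ?W = "M.cls (\<lambda>j. X k \<one> \<odot>\<^bsub>T\<^esub> \<one>\<^bsub>T\<^esub>)"
  have cs: "(\<lambda>j. \<Phi> (X j)) \<in> M.CS" "(\<lambda>j. \<Phi> (X k)) \<in> M.CS" "(\<lambda>j. X k) \<in> M.CS" "(\<lambda>j. X k \<one> \<odot>\<^bsub>T\<^esub> \<one>\<^bsub>T\<^esub>) \<in> M.CS"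
    using avg_CS[OF \<Phi>(1) X] M.CS_const[OF \<Phi>c] M.CS_const[OF Xc] M.CS_const[OF T.smult_closed[OF T.one_closed]] by auto
  have cl: "?U \<in> carrier M.CC" "?V \<in> carrier M.CC" "?W \<in> carrier M.CC" "c \<odot>\<^bsub>M.CC\<^esub> \<one>\<^bsub>M.CC\<^esub> \<in> carrier M.CC"
    using cs by (simp_all add: M.cls_in)
  have "nrm M.CC (?V \<ominus>\<^bsub>M.CC\<^esub> ?U) \<le> nrm M.CC (M.cls (\<lambda>j. X k) \<ominus>\<^bsub>M.CC\<^esub> M.cls X)"
  proof (rule tendsto_le[OF trivial_limit_sequentially])
    show "(\<lambda>j. max_norm T (\<Phi> (X k) \<ominus>\<^bsub>T\<^esub> \<Phi> (X j))) \<longlonglongrightarrow> nrm M.CC (?V \<ominus>\<^bsub>M.CC\<^esub> ?U)"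
      unfolding M.CC_diff[OF cs(2,1)] by (rule M.CC_nrm[OF M.CS_diff[OF cs(2,1)]])
    show "(\<lambda>j. max_norm T (X k \<ominus>\<^bsub>T\<^esub> X j)) \<longlonglongrightarrow> nrm M.CC (M.cls (\<lambda>j. X k) \<ominus>\<^bsub>M.CC\<^esub> M.cls X)"
      unfolding M.CC_diff[OF cs(3) X] by (rule M.CC_nrm[OF M.CS_diff[OF cs(3) X]])
    show "\<forall>\<^sub>F j in sequentially. max_norm T (\<Phi> (X k) \<ominus>\<^bsub>T\<^esub> \<Phi> (X j)) \<le> max_norm T (X k \<ominus>\<^bsub>T\<^esub> X j)"
      using max_norm_avg[OF \<Phi>(1) T.minus_closed[OF Xc Xc]]
      by (intro always_eventually allI) (simp only: avg_diff[OF \<Phi>(1) Xc Xc])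
  qed
  then have 1: "nrm M.CC (?U \<ominus>\<^bsub>M.CC\<^esub> ?V) < e / 3" using k(1) CC.p_diff_sym[OF cl(1,2)] by linarith
  have 2: "nrm M.CC (?V \<ominus>\<^bsub>M.CC\<^esub> ?W) < e / 3"
    using \<Phi>(2) M.nrm_diff_const[OF \<Phi>c T.smult_closed[OF T.one_closed]] by simp
  have W: "?W = X k \<one> \<odot>\<^bsub>M.CC\<^esub> \<one>\<^bsub>M.CC\<^esub>" by (simp add: M.CC_one M.CC_smult M.CS_const)
  have "nrm M.CC (?W \<ominus>\<^bsub>M.CC\<^esub> c \<odot>\<^bsub>M.CC\<^esub> \<one>\<^bsub>M.CC\<^esub>) = nrm M.CC ((X k \<one> - c) \<odot>\<^bsub>M.CC\<^esub> \<one>\<^bsub>M.CC\<^esub>)"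
    using CC.smult_l_distr[OF CC.one_closed, of "X k \<one>" "- c"] CC.smult_assoc1[OF CC.one_closed, of "-1" c]
    by (simp add: W CC.minus_eq CC.minus_smult)
  also have "\<dots> \<le> cmod (X k \<one> - c)"
    using max_norm_one_le M.nrm_const[OF T.one_closed] by (simp add: CC.p_smult M.CC_one mult_left_le M.CS_const)
  finally have 3: "nrm M.CC (?W \<ominus>\<^bsub>M.CC\<^esub> c \<odot>\<^bsub>M.CC\<^esub> \<one>\<^bsub>M.CC\<^esub>) < e / 3" using k(2) by linarith
  have "nrm M.CC (?U \<ominus>\<^bsub>M.CC\<^esub> c \<odot>\<^bsub>M.CC\<^esub> \<one>\<^bsub>M.CC\<^esub>) < e"
    using CC.p_diff_tri[OF cl(1,2,4)] CC.p_diff_tri[OF cl(2,3,4)] 1 2 3 by linarith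
  then show ?thesis by (rule that[OF \<Phi>(1)])
qed

theorem trivial_center_twisted_cstar:
  assumes nr: "\<And>z. z \<in> mult_center G \<Longrightarrow> z \<noteq> \<one> \<Longrightarrow> \<not> cocycle_regular G \<sigma> z"
  shows "trivial_center (twisted_cstar G \<sigma>)"
proof -
  have "\<exists>c. U = c \<odot>\<^bsub>M.CC\<^esub> \<one>\<^bsub>M.CC\<^esub>" if U: "U \<in> mult_center M.CC" for U
  proof -
    have Uc: "U \<in> carrier M.CC" using U by (simp add: mult_center_def)
    then obtain X where X: "X \<in> M.CS" "U = M.cls X" by (elim M.CC_cases)
    obtain c where c: "(\<lambda>k. X k \<one>) \<longlonglongrightarrow> c" using CS_trace_convergent[OF X(1)] by (auto simp: convergent_def)
    define V where "V = c \<odot>\<^bsub>M.CC\<^esub> \<one>\<^bsub>M.CC\<^esub>"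
    have V: "V \<in> carrier M.CC" by (simp add: V_def)
    have "nrm M.CC (U \<ominus>\<^bsub>M.CC\<^esub> V) \<le> e" if e: "e > 0" for e
    proof -
      obtain \<Phi> where \<Phi>: "avg \<Phi>" "nrm M.CC (M.cls (\<lambda>k. \<Phi> (X k)) \<ominus>\<^bsub>M.CC\<^esub> V) < e"
        unfolding V_def by (rule cls_avg_approx_trace[OF nr X(1) c e])
      then show ?thesis using cls_avg_center[OF X(1) U[unfolded X(2)] \<Phi>(1)] X(2) by simp
    qed
    then have "nrm M.CC (U \<ominus>\<^bsub>M.CC\<^esub> V) \<le> 0" by (rule field_le_epsilon[of _ 0, simplified])
    then have "U \<ominus>\<^bsub>M.CC\<^esub> V = \<zero>\<^bsub>M.CC\<^esub>"
      using CC.p_nonneg[of "U \<ominus>\<^bsub>M.CC\<^esub> V"] Uc V by (intro CC.nrm_zero_imp) auto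
    then have "U = V" by (rule CC.eq_of_minus_eq_zero[OF Uc V])
    then show ?thesis by (auto simp: V_def)
  qed
  moreover have "c \<odot>\<^bsub>M.CC\<^esub> \<one>\<^bsub>M.CC\<^esub> \<in> mult_center M.CC" for c
    by (auto simp: mult_center_def CC.smult_mult_l CC.smult_mult_r)
  ultimately show ?thesis unfolding trivial_center_def twisted_cstar_def by blast
qed

theorem simple_twisted_cstar:
  assumes nr: "\<And>z. z \<in> mult_center G \<Longrightarrow> z \<noteq> \<one> \<Longrightarrow> \<not> cocycle_regular G \<sigma> z"
  shows "simple_cstar (twisted_cstar G \<sigma>)"
proof -
  have "carrier M.CC \<noteq> {\<zero>\<^bsub>M.CC\<^esub>}" using CC_one_nonzero CC.one_closed by blast
  moreover have "I = carrier M.CC" if I: "ideal I M.CC" "closed_in M.CC I" "I \<noteq> {\<zero>\<^bsub>M.CC\<^esub>}" for I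
  proof -
    interpret I: ideal I M.CC by (rule I(1))
    obtain U where U: "U \<in> I" "U \<noteq> \<zero>\<^bsub>M.CC\<^esub>" using I(3) I.zero_closed by blast
    have Uc: "U \<in> carrier M.CC" using U(1) I.a_subset by blast
    then obtain X where X: "X \<in> M.CS" "U = M.cls X" by (elim M.CC_cases)
    define Y where "Y k = star T (X k) \<otimes>\<^bsub>T\<^esub> X k" for k
    have Y: "Y \<in> M.CS" unfolding Y_def using X by (intro M.CS_mult M.CS_star)
    have "M.cls Y = star M.CC U \<otimes>\<^bsub>M.CC\<^esub> U"
      unfolding Y_def X(2) using X(1) by (simp add: M.CC_star M.CC_mult M.CS_star)
    then have YI: "M.cls Y \<in> I" using U(1) Uc by (simp add: I.I_l_closed)
    obtain c where c: "(\<lambda>k. Y k \<one>) \<longlonglongrightarrow> c" using CS_trace_convergent[OF Y] by (auto simp: convergent_def)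
    have Yt: "Y k \<one> = of_real ((l2 (X k))\<^sup>2)" for k
      using ip_self[OF M.CS_carrier[OF X(1)]] by (simp add: Y_def ip_def)
    \<comment> \<open>\<open>c\<close> is the limit of the squared 2-norms of \<open>X k\<close>. If
      it were 0, faithfulness in the form \<open>max_norm_null_of_l2_null\<close> would give
      \<open>U\<close> norm 0.\<close>
    have c0: "c \<noteq> 0"
    proof
      assume "c = 0"
      then have "(\<lambda>k. cmod (Y k \<one>)) \<longlonglongrightarrow> 0" using tendsto_norm[OF c] by simp
      then have "(\<lambda>k. sqrt ((l2 (X k))\<^sup>2)) \<longlonglongrightarrow> sqrt 0" unfolding Yt norm_of_real by (intro tendsto_real_sqrt) simp
      then have "(\<lambda>k. max_norm T (X k)) \<longlonglongrightarrow> 0" by (intro max_norm_null_of_l2_null[OF X(1)]) simp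
      then have "nrm M.CC U = 0" using M.CC_nrm[OF X(1)] X(2) LIMSEQ_unique by blast
      then show False using U(2) CC.nrm_zero_imp[OF Uc] by simp
    qed
    have "\<exists>V\<in>I. nrm M.CC (V \<ominus>\<^bsub>M.CC\<^esub> c \<odot>\<^bsub>M.CC\<^esub> \<one>\<^bsub>M.CC\<^esub>) < 1 / real (Suc m)" for m
    proof -
      have m: "1 / real (Suc m) > 0" by simp
      obtain \<Phi> where \<Phi>: "avg \<Phi>" "nrm M.CC (M.cls (\<lambda>k. \<Phi> (Y k)) \<ominus>\<^bsub>M.CC\<^esub> c \<odot>\<^bsub>M.CC\<^esub> \<one>\<^bsub>M.CC\<^esub>) < 1 / real (Suc m)"
        by (rule cls_avg_approx_trace[OF nr Y c m])
      show ?thesis by (rule bexI, rule \<Phi>(2), rule cls_avg_ideal[OF I(1) Y YI \<Phi>(1)])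
    qed
    then obtain V where V: "\<And>m. V m \<in> I" "\<And>m. nrm M.CC (V m \<ominus>\<^bsub>M.CC\<^esub> c \<odot>\<^bsub>M.CC\<^esub> \<one>\<^bsub>M.CC\<^esub>) < 1 / real (Suc m)" by metis
    have lim: "(\<lambda>m. 1 / real (Suc m)) \<longlonglongrightarrow> 0" using LIMSEQ_inverse_real_of_nat by (simp add: inverse_eq_divide)
    have "(\<lambda>m. nrm M.CC (V m \<ominus>\<^bsub>M.CC\<^esub> c \<odot>\<^bsub>M.CC\<^esub> \<one>\<^bsub>M.CC\<^esub>)) \<longlonglongrightarrow> 0"
    proof (rule CC.null_dominated[OF lim])
      show "V m \<ominus>\<^bsub>M.CC\<^esub> c \<odot>\<^bsub>M.CC\<^esub> \<one>\<^bsub>M.CC\<^esub> \<in> carrier M.CC" for m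
        using V(1)[of m] I.a_subset by (intro CC.minus_closed CC.smult_closed CC.one_closed) blast
    qed (use V(2) in \<open>blast intro: less_imp_le\<close>)
    then have cI: "c \<odot>\<^bsub>M.CC\<^esub> \<one>\<^bsub>M.CC\<^esub> \<in> I"
      using I(2)[unfolded closed_in_def, rule_format, of V "c \<odot>\<^bsub>M.CC\<^esub> \<one>\<^bsub>M.CC\<^esub>"] V(1) by simp
    have "(inverse c \<odot>\<^bsub>M.CC\<^esub> \<one>\<^bsub>M.CC\<^esub>) \<otimes>\<^bsub>M.CC\<^esub> (c \<odot>\<^bsub>M.CC\<^esub> \<one>\<^bsub>M.CC\<^esub>) \<in> I"
      by (intro I.I_l_closed cI CC.smult_closed CC.one_closed)
    moreover have "(inverse c \<odot>\<^bsub>M.CC\<^esub> \<one>\<^bsub>M.CC\<^esub>) \<otimes>\<^bsub>M.CC\<^esub> (c \<odot>\<^bsub>M.CC\<^esub> \<one>\<^bsub>M.CC\<^esub>) = \<one>\<^bsub>M.CC\<^esub>"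
      using CC.smult_assoc1[OF CC.one_closed, of "inverse c" c] c0 by (simp add: CC.smult_mult_l)
    ultimately have "\<one>\<^bsub>M.CC\<^esub> \<in> I" by simp
    then show ?thesis by (rule I.one_imp_carrier)
  qed
  ultimately show ?thesis unfolding simple_cstar_def twisted_cstar_def by blast
qed

end

section \<open>Central regular elements of infinite order\<close>

context twisted_group
begin

interpretation T: star_alg T by (rule T_star_alg)
interpretation M: seminormed_star_alg T "max_norm T"
  by (intro seminormed_star_alg.intro seminormed_star_alg_axioms.intro T_star_alg max_norm_cstar)
interpretation CC: cstar_alg M.CC by (rule M.CC_cstar_alg)
interpretation CC: seminormed_star_alg M.CC "nrm M.CC"
  by (intro seminormed_star_alg.intro seminormed_star_alg_axioms.intro M.CC_star_alg M.CC_cstar_seminorm)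

text \<open>Every \<open>s\<close> commutes with a central \<open>r\<close>, so regularity gives
  \<open>\<sigma> r s = \<sigma> s r\<close> for all \<open>s\<close>.\<close>

lemma delta_central:
  assumes r: "r \<in> mult_center G" "cocycle_regular G \<sigma> r"
  shows "f \<in> carrier T \<Longrightarrow> delta r \<otimes>\<^bsub>T\<^esub> f = f \<otimes>\<^bsub>T\<^esub> delta r"
proof (induction f rule: T_induct)
  case (delta c s)
  have rG: "r \<in> carrier G" and rs: "r \<otimes> s = s \<otimes> r" using r(1) delta by (auto simp: mult_center_def)
  have "\<sigma> r s = \<sigma> s r" using r(2) delta rs by (simp add: cocycle_regular_def)
  then show ?case using rG delta rs by (simp add: T_smult_mult T_delta_mult)
qed (use r(1) in \<open>simp_all add: T_bilin mult_center_def\<close>)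

lemma iota_central:
  assumes r: "r \<in> mult_center G" "cocycle_regular G \<sigma> r"
  shows "\<iota> r \<in> mult_center M.CC"
proof -
  have rG: "r \<in> carrier G" using r(1) by (simp add: mult_center_def)
  have "\<iota> r \<otimes>\<^bsub>M.CC\<^esub> U = U \<otimes>\<^bsub>M.CC\<^esub> \<iota> r" if U: "U \<in> carrier M.CC" for U
  proof -
    obtain X where X: "X \<in> M.CS" "U = M.cls X" using U by (elim M.CC_cases)
    have "(\<lambda>k. delta r \<otimes>\<^bsub>T\<^esub> X k) = (\<lambda>k. X k \<otimes>\<^bsub>T\<^esub> delta r)"
      using delta_central[OF r M.CS_carrier[OF X(1)]] by simp
    then show ?thesis using X rG by (simp add: twisted_unitary_def M.CC_mult M.CS_const)
  qed
  then show ?thesis using iota_closed[OF rG] by (simp add: mult_center_def)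
qed

text \<open>The difference would have norm 0, but its coefficient at \<open>r\<close> is 1.\<close>

lemma iota_not_scalar:
  assumes r: "r \<in> carrier G" "r \<noteq> \<one>"
  shows "\<iota> r \<noteq> c \<odot>\<^bsub>M.CC\<^esub> \<one>\<^bsub>M.CC\<^esub>"
proof
  assume a: "\<iota> r = c \<odot>\<^bsub>M.CC\<^esub> \<one>\<^bsub>M.CC\<^esub>"
  have c: "delta r \<in> carrier T" "c \<odot>\<^bsub>T\<^esub> \<one>\<^bsub>T\<^esub> \<in> carrier T" using r by auto
  have "M.cls (\<lambda>k. delta r) = M.cls (\<lambda>k. c \<odot>\<^bsub>T\<^esub> \<one>\<^bsub>T\<^esub>)"
    using a by (simp add: twisted_unitary_def M.CC_one M.CC_smult M.CS_const)
  then have "(\<lambda>k::nat. max_norm T (delta r \<ominus>\<^bsub>T\<^esub> c \<odot>\<^bsub>T\<^esub> \<one>\<^bsub>T\<^esub>)) \<longlonglongrightarrow> 0"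
    using M.cls_eq_iff[OF M.CS_const[OF c(1)] M.CS_const[OF c(2)]] by blast
  then have "max_norm T (delta r \<ominus>\<^bsub>T\<^esub> c \<odot>\<^bsub>T\<^esub> \<one>\<^bsub>T\<^esub>) = 0" by (simp add: LIMSEQ_const_iff)
  moreover have "(delta r \<ominus>\<^bsub>T\<^esub> c \<odot>\<^bsub>T\<^esub> \<one>\<^bsub>T\<^esub>) r = 1"
    unfolding T.minus_eq T.minus_smult[OF c(2)] using r by (simp add: T_ops delta_def)
  ultimately show False using cmod_apply_le[OF T.minus_closed[OF c] r(1)] by simp
qed

text \<open>The cocycle leaves a phase; only its modulus matters below.\<close>

lemma delta_pow:
  assumes r: "r \<in> carrier G"
  shows "\<exists>p. cmod p = 1 \<and> delta r [^]\<^bsub>T\<^esub> (j::nat) = p \<odot>\<^bsub>T\<^esub> delta (r [^] j)"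
proof (induction j)
  case 0
  show ?case by (intro exI[of _ 1]) (simp add: T_smult_one T_ops(4))
next
  case (Suc j)
  then obtain p where p: "cmod p = 1" "delta r [^]\<^bsub>T\<^esub> j = p \<odot>\<^bsub>T\<^esub> delta (r [^] j)" by blast
  have "delta r [^]\<^bsub>T\<^esub> Suc j = (p * \<sigma> (r [^] j) r) \<odot>\<^bsub>T\<^esub> delta (r [^] Suc j)"
    using r by (simp add: p T_smult_mult T_delta_mult T_smult_smult)
  then show ?case using p(1) r by (intro exI[of _ "p * \<sigma> (r [^] j) r"]) (simp add: norm_mult sigma_norm)
qed

text \<open>A geometric sum of powers taken in \<open>T\<close>, phases included, so that
  multiplication by \<open>delta r\<close> minus 1 telescopes exactly.\<close>

fun pow_sum :: "'g \<Rightarrow> nat \<Rightarrow> 'g \<Rightarrow> complex" where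
  "pow_sum r 0 = \<zero>\<^bsub>T\<^esub>"
| "pow_sum r (Suc L) = pow_sum r L \<oplus>\<^bsub>T\<^esub> delta r [^]\<^bsub>T\<^esub> L"

lemma pow_sum_closed: "r \<in> carrier G \<Longrightarrow> pow_sum r L \<in> carrier T"
  by (induction L) auto

lemma pow_sum_telescope:
  assumes r: "r \<in> carrier G"
  shows "(delta r \<ominus>\<^bsub>T\<^esub> \<one>\<^bsub>T\<^esub>) \<otimes>\<^bsub>T\<^esub> pow_sum r L = delta r [^]\<^bsub>T\<^esub> L \<ominus>\<^bsub>T\<^esub> \<one>\<^bsub>T\<^esub>"
proof (induction L)
  case 0
  show ?case using r by (simp add: T.minus_eq T.r_neg)
next
  case (Suc L)
  define u where "u = delta r"
  define v where "v = delta r [^]\<^bsub>T\<^esub> L"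
  have u: "u \<in> carrier T" and v: "v \<in> carrier T" using r by (auto simp: u_def v_def)
  have uv: "delta r [^]\<^bsub>T\<^esub> Suc L = u \<otimes>\<^bsub>T\<^esub> v" unfolding u_def v_def using r by (intro T.nat_pow_Suc2) auto
  have "(u \<ominus>\<^bsub>T\<^esub> \<one>\<^bsub>T\<^esub>) \<otimes>\<^bsub>T\<^esub> pow_sum r (Suc L) = (v \<ominus>\<^bsub>T\<^esub> \<one>\<^bsub>T\<^esub>) \<oplus>\<^bsub>T\<^esub> (u \<ominus>\<^bsub>T\<^esub> \<one>\<^bsub>T\<^esub>) \<otimes>\<^bsub>T\<^esub> v"
    using Suc u v pow_sum_closed[OF r, of L] by (simp add: T.r_distr v_def flip: u_def)
  also have "\<dots> = u \<otimes>\<^bsub>T\<^esub> v \<ominus>\<^bsub>T\<^esub> \<one>\<^bsub>T\<^esub>" using u v by algebra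
  finally show ?case by (simp only: uv u_def)
qed

text \<open>The powers of \<open>r\<close> are distinct, so the summands are orthonormal.\<close>

lemma l2_pow_sum:
  assumes r: "r \<in> carrier G" and inf: "\<And>j. 0 < j \<Longrightarrow> r [^] (j::nat) \<noteq> \<one>"
  shows "(l2 (pow_sum r L))\<^sup>2 = real L"
proof -
  have inj: "r [^] i \<noteq> r [^] j" if "i < j" for i j :: nat
  proof
    assume a: "r [^] i = r [^] j"
    have "r [^] i \<otimes> r [^] (j - i) = r [^] j" using r that nat_pow_mult[of r i "j - i"] by simp
    then have "r [^] (j - i) = \<one>" using a r l_cancel_one[of "r [^] i" "r [^] (j - i)"] by simp
    then show False using inf[of "j - i"] that by simp
  qed
  \<comment> \<open>The first conjunct says that later powers of \<open>r\<close> are not yet in the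
    support, which makes the next summand orthogonal.\<close>
  have "(\<forall>j\<ge>L. pow_sum r L (r [^] j) = 0) \<and> (l2 (pow_sum r L))\<^sup>2 = real L"
  proof (induction L)
    case 0
    show ?case by (auto simp: l2_def L2_set_def T_ops)
  next
    case (Suc L)
    obtain p where p: "cmod p = 1" "delta r [^]\<^bsub>T\<^esub> L = p \<odot>\<^bsub>T\<^esub> delta (r [^] L)" using delta_pow[OF r] by blast
    let ?f = "pow_sum r L" and ?d = "delta (r [^] L)"
    have f: "?f \<in> carrier T" and d: "?d \<in> carrier T" using pow_sum_closed[OF r] r by auto
    have df: "ip ?d ?f = 0" using Suc ip_delta[OF f, of "r [^] L"] r by simp
    have fd: "ip ?f ?d = 0"
    proof -
      have "ip ?f ?d = (\<Sum>t | ?f t \<noteq> 0. cnj (?f t) * ?d t)" by (rule ip_sum[OF f d T_finite[OF f] subset_refl])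
      also have "\<dots> = 0" using Suc by (intro sum.neutral) (auto simp: delta_def)
      finally show ?thesis .
    qed
    have "ip (?f \<oplus>\<^bsub>T\<^esub> p \<odot>\<^bsub>T\<^esub> ?d) (?f \<oplus>\<^bsub>T\<^esub> p \<odot>\<^bsub>T\<^esub> ?d) = ip ?f ?f + (p * cnj p) * ip ?d ?d"
      using f d df fd by (simp add: ip_add_left ip_add_right ip_smult_left ip_smult_right T_closed)
    also have "\<dots> = of_real (real (Suc L))"
      using Suc ip_self[OF f] ip_self[OF d] complex_norm_square[of p] p(1) by simp
    finally have "(l2 (pow_sum r (Suc L)))\<^sup>2 = real (Suc L)"
      using ip_self[OF T_add_closed[OF f T_smult_closed[OF d]]] unfolding pow_sum.simps p(2) by (metis of_real_eq_iff)
    moreover have "pow_sum r (Suc L) (r [^] j) = 0" if j: "j \<ge> Suc L" for j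
      using Suc j inj[of L j] unfolding pow_sum.simps p(2) by (auto simp: T_ops delta_def)
    ultimately show ?case by blast
  qed
  then show ?thesis by blast
qed

text \<open>With \<open>u = delta r\<close>, \<open>x = pow_sum r L\<close> and \<open>h\<close> the
  element in the norm, \<open>x = h x + f (u - 1) x\<close>, where \<open>u - 1\<close> was moved
  past \<open>f\<close> by centrality. Here \<open>x\<close> has 2-norm \<open>sqrt L\<close>, while
  that of \<open>(u - 1) x = u^L - 1\<close> is at most 2. A norm \<open>q < 1\<close> of
  \<open>h\<close> would thus bound \<open>(1 - q) * sqrt L\<close> independently of
  \<open>L\<close>.\<close>

lemma delta_minus_one_not_invertible:
  assumes r: "r \<in> mult_center G" "cocycle_regular G \<sigma> r" and inf: "\<And>j. 0 < j \<Longrightarrow> r [^] (j::nat) \<noteq> \<one>"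
    and f: "f \<in> carrier T"
  shows "1 \<le> max_norm T (\<one>\<^bsub>T\<^esub> \<ominus>\<^bsub>T\<^esub> (delta r \<ominus>\<^bsub>T\<^esub> \<one>\<^bsub>T\<^esub>) \<otimes>\<^bsub>T\<^esub> f)"
proof (rule ccontr)
  assume n: "\<not> ?thesis"
  define q where "q = max_norm T (\<one>\<^bsub>T\<^esub> \<ominus>\<^bsub>T\<^esub> (delta r \<ominus>\<^bsub>T\<^esub> \<one>\<^bsub>T\<^esub>) \<otimes>\<^bsub>T\<^esub> f)"
  have q: "q < 1" using n unfolding q_def by simp
  have rG: "r \<in> carrier G" using r(1) by (simp add: mult_center_def)
  define u where "u = delta r"
  have u: "u \<in> carrier T" using rG by (simp add: u_def)
  have uf: "u \<otimes>\<^bsub>T\<^esub> f = f \<otimes>\<^bsub>T\<^esub> u" unfolding u_def by (rule delta_central[OF r f])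
  obtain B where B: "B \<ge> 0" "\<And>g. g \<in> carrier T \<Longrightarrow> l2 (f \<otimes>\<^bsub>T\<^esub> g) \<le> B * l2 g"
    using l2_mult_bounded_left[OF f] by blast
  have ineq: "sqrt (real L) \<le> q * sqrt (real L) + B * 2" for L
  proof -
    define x where "x = pow_sum r L"
    define v where "v = u [^]\<^bsub>T\<^esub> L"
    have x: "x \<in> carrier T" and v: "v \<in> carrier T" using pow_sum_closed[OF rG] u by (auto simp: x_def v_def)
    have lx: "l2 x = sqrt (real L)" using l2_pow_sum[OF rG inf, of L] unfolding x_def by (metis l2_nonneg real_sqrt_unique)
    obtain p where p: "cmod p = 1" "v = p \<odot>\<^bsub>T\<^esub> delta (r [^] L)" using delta_pow[OF rG] unfolding v_def u_def by blast
    have lv: "l2 v = 1" using p rG by (simp add: l2_smult)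
    have tel: "(u \<ominus>\<^bsub>T\<^esub> \<one>\<^bsub>T\<^esub>) \<otimes>\<^bsub>T\<^esub> x = v \<ominus>\<^bsub>T\<^esub> \<one>\<^bsub>T\<^esub>" unfolding u_def x_def v_def by (rule pow_sum_telescope[OF rG])
    have w: "(u \<ominus>\<^bsub>T\<^esub> \<one>\<^bsub>T\<^esub>) \<otimes>\<^bsub>T\<^esub> f = f \<otimes>\<^bsub>T\<^esub> (u \<ominus>\<^bsub>T\<^esub> \<one>\<^bsub>T\<^esub>)"
      using u f by (simp add: T.minus_eq T.l_distr T.r_distr T.l_minus T.r_minus uf)
    let ?h = "\<one>\<^bsub>T\<^esub> \<ominus>\<^bsub>T\<^esub> (u \<ominus>\<^bsub>T\<^esub> \<one>\<^bsub>T\<^esub>) \<otimes>\<^bsub>T\<^esub> f"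
    have h: "?h \<in> carrier T" using u f by simp
    have "x = ?h \<otimes>\<^bsub>T\<^esub> x \<oplus>\<^bsub>T\<^esub> ((u \<ominus>\<^bsub>T\<^esub> \<one>\<^bsub>T\<^esub>) \<otimes>\<^bsub>T\<^esub> f) \<otimes>\<^bsub>T\<^esub> x" using u f x by algebra
    also have "((u \<ominus>\<^bsub>T\<^esub> \<one>\<^bsub>T\<^esub>) \<otimes>\<^bsub>T\<^esub> f) \<otimes>\<^bsub>T\<^esub> x = f \<otimes>\<^bsub>T\<^esub> (v \<ominus>\<^bsub>T\<^esub> \<one>\<^bsub>T\<^esub>)"
      unfolding w using u f x by (simp add: T.m_assoc tel)
    finally have "l2 x \<le> l2 (?h \<otimes>\<^bsub>T\<^esub> x) + l2 (f \<otimes>\<^bsub>T\<^esub> (v \<ominus>\<^bsub>T\<^esub> \<one>\<^bsub>T\<^esub>))"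
      using l2_add[of "?h \<otimes>\<^bsub>T\<^esub> x" "f \<otimes>\<^bsub>T\<^esub> (v \<ominus>\<^bsub>T\<^esub> \<one>\<^bsub>T\<^esub>)"] h x f v by simp
    also have "l2 (?h \<otimes>\<^bsub>T\<^esub> x) \<le> q * l2 x" using l2_mult_max_norm[OF h x] by (simp add: q_def u_def)
    also have "l2 (f \<otimes>\<^bsub>T\<^esub> (v \<ominus>\<^bsub>T\<^esub> \<one>\<^bsub>T\<^esub>)) \<le> B * l2 (v \<ominus>\<^bsub>T\<^esub> \<one>\<^bsub>T\<^esub>)" using B(2)[of "v \<ominus>\<^bsub>T\<^esub> \<one>\<^bsub>T\<^esub>"] v by simp
    also have "l2 (v \<ominus>\<^bsub>T\<^esub> \<one>\<^bsub>T\<^esub>) \<le> 2"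
      using l2_add[OF v T.smult_closed[OF T.one_closed], of "-1"] l2_smult[OF T.one_closed, of "-1"] lv
      by (simp add: T.minus_eq T.minus_smult) (simp add: T_ops(4))
    finally show ?thesis using B(1) by (simp add: lx mult_left_mono)
  qed
  \<comment> \<open>Chosen so that \<open>(1 - q) * sqrt L\<close> is at least
    \<open>2 * B + 1\<close>, while \<open>ineq\<close> allows at most \<open>2 * B\<close>.\<close>
  obtain L :: nat where L: "((B * 2 + 1) / (1 - q))\<^sup>2 \<le> real L" using real_arch_simple by blast
  have "(B * 2 + 1) / (1 - q) \<le> sqrt (real L)" using L by (rule real_le_rsqrt)
  then have "B * 2 + 1 \<le> sqrt (real L) * (1 - q)" using q by (simp add: divide_le_eq)
  then show False using ineq[of L] by (simp add: algebra_simps)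
qed

theorem not_simple_and_center_of_central_regular:
  assumes r: "r \<in> mult_center G" "cocycle_regular G \<sigma> r" and inf: "\<And>j. 0 < j \<Longrightarrow> r [^] (j::nat) \<noteq> \<one>"
  shows "\<not> trivial_center (twisted_cstar G \<sigma>)" "\<not> simple_cstar (twisted_cstar G \<sigma>)"
proof -
  have rG: "r \<in> carrier G" and r1: "r \<noteq> \<one>" using r(1) inf[of 1] by (auto simp: mult_center_def)
  note central = iota_central[OF r]
  show "\<not> trivial_center (twisted_cstar G \<sigma>)"
    using central iota_not_scalar[OF rG r1] unfolding trivial_center_def twisted_cstar_def by blast
  define w where "w = \<iota> r \<ominus>\<^bsub>M.CC\<^esub> \<one>\<^bsub>M.CC\<^esub>"
  have i: "\<iota> r \<in> carrier M.CC" by (rule iota_closed[OF rG])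
  have w: "w \<in> mult_center M.CC"
    using central i by (auto simp: w_def mult_center_def CC.minus_eq CC.l_distr CC.r_distr CC.l_minus CC.r_minus)
  let ?J = "{x \<in> carrier M.CC. \<forall>e>0. \<exists>y\<in>carrier M.CC. nrm M.CC (x \<ominus>\<^bsub>M.CC\<^esub> w \<otimes>\<^bsub>M.CC\<^esub> y) < e}"
  note J = CC.central_ideal_closure[OF w]
  have w0: "w \<noteq> \<zero>\<^bsub>M.CC\<^esub>"
  proof
    assume "w = \<zero>\<^bsub>M.CC\<^esub>"
    then have "\<iota> r = 1 \<odot>\<^bsub>M.CC\<^esub> \<one>\<^bsub>M.CC\<^esub>" unfolding w_def using CC.eq_of_minus_eq_zero[OF i CC.one_closed] by simp
    then show False using iota_not_scalar[OF rG r1] by blast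
  qed
  have "\<one>\<^bsub>M.CC\<^esub> \<notin> ?J"
  proof
    assume "\<one>\<^bsub>M.CC\<^esub> \<in> ?J"
    then obtain V where V: "V \<in> carrier M.CC" "nrm M.CC (\<one>\<^bsub>M.CC\<^esub> \<ominus>\<^bsub>M.CC\<^esub> w \<otimes>\<^bsub>M.CC\<^esub> V) < 1"
      using zero_less_one by blast
    obtain Y where Y: "Y \<in> M.CS" "V = M.cls Y" using V(1) by (elim M.CC_cases)
    \<comment> \<open>A sequence in \<open>T\<close> representing the difference of 1 and
      \<open>w V\<close>. Each term has norm at least 1, hence so has the limit.\<close>
    let ?Z = "\<lambda>k. \<one>\<^bsub>T\<^esub> \<ominus>\<^bsub>T\<^esub> (delta r \<ominus>\<^bsub>T\<^esub> \<one>\<^bsub>T\<^esub>) \<otimes>\<^bsub>T\<^esub> Y k"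
    have Z: "?Z \<in> M.CS" using Y rG by (intro M.CS_diff M.CS_mult M.CS_const) auto
    have "\<one>\<^bsub>M.CC\<^esub> \<ominus>\<^bsub>M.CC\<^esub> w \<otimes>\<^bsub>M.CC\<^esub> V = M.cls ?Z"
      unfolding w_def Y(2) twisted_unitary_def using Y(1) rG
      by (simp add: M.CC_one M.CC_diff M.CC_mult M.CS_const M.CS_mult M.CS_diff)
    then have "(\<lambda>k. max_norm T (?Z k)) \<longlonglongrightarrow> nrm M.CC (\<one>\<^bsub>M.CC\<^esub> \<ominus>\<^bsub>M.CC\<^esub> w \<otimes>\<^bsub>M.CC\<^esub> V)" using M.CC_nrm[OF Z] by simp
    then have "1 \<le> nrm M.CC (\<one>\<^bsub>M.CC\<^esub> \<ominus>\<^bsub>M.CC\<^esub> w \<otimes>\<^bsub>M.CC\<^esub> V)"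
      using delta_minus_one_not_invertible[OF r inf M.CS_carrier[OF Y(1)]]
      by (intro tendsto_lowerbound[OF _ always_eventually]) auto
    then show False using V(2) by simp
  qed
  then have "?J \<noteq> carrier M.CC" using CC.one_closed by blast
  moreover have "?J \<noteq> {\<zero>\<^bsub>M.CC\<^esub>}" using J(3) w0 by blast
  ultimately show "\<not> simple_cstar (twisted_cstar G \<sigma>)"
    using J(1,2) unfolding simple_cstar_def twisted_cstar_def by blast
qed

end

section \<open>The free nilpotent group\<close>

text \<open>The central coordinates have weight two: with the quadratic bound, the product term of
  size at most \<open>i * j\<close> is absorbed by \<open>(i + j)^2\<close>, so radii add under
  multiplication.\<close>

definition nil2_ball :: "nat \<Rightarrow> nat \<Rightarrow> nil2 set" where
  "nil2_ball n m = {(a, b) \<in> carrier (free_nil2 n). (\<forall>i. \<bar>a i\<bar> \<le> int m) \<and> (\<forall>j k. \<bar>b j k\<bar> \<le> int m ^ 2)}"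

lemma nil2_ball_mult:
  assumes r: "r \<in> nil2_ball n i" and s: "s \<in> nil2_ball n j"
  shows "r \<otimes>\<^bsub>free_nil2 n\<^esub> s \<in> nil2_ball n (i + j)"
proof -
  obtain a b c d where e: "r = (a, b)" "s = (c, d)" by (metis surj_pair)
  have A: "\<bar>a k\<bar> \<le> int i" "\<bar>c k\<bar> \<le> int j" "\<bar>b k l\<bar> \<le> int i ^ 2" "\<bar>d k l\<bar> \<le> int j ^ 2" for k l
    using r s by (auto simp: e nil2_ball_def)
  have "\<bar>b k l + d k l + a k * c l\<bar> \<le> (int i + int j) ^ 2" for k l
  proof -
    have "\<bar>a k * c l\<bar> \<le> int i * int j" unfolding abs_mult using A by (intro mult_mono) auto
    then have "\<bar>b k l + d k l + a k * c l\<bar> \<le> int i ^ 2 + int j ^ 2 + int i * int j"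
      using A(3,4)[of k l] by linarith
    also have "\<dots> \<le> (int i + int j) ^ 2" by (simp add: power2_eq_square algebra_simps)
    finally show ?thesis .
  qed
  moreover have "\<bar>a k + c k\<bar> \<le> int i + int j" for k using A(1,2)[of k] by linarith
  moreover have "r \<otimes>\<^bsub>free_nil2 n\<^esub> s \<in> carrier (free_nil2 n)"
    using r s by (intro monoid.m_closed group.is_monoid group_free_nil2) (auto simp: nil2_ball_def)
  ultimately show ?thesis by (auto simp: e nil2_ball_def free_nil2_def)
qed

text \<open>Injection into a box with \<open>n\<close> sides of \<open>2 * m + 1\<close> points and,
  counting all pairs, \<open>n * n\<close> sides of \<open>2 * m^2 + 1\<close> points. Bounding the
  sides by \<open>3 * (m + 1)\<close> and \<open>3 * (m + 1)^2\<close> gives the constant and the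
  degree.\<close>

lemma nil2_ball_card:
  "finite (nil2_ball n m)" "real (card (nil2_ball n m)) \<le> 3 ^ (n + n * n) * real (m + 1) ^ (n + 2 * n * n)"
proof -
  let ?I = "{1..n}"
  let ?P = "(\<Pi>\<^sub>E i\<in>?I. {- int m..int m}) \<times> (\<Pi>\<^sub>E p\<in>?I \<times> ?I. {- (int m ^ 2)..int m ^ 2})"
  let ?f = "\<lambda>(a, b). (restrict a ?I, restrict (\<lambda>(j, k). b j k) (?I \<times> ?I))"
  have inj: "inj_on ?f (nil2_ball n m)"
  proof (rule inj_onI, clarify)
    fix a b c d
    assume A: "(a, b) \<in> nil2_ball n m" "(c, d) \<in> nil2_ball n m"
      and e1: "restrict a ?I = restrict c ?I"
      and e2: "restrict (\<lambda>(j, k). b j k) (?I \<times> ?I) = restrict (\<lambda>(j, k). d j k) (?I \<times> ?I)"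
    have "a i = c i" for i
      using fun_cong[OF e1, of i] A by (cases "i \<in> ?I") (auto simp: nil2_ball_def free_nil2_def)
    moreover have "b j k = d j k" for j k
      using fun_cong[OF e2, of "(j, k)"] A by (cases "(j, k) \<in> ?I \<times> ?I") (auto simp: nil2_ball_def free_nil2_def)
    ultimately show "a = c \<and> b = d" by blast
  qed
  have sub: "?f ` nil2_ball n m \<subseteq> ?P"
    by (auto simp: nil2_ball_def abs_le_iff minus_le_iff split: if_splits)
  have fin: "finite ?P" by (intro finite_cartesian_product finite_PiE) auto
  show "finite (nil2_ball n m)" using inj_on_finite[OF inj sub fin] .
  have "card (nil2_ball n m) \<le> card ?P" using card_inj_on_le[OF inj sub fin] .
  also have "card ?P = (2 * m + 1) ^ n * (2 * m ^ 2 + 1) ^ (n * n)"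
    by (simp add: card_cartesian_product card_PiE nat_add_distrib nat_mult_distrib nat_power_eq)
  finally have "real (card (nil2_ball n m)) \<le> real ((2 * m + 1) ^ n * (2 * m ^ 2 + 1) ^ (n * n))"
    by (rule of_nat_mono)
  also have "\<dots> = (2 * real m + 1) ^ n * (2 * real m ^ 2 + 1) ^ (n * n)" by (simp add: add.commute)
  also have "\<dots> \<le> (3 * (real m + 1)) ^ n * (3 * (real m + 1) ^ 2) ^ (n * n)"
    by (intro mult_mono power_mono) (auto simp: power2_eq_square algebra_simps)
  also have "\<dots> = 3 ^ (n + n * n) * real (m + 1) ^ (n + 2 * n * n)"
  proof -
    have "(3 * x) ^ n * (3 * x ^ 2) ^ (n * n) = 3 ^ (n + n * n) * x ^ (n + 2 * n * n)" for x :: real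
      by (simp add: power_mult_distrib power_add mult_ac flip: power_mult)
    from this[of "real m + 1"] show ?thesis by (simp add: add.commute)
  qed
  finally show "real (card (nil2_ball n m)) \<le> 3 ^ (n + n * n) * real (m + 1) ^ (n + 2 * n * n)" .
qed

lemma nil2_ball_exhaust:
  assumes "finite F" "F \<subseteq> carrier (free_nil2 n)" shows "\<exists>m. F \<subseteq> nil2_ball n m"
  using assms
proof (induction F rule: finite_induct)
  case (insert r F)
  then obtain m where m: "F \<subseteq> nil2_ball n m" by auto
  obtain a b where e: "r = (a, b)" by fastforce
  have r: "\<And>i. i \<notin> {1..n} \<Longrightarrow> a i = 0" "\<And>j k. (j, k) \<notin> {1..n} \<times> {1..n} \<Longrightarrow> b j k = 0"
    using insert by (auto simp: e free_nil2_def)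
  \<comment> \<open>Summing absolute values dominates every coordinate at once; as
    \<open>M \<le> M^2\<close> for natural numbers, the quadratic bound on \<open>b\<close> follows
    too.\<close>
  define M where "M = m + (\<Sum>i\<in>{1..n}. nat \<bar>a i\<bar>) + (\<Sum>(j, k)\<in>{1..n} \<times> {1..n}. nat \<bar>b j k\<bar>)"
  have mM: "m \<le> M" by (simp add: M_def)
  have M2: "int M \<le> int M ^ 2" by (cases "M = 0") (auto simp: power2_eq_square)
  have "\<bar>a i\<bar> \<le> int M" for i
  proof (cases "i \<in> {1..n}")
    case True
    have "nat \<bar>a i\<bar> \<le> (\<Sum>i\<in>{1..n}. nat \<bar>a i\<bar>)" by (rule member_le_sum[OF True]) auto
    then have "nat \<bar>a i\<bar> \<le> M" unfolding M_def by linarith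
    then show ?thesis by linarith
  qed (use r in simp)
  moreover have "\<bar>b j k\<bar> \<le> int M" for j k
  proof (cases "(j, k) \<in> {1..n} \<times> {1..n}")
    case True
    have "nat \<bar>b j k\<bar> \<le> (\<Sum>(j, k)\<in>{1..n} \<times> {1..n}. nat \<bar>b j k\<bar>)"
      using member_le_sum[OF True, of "\<lambda>(j, k). nat \<bar>b j k\<bar>"] by simp
    then have "nat \<bar>b j k\<bar> \<le> M" unfolding M_def by linarith
    then show ?thesis by linarith
  qed (use r in auto)
  moreover from this have "\<bar>b j k\<bar> \<le> int M ^ 2" for j k using M2 by (meson order_trans)
  ultimately have "r \<in> nil2_ball n M" using insert(4) by (simp add: e nil2_ball_def)
  moreover have "nil2_ball n m \<subseteq> nil2_ball n M"
    using mM power_mono[of "int m" "int M" 2] by (fastforce simp: nil2_ball_def intro: order_trans)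
  ultimately show ?case using m by blast
qed auto

lemma fst_mult_free_nil2: "fst (r \<otimes>\<^bsub>free_nil2 n\<^esub> s) = (\<lambda>i. fst r i + fst s i)"
  by (auto simp: free_nil2_def split: prod.splits)

lemma fst_inv_free_nil2:
  assumes "r \<in> carrier (free_nil2 n)"
  shows "fst (inv\<^bsub>free_nil2 n\<^esub> r) = (\<lambda>i. - fst r i)"
proof -
  have "fst (inv\<^bsub>free_nil2 n\<^esub> r \<otimes>\<^bsub>free_nil2 n\<^esub> r) = (\<lambda>i. 0)"
    using group.l_inv[OF group_free_nil2 assms] by (simp add: free_nil2_def)
  then show ?thesis by (simp add: fst_mult_free_nil2 fun_eq_iff eq_neg_iff_add_eq_0)
qed

text \<open>\<open>fst\<close> is a homomorphism into an abelian group, so it kills commutators, and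
  its kernel is the center.\<close>

lemma commutator_free_nil2:
  assumes n: "n \<ge> 2" and r: "r \<in> carrier (free_nil2 n)" and s: "s \<in> carrier (free_nil2 n)"
  shows "inv\<^bsub>free_nil2 n\<^esub> r \<otimes>\<^bsub>free_nil2 n\<^esub> s \<otimes>\<^bsub>free_nil2 n\<^esub> r \<otimes>\<^bsub>free_nil2 n\<^esub> inv\<^bsub>free_nil2 n\<^esub> s \<in> mult_center (free_nil2 n)"
    (is "?c \<in> _")
proof -
  interpret group "free_nil2 n" by (rule group_free_nil2)
  obtain a b where c: "?c = (a, b)" by fastforce
  have "?c \<in> carrier (free_nil2 n)" using r s by simp
  moreover have "fst ?c = (\<lambda>i. 0)" using r s by (simp add: fst_mult_free_nil2 fst_inv_free_nil2)
  ultimately show ?thesis unfolding c center_free_nil2[OF n] by simp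
qed

lemma center_free_nil2_torsion_free:
  assumes n: "n \<ge> 2" and z: "z \<in> mult_center (free_nil2 n)" and m: "0 < m" and one: "z [^]\<^bsub>free_nil2 n\<^esub> (m::nat) = \<one>\<^bsub>free_nil2 n\<^esub>"
  shows "z = \<one>\<^bsub>free_nil2 n\<^esub>"
proof -
  obtain b where zb: "z = (\<lambda>i. 0, b)" and zc: "z \<in> carrier (free_nil2 n)"
    using z unfolding center_free_nil2[OF n] by auto
  have "z [^]\<^bsub>free_nil2 n\<^esub> (k::nat) = (\<lambda>i. 0, \<lambda>j l. int k * b j l)" for k
  proof (induction k)
    case 0
    show ?case by (simp add: nat_pow_def free_nil2_def)
  next
    case (Suc k)
    then show ?case using zc
      by (auto simp: nat_pow_def zb free_nil2_def fun_eq_iff algebra_simps)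
  qed
  then have "(\<lambda>j l. int m * b j l) = (\<lambda>j l. 0)" using one by (simp add: free_nil2_def)
  then have "b j l = 0" for j l using m by (auto simp: fun_eq_iff)
  then show ?thesis by (simp add: zb free_nil2_def fun_eq_iff)
qed

lemma nil2_twisted_group_free_nil2:
  assumes "n \<ge> 2" and "\<And>i j k. 1 \<le> i \<Longrightarrow> i \<le> k \<Longrightarrow> 1 \<le> j \<Longrightarrow> j < k \<Longrightarrow> k \<le> n \<Longrightarrow> cmod (l i j k) = 1"
  shows "nil2_twisted_group (free_nil2 n) (nil2_cocycle n l) (nil2_ball n) (3 ^ (n + n * n)) (n + 2 * n * n)"
proof -
  interpret twisted_group "free_nil2 n" "nil2_cocycle n l" by (rule twisted_group_free_nil2) (fact assms(2))
  show ?thesis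
  proof unfold_locales
    show "nil2_ball n m \<subseteq> carrier (free_nil2 n)" for m by (auto simp: nil2_ball_def)
  qed (fact nil2_ball_card nil2_ball_mult nil2_ball_exhaust commutator_free_nil2[OF assms(1)]
      center_free_nil2_torsion_free[OF assms(1)])+
qed

theorem theorem4p4:
  fixes n :: nat and l :: "nat \<Rightarrow> nat \<Rightarrow> nat \<Rightarrow> complex"
  assumes "n \<ge> 2"
    and "\<And>i j k. 1 \<le> i \<Longrightarrow> i \<le> k \<Longrightarrow> 1 \<le> j \<Longrightarrow> j < k \<Longrightarrow> k \<le> n \<Longrightarrow> cmod (l i j k) = 1"
  shows "(simple_cstar (twisted_cstar (free_nil2 n) (nil2_cocycle n l)) \<longleftrightarrow>
          trivial_center (twisted_cstar (free_nil2 n) (nil2_cocycle n l))) \<and>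
         (trivial_center (twisted_cstar (free_nil2 n) (nil2_cocycle n l)) \<longleftrightarrow>
          \<not> (\<exists>r. r \<in> mult_center (free_nil2 n) \<and> r \<noteq> \<one>\<^bsub>free_nil2 n\<^esub> \<and>
                 cocycle_regular (free_nil2 n) (nil2_cocycle n l) r))"
proof -
  interpret nil2_twisted_group "free_nil2 n" "nil2_cocycle n l" "nil2_ball n" "3 ^ (n + n * n)" "n + 2 * n * n"
    by (rule nil2_twisted_group_free_nil2[OF assms])
  \<comment> \<open>One case split yields all equivalences: a nontrivial central regular element
    destroys both simplicity and triviality of the center, and its absence gives both.\<close>
  show ?thesis
  proof (cases "\<exists>r. r \<in> mult_center (free_nil2 n) \<and> r \<noteq> \<one>\<^bsub>free_nil2 n\<^esub> \<and>
      cocycle_regular (free_nil2 n) (nil2_cocycle n l) r")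
    case True
    then obtain r where r: "r \<in> mult_center (free_nil2 n)" "r \<noteq> \<one>\<^bsub>free_nil2 n\<^esub>"
      "cocycle_regular (free_nil2 n) (nil2_cocycle n l) r" by blast
    have "r [^]\<^bsub>free_nil2 n\<^esub> j \<noteq> \<one>\<^bsub>free_nil2 n\<^esub>" if "0 < j" for j :: nat
      using center_torsion_free[OF r(1) that] r(2) by blast
    from not_simple_and_center_of_central_regular[OF r(1,3) this] True show ?thesis by blast
  next
    case False
    then have nr: "\<not> cocycle_regular (free_nil2 n) (nil2_cocycle n l) z"
      if "z \<in> mult_center (free_nil2 n)" "z \<noteq> \<one>\<^bsub>free_nil2 n\<^esub>" for z using that by blast
    show ?thesis using trivial_center_twisted_cstar[OF nr] simple_twisted_cstar[OF nr] False by blast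
  qed
qed

end
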